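(* For each $n\in\mathbb N^*$ and $\Delta t>0$, the implicit Euler approximation $\widetilde\Phi^n=(I+\Delta tA)^{-n}\Phi(0,\cdot)$ of $\Phi'+A\Phi=0$ satisfies $$\bigl\|\widetilde\Phi^n\bigr\|_{\mathcal E}^2=\sum_{k=1}^\infty\frac{|\langle\Phi(0,\cdot),\phi_k\rangle_{\mathcal E}|^2}{(1+\omega_k^2\Delta t^2)^n}.$$ Moreover, $$\|(I+\Delta tA)^{-n}\|_{\mathcal L(\mathcal E)}=\bigl(1+\omega_{\min}^2\Delta t^2\bigr)^{-n/2}<1,\qquad \omega_{\min}:=\inf_{k\in\mathbb N^*}|\omega_k|=\sqrt{N\pi^2+\alpha}>0,$$ the infimum being attained at the multi-index $(1,1,\dots,1)\in(\mathbb N^* )^N$. Consequently: (i) if $\Phi(0,\cdot)\neq0$, then $\|\widetilde\Phi^n\|_{\mathcal E}<\|\Phi(0,\cdot)\|_{\mathcal E}$; (ii) for every $k\in\mathbb N^*$, $$\bigl|\langle\widetilde\Phi^n,\phi_k\rangle_{\mathcal E}\bigr|=\frac{|\langle\Phi(0,\cdot),\phi_k\rangle_{\mathcal E}|}{(1+\omega_k^2\Delta t^2)^{n/2}}\le\frac{|\langle\Phi(0,\cdot),\phi_k\rangle_{\mathcal E}|}{(|\omega_k|\Delta t)^n}.$$ (In particular, for modes with $|\omega_k|\Delta t\gg1$ the amplitude is suppressed by a factor of order $(|\omega_k|\Delta t)^{-n}$.)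
   Context: $\Omega=(0,1)^N$, $\alpha\ge0$ real, $\mathbb N^*=\{1,2,\dots\}$. $\mathcal E=H_0^1(\Omega)\times L^2(\Omega)$ (complex-valued functions) with inner product $\langle(u_1,z_1),(u_2,z_2)\rangle_{\mathcal E}=\int_\Omega(\nabla u_1\cdot\overline{\nabla u_2}+\alpha u_1\overline{u_2})dx+\int_\Omega z_1\overline{z_2}\,dx$. The operator $A$ has domain $D(A)=(H^2(\Omega)\cap H_0^1(\Omega))\times H_0^1(\Omega)$ and $A(u,z)=(-z,-\Delta u+\alpha u)$; it is skew-adjoint. It has an orthonormal basis of eigenfunctions of $\mathcal E$, namely, for $k\in(\mathbb N^* )^N$, $\phi_k^\pm=2^{-1/2}(e_k/\lambda_k^\pm,\,-e_k)$ with eigenvalues $\lambda_k^\pm=\pm\mathbf i\sqrt{\pi^2\sum_jk_j^2+\alpha}$, where $e_k(x)=2^{N/2}\prod_j\sin(k_j\pi x_j)$. These are enumerated as a single sequence $(\lambda_k,\phi_k)_{k\in\mathbb N^*}$ (multi-indices ordered by increasing $\sum_jk_j^2$, ties lexicographically, each contributing first its $+$ and then its $-$ branch), and one writes $\lambda_k=\mathbf i\omega_k$, $\omega_k\in\mathbb R$. $\Phi(0,\cdot)\in\mathcal E$ is the initial datum, and $\mathcal L(\mathcal E)$ denotes bounded linear operators on $\mathcal E$ with the operator norm. *)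

theory Defs
  imports "HOL-Analysis.Analysis" "HOL-Library.Fun_Lexorder"
begin

section \<open>The space of square integrable functions on the open unit cube\<close>

definition cube :: "(real ^ 'n) set" where
  "cube = box 0 1"

abbreviation cube_measure :: "(real ^ 'n) measure" where
  "cube_measure \<equiv> lebesgue_on cube"

lemma sets_cube [measurable, simp]: "cube \<in> sets lebesgue"
  by (simp add: cube_def)

definition square_integrable :: "(real ^ 'n \<Rightarrow> complex) \<Rightarrow> bool" where
  "square_integrable f \<longleftrightarrow> f \<in> borel_measurable cube_measure \<and>
     integrable cube_measure (\<lambda>x. (cmod (f x))\<^sup>2)"

definition L2_eq :: "(real ^ 'n \<Rightarrow> complex) \<Rightarrow> (real ^ 'n \<Rightarrow> complex) \<Rightarrow> bool" where
  "L2_eq f g \<longleftrightarrow> square_integrable f \<and> square_integrable g \<and>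
     (AE x in cube_measure. f x = g x)"

lemma square_integrable_zero: "square_integrable (\<lambda>x. 0)"
  by (simp add: square_integrable_def)

lemma square_integrable_cmult:
  assumes "square_integrable f" shows "square_integrable (\<lambda>x. c * f x)"
  using assms by (auto simp: square_integrable_def norm_mult power_mult_distrib)

lemma square_integrable_add:
  assumes "square_integrable f" "square_integrable g"
  shows "square_integrable (\<lambda>x. f x + g x)"
  unfolding square_integrable_def
proof
  have [measurable]: "f \<in> borel_measurable cube_measure" "g \<in> borel_measurable cube_measure"
    using assms by (auto simp: square_integrable_def)
  show "(\<lambda>x. f x + g x) \<in> borel_measurable cube_measure" by measurable
  have "integrable cube_measure (\<lambda>x. 2 * (cmod (f x))\<^sup>2 + 2 * (cmod (g x))\<^sup>2)"
    using assms by (auto simp: square_integrable_def)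
  then show "integrable cube_measure (\<lambda>x. (cmod (f x + g x))\<^sup>2)"
  proof (rule Bochner_Integration.integrable_bound)
    show "(\<lambda>x. (cmod (f x + g x))\<^sup>2) \<in> borel_measurable cube_measure" by measurable
    have "(cmod (f x + g x))\<^sup>2 \<le> 2 * (cmod (f x))\<^sup>2 + 2 * (cmod (g x))\<^sup>2" for x
    proof -
      have "(cmod (f x + g x))\<^sup>2 \<le> (cmod (f x) + cmod (g x))\<^sup>2"
        by (simp add: norm_triangle_ineq power_mono)
      also have "\<dots> \<le> 2 * (cmod (f x))\<^sup>2 + 2 * (cmod (g x))\<^sup>2"
        using sum_squares_bound[of "cmod (f x)" "cmod (g x)"] by (simp add: power2_sum)
      finally show ?thesis .
    qed
    then show "AE x in cube_measure. norm ((cmod (f x + g x))\<^sup>2)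
        \<le> norm (2 * (cmod (f x))\<^sup>2 + 2 * (cmod (g x))\<^sup>2)" by auto
  qed
qed

quotient_type 'n L2_cube = "real ^ ('n::finite) \<Rightarrow> complex" / partial: L2_eq
proof (rule part_equivpI)
  show "\<exists>f :: real ^ 'n \<Rightarrow> complex. L2_eq f f"
    using square_integrable_zero by (auto simp: L2_eq_def)
  show "symp (L2_eq :: (real ^ 'n \<Rightarrow> complex) \<Rightarrow> _)"
    by (auto simp: L2_eq_def symp_def)
  show "transp (L2_eq :: (real ^ 'n \<Rightarrow> complex) \<Rightarrow> _)"
    unfolding transp_def L2_eq_def by (auto elim: AE_mp)
qed

text \<open>\<open>abs_L2_cube f\<close> is the class of \<open>f\<close>; it is meaningful only for square integrable \<open>f\<close>.\<close>

lift_definition cscale :: "complex \<Rightarrow> 'n L2_cube \<Rightarrow> 'n::finite L2_cube"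
  is "\<lambda>c f x. c * f x"
  by (auto simp: L2_eq_def square_integrable_cmult)

instantiation L2_cube :: (finite) real_vector
begin

lift_definition zero_L2_cube :: "'a L2_cube" is "\<lambda>x. 0"
  by (simp add: L2_eq_def square_integrable_zero)

lift_definition plus_L2_cube :: "'a L2_cube \<Rightarrow> 'a L2_cube \<Rightarrow> 'a L2_cube"
  is "\<lambda>f g x. f x + g x"
  by (auto simp: L2_eq_def square_integrable_add)

definition scaleR_L2_cube :: "real \<Rightarrow> 'a L2_cube \<Rightarrow> 'a L2_cube"
  where "scaleR_L2_cube r u = cscale (of_real r) u"

definition uminus_L2_cube :: "'a L2_cube \<Rightarrow> 'a L2_cube"
  where "uminus_L2_cube u = cscale (- 1) u"

definition minus_L2_cube :: "'a L2_cube \<Rightarrow> 'a L2_cube \<Rightarrow> 'a L2_cube"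
  where "minus_L2_cube u v = u + - v"

instance
proof
  fix a b :: real and u v w :: "'a L2_cube"
  show "u + v + w = u + (v + w)"
    by transfer (auto simp: L2_eq_def square_integrable_add add.assoc)
  show "u + v = v + u"
    by transfer (auto simp: L2_eq_def square_integrable_add add.commute)
  show "0 + u = u"
    by transfer (auto simp: L2_eq_def)
  show "- u + u = 0"
    unfolding uminus_L2_cube_def
    by transfer (auto simp: L2_eq_def square_integrable_zero)
  show "u - v = u + - v"
    by (rule minus_L2_cube_def)
  show "a *\<^sub>R (u + v) = a *\<^sub>R u + a *\<^sub>R v"
    unfolding scaleR_L2_cube_def
    by transfer (auto simp: L2_eq_def square_integrable_add square_integrable_cmult
        distrib_left)
  show "(a + b) *\<^sub>R u = a *\<^sub>R u + b *\<^sub>R u"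
    unfolding scaleR_L2_cube_def
    by transfer (auto simp: L2_eq_def square_integrable_add square_integrable_cmult
        distrib_right)
  show "a *\<^sub>R b *\<^sub>R u = (a * b) *\<^sub>R u"
    unfolding scaleR_L2_cube_def
    by transfer (auto simp: L2_eq_def square_integrable_cmult mult.assoc)
  show "1 *\<^sub>R u = u"
    unfolding scaleR_L2_cube_def
    by transfer (auto simp: L2_eq_def)
qed

end

lift_definition L2_inner :: "'n L2_cube \<Rightarrow> 'n::finite L2_cube \<Rightarrow> complex"
  is "\<lambda>f g. LINT x|cube_measure. f x * cnj (g x)"
proof -
  fix f f' g g' :: "real ^ 'n \<Rightarrow> complex"
  assume *: "L2_eq f f'" "L2_eq g g'"
  have [measurable]: "f \<in> borel_measurable cube_measure" "f' \<in> borel_measurable cube_measure"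
    "g \<in> borel_measurable cube_measure" "g' \<in> borel_measurable cube_measure"
    using * by (auto simp: L2_eq_def square_integrable_def)
  have [measurable]: "(\<lambda>x. cnj (g x)) \<in> borel_measurable cube_measure"
    "(\<lambda>x. cnj (g' x)) \<in> borel_measurable cube_measure"
    by (auto intro!: borel_measurable_continuous_on[where f = cnj] continuous_intros)
  show "(LINT x|cube_measure. f x * cnj (g x)) = (LINT x|cube_measure. f' x * cnj (g' x))"
  proof (rule integral_cong_AE)
    show "AE x in cube_measure. f x * cnj (g x) = f' x * cnj (g' x)"
      using * by (auto simp: L2_eq_def)
  qed measurable
qed

definition L2_norm :: "'n::finite L2_cube \<Rightarrow> real" where
  "L2_norm u = sqrt (Re (L2_inner u u))"


section \<open>Weak derivatives and Sobolev spaces\<close>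

definition pderiv_cl :: "'n \<Rightarrow> (real ^ 'n \<Rightarrow> complex) \<Rightarrow> real ^ 'n::finite \<Rightarrow> complex" where
  "pderiv_cl i f x = frechet_derivative f (at x) (axis i 1)"

fun Ck :: "nat \<Rightarrow> (real ^ 'n::finite \<Rightarrow> complex) \<Rightarrow> bool" where
  "Ck 0 f \<longleftrightarrow> continuous_on UNIV f"
| "Ck (Suc m) f \<longleftrightarrow> (\<forall>x. f differentiable (at x)) \<and> (\<forall>i. Ck m (pderiv_cl i f))"

text \<open>A function in \<open>C\<^sub>c\<^sup>\<infinity>\<close> of the open cube is represented by its extension by zero
  to the whole space.\<close>

definition test_fun :: "(real ^ 'n::finite \<Rightarrow> complex) \<Rightarrow> bool" where
  "test_fun \<phi> \<longleftrightarrow> (\<forall>m. Ck m \<phi>) \<and>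
     compact (closure {x. \<phi> x \<noteq> 0}) \<and> closure {x. \<phi> x \<noteq> 0} \<subseteq> cube"

lemma continuous_imp_cube_measurable:
  fixes f :: "real ^ 'n::finite \<Rightarrow> complex"
  assumes "continuous_on UNIV f" shows "f \<in> borel_measurable cube_measure"
  using assms
  by (intro continuous_imp_measurable_on_sets_lebesgue)
     (auto intro: continuous_on_subset)

lemma test_fun_measurable:
  assumes "test_fun \<phi>"
  shows "\<phi> \<in> borel_measurable cube_measure" "pderiv_cl i \<phi> \<in> borel_measurable cube_measure"
proof -
  have "Ck 0 \<phi>" "Ck (Suc 0) \<phi>"
    using assms unfolding test_fun_def by blast+
  then show "\<phi> \<in> borel_measurable cube_measure" "pderiv_cl i \<phi> \<in> borel_measurable cube_measure"
    by (auto intro!: continuous_imp_cube_measurable)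
qed

lift_definition weak_pderiv :: "'n \<Rightarrow> 'n L2_cube \<Rightarrow> 'n::finite L2_cube \<Rightarrow> bool"
  is "\<lambda>i f g. \<forall>\<phi>. test_fun \<phi> \<longrightarrow>
        (LINT x|cube_measure. f x * pderiv_cl i \<phi> x) = - (LINT x|cube_measure. g x * \<phi> x)"
proof -
  fix i :: 'n and f f' g g' :: "real ^ 'n \<Rightarrow> complex"
  assume *: "L2_eq f f'" "L2_eq g g'"
  have [measurable]: "f \<in> borel_measurable cube_measure" "f' \<in> borel_measurable cube_measure"
    "g \<in> borel_measurable cube_measure" "g' \<in> borel_measurable cube_measure"
    using * by (auto simp: L2_eq_def square_integrable_def)
  have "(LINT x|cube_measure. f x * pderiv_cl i \<phi> x) = (LINT x|cube_measure. f' x * pderiv_cl i \<phi> x)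
    \<and> (LINT x|cube_measure. g x * \<phi> x) = (LINT x|cube_measure. g' x * \<phi> x)"
    if "test_fun \<phi>" for \<phi>
  proof -
    note [measurable] = test_fun_measurable[OF that]
    show ?thesis
      using * by (auto intro!: integral_cong_AE simp: L2_eq_def)
  qed
  then show "(\<forall>\<phi>. test_fun \<phi> \<longrightarrow>
        (LINT x|cube_measure. f x * pderiv_cl i \<phi> x) = - (LINT x|cube_measure. g x * \<phi> x)) \<longleftrightarrow>
      (\<forall>\<phi>. test_fun \<phi> \<longrightarrow>
        (LINT x|cube_measure. f' x * pderiv_cl i \<phi> x) = - (LINT x|cube_measure. g' x * \<phi> x))"
    by simp
qed

text \<open>Weak derivatives are unique when they exist, so \<open>pd i u\<close> is the weak derivative for
  \<open>u\<close> in \<open>H1\<close> and meaningless otherwise.\<close>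

definition pd :: "'n \<Rightarrow> 'n L2_cube \<Rightarrow> 'n::finite L2_cube" where
  "pd i u = (THE v. weak_pderiv i u v)"

definition H1 :: "'n::finite L2_cube set" where
  "H1 = {u. \<forall>i. \<exists>v. weak_pderiv i u v}"

definition H2 :: "'n::finite L2_cube set" where
  "H2 = {u \<in> H1. \<forall>i. pd i u \<in> H1}"

definition H1_norm :: "'n::finite L2_cube \<Rightarrow> real" where
  "H1_norm u = sqrt ((L2_norm u)\<^sup>2 + (\<Sum>i\<in>UNIV. (L2_norm (pd i u))\<^sup>2))"

definition H10 :: "'n::finite L2_cube set" where
  "H10 = {u \<in> H1. \<forall>\<epsilon>>0. \<exists>\<phi>. test_fun \<phi> \<and> H1_norm (u - abs_L2_cube \<phi>) < \<epsilon>}"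

definition laplacian :: "'n L2_cube \<Rightarrow> 'n::finite L2_cube" where
  "laplacian u = (\<Sum>i\<in>UNIV. pd i (pd i u))"


section \<open>The energy space and the operator\<close>

type_synonym 'n state = "'n L2_cube \<times> 'n L2_cube"

definition energy_space :: "'n::finite state set" where
  "energy_space = H10 \<times> UNIV"

definition energy_inner :: "real \<Rightarrow> 'n::finite state \<Rightarrow> 'n state \<Rightarrow> complex" where
  "energy_inner \<alpha> U V =
     (\<Sum>i\<in>UNIV. L2_inner (pd i (fst U)) (pd i (fst V)))
     + of_real \<alpha> * L2_inner (fst U) (fst V) + L2_inner (snd U) (snd V)"

definition energy_norm :: "real \<Rightarrow> 'n::finite state \<Rightarrow> real" where
  "energy_norm \<alpha> U = sqrt (Re (energy_inner \<alpha> U U))"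

definition cscale_state :: "complex \<Rightarrow> 'n::finite state \<Rightarrow> 'n state" where
  "cscale_state c U = (cscale c (fst U), cscale c (snd U))"

definition dom_A :: "'n::finite state set" where
  "dom_A = (H2 \<inter> H10) \<times> H10"

definition op_A :: "real \<Rightarrow> 'n::finite state \<Rightarrow> 'n state" where
  "op_A \<alpha> U = (- snd U, - laplacian (fst U) + \<alpha> *\<^sub>R fst U)"

definition bounded_operators :: "real \<Rightarrow> ('n::finite state \<Rightarrow> 'n state) set" where
  "bounded_operators \<alpha> = {T.
     (\<forall>U\<in>energy_space. T U \<in> energy_space) \<and>
     (\<forall>U\<in>energy_space. \<forall>V\<in>energy_space. T (U + V) = T U + T V) \<and>
     (\<forall>c. \<forall>U\<in>energy_space. T (cscale_state c U) = cscale_state c (T U)) \<and>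
     (\<exists>C. \<forall>U\<in>energy_space. energy_norm \<alpha> (T U) \<le> C * energy_norm \<alpha> U)}"

definition operator_norm :: "real \<Rightarrow> ('n::finite state \<Rightarrow> 'n state) \<Rightarrow> real" where
  "operator_norm \<alpha> T =
     (SUP U\<in>{U \<in> energy_space. energy_norm \<alpha> U \<le> 1}. energy_norm \<alpha> (T U))"

definition euler_map :: "real \<Rightarrow> real \<Rightarrow> 'n::finite state \<Rightarrow> 'n state" where
  "euler_map \<alpha> \<Delta>t U = U + \<Delta>t *\<^sub>R op_A \<alpha> U"

text \<open>The inverse of \<open>I + \<Delta>t A\<close>, an unbounded operator with domain \<open>dom_A\<close>, and its powers.
  They are meaningful on \<open>energy_space\<close> only, and only if \<open>I + \<Delta>t A\<close> maps \<open>dom_A\<close>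
  bijectively onto \<open>energy_space\<close>.\<close>

definition euler_inv :: "real \<Rightarrow> real \<Rightarrow> 'n::finite state \<Rightarrow> 'n state" where
  "euler_inv \<alpha> \<Delta>t = inv_into dom_A (euler_map \<alpha> \<Delta>t)"

definition euler_inv_pow :: "real \<Rightarrow> real \<Rightarrow> nat \<Rightarrow> 'n::finite state \<Rightarrow> 'n state" where
  "euler_inv_pow \<alpha> \<Delta>t n = euler_inv \<alpha> \<Delta>t ^^ n"


section \<open>Eigenvalues, eigenfunctions and their enumeration\<close>

type_synonym 'n multi_nat = "(nat, 'n) vec"

definition multi_indices :: "'n::finite multi_nat set" where
  "multi_indices = {\<kappa>. \<forall>j. 1 \<le> \<kappa> $ j}"

definition sq_sum :: "'n::finite multi_nat \<Rightarrow> nat" where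
  "sq_sum \<kappa> = (\<Sum>j\<in>UNIV. (\<kappa> $ j)\<^sup>2)"

text \<open>The linear order on the index type \<open>'n\<close> plays the role of the order of the coordinates
  \<open>1, \<dots>, N\<close> in the lexicographic comparison.\<close>

definition precedes :: "'n::{finite,linorder} multi_nat \<Rightarrow> 'n multi_nat \<Rightarrow> bool" where
  "precedes \<kappa> \<mu> \<longleftrightarrow> sq_sum \<kappa> < sq_sum \<mu> \<or>
     (sq_sum \<kappa> = sq_sum \<mu> \<and> less_fun (($) \<kappa>) (($) \<mu>))"

definition predecessors :: "'n::{finite,linorder} multi_nat \<Rightarrow> 'n multi_nat set" where
  "predecessors \<kappa> = {\<mu> \<in> multi_indices. precedes \<mu> \<kappa>}"

text \<open>The increasing enumeration of the multi-indices, starting with number 0.\<close>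

definition multi_index :: "nat \<Rightarrow> 'n::{finite,linorder} multi_nat" where
  "multi_index m = (THE \<kappa>. \<kappa> \<in> multi_indices \<and> card (predecessors \<kappa>) = m)"

definition eigval_branch :: "real \<Rightarrow> bool \<Rightarrow> 'n::finite multi_nat \<Rightarrow> complex" where
  "eigval_branch \<alpha> pos \<kappa> =
     (if pos then 1 else - 1) * \<i> * of_real (sqrt (pi\<^sup>2 * real (sq_sum \<kappa>) + \<alpha>))"

definition sine_fun :: "'n multi_nat \<Rightarrow> real ^ 'n \<Rightarrow> complex" where
  "sine_fun \<kappa> x = of_real (2 powr (real CARD('n) / 2) *
     (\<Prod>j\<in>UNIV. sin (real (\<kappa> $ j) * pi * x $ j)))"

definition eigfun_branch :: "real \<Rightarrow> bool \<Rightarrow> 'n::finite multi_nat \<Rightarrow> 'n state" where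
  "eigfun_branch \<alpha> pos \<kappa> = cscale_state (of_real (1 / sqrt 2))
     (cscale (1 / eigval_branch \<alpha> pos \<kappa>) (abs_L2_cube (sine_fun \<kappa>)),
      - abs_L2_cube (sine_fun \<kappa>))"

text \<open>The single sequence is indexed by \<open>k \<ge> 1\<close>: multi-index number \<open>m\<close> contributes its plus
  branch at \<open>k = 2 * m + 1\<close> and its minus branch at \<open>k = 2 * m + 2\<close>. The type argument
  carries the dimension.\<close>

definition mode_index :: "nat \<Rightarrow> 'n::{finite,linorder} multi_nat" where
  "mode_index k = multi_index ((k - 1) div 2)"

definition eigval :: "'n::{finite,linorder} itself \<Rightarrow> real \<Rightarrow> nat \<Rightarrow> complex" where
  "eigval _ \<alpha> k = eigval_branch \<alpha> (odd k) (mode_index k :: 'n multi_nat)"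

definition eigfun :: "real \<Rightarrow> nat \<Rightarrow> 'n::{finite,linorder} state" where
  "eigfun \<alpha> k = eigfun_branch \<alpha> (odd k) (mode_index k)"

definition omega :: "'n::{finite,linorder} itself \<Rightarrow> real \<Rightarrow> nat \<Rightarrow> real" where
  "omega N \<alpha> k = Im (eigval N \<alpha> k)"

lemma eigval_eq_omega: "eigval N \<alpha> k = \<i> * of_real (omega N \<alpha> k)"
  by (simp add: omega_def eigval_def eigval_branch_def complex_eq_iff)

definition omega_min :: "'n::{finite,linorder} itself \<Rightarrow> real \<Rightarrow> real" where
  "omega_min N \<alpha> = (INF k\<in>{1..}. \<bar>omega N \<alpha> k\<bar>)"

end

theory Submission
  imports Defs "HOL-Computational_Algebra.Polynomial"
begin

text \<open>
  The sines diagonalise the operator. A state \<open>(u, z)\<close> of finite energy is determined by the sine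
  coefficients of \<open>u\<close> and \<open>z\<close>, and for each multi-index the two numbers that pair \<open>(u, z)\<close> with the
  eigenfunctions \<open>\<phi>\<^sup>+\<close> and \<open>\<phi>\<^sup>-\<close> arise from \<open>\<omega>\<close> times the coefficient of \<open>u\<close> and from the
  coefficient of \<open>z\<close> by a unitary map of \<open>\<complex>\<^sup>2\<close>. Parseval's identity for \<open>z\<close>, for \<open>u\<close> and for the gradient
  of \<open>u\<close> therefore adds up to Parseval's identity for the energy (\<open>energy_Parseval\<close>). In these coordinates
  one implicit Euler step divides each coefficient by \<open>1 + \<Delta>t \<lambda>\<close>
  (\<open>energy_inner_euler_map\<close>), a number of modulus \<open>sqrt (1 + \<omega>\<^sup>2 \<Delta>t\<^sup>2)\<close> because the eigenvalue
  \<open>\<lambda>\<close> is imaginary. The norm of a power of the resolvent is thus a weighted sum of squares. The largest weight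
  belongs to the lowest frequency, that is to the multi-index \<open>(1, \<dots>, 1)\<close>, whose eigenfunction
  attains the operator norm. That \<open>I + \<Delta>t A\<close> is onto (\<open>euler_map_bij\<close>) amounts to solving
  \<open>(1 + \<Delta>t\<^sup>2 (\<alpha> - \<Delta>)) u = h\<close> in \<open>H2 \<inter> H10\<close> for square integrable \<open>h\<close>; dividing the sine
  coefficients of \<open>h\<close> by \<open>1 + \<Delta>t\<^sup>2 \<omega>\<^sup>2\<close> gains the two derivatives that \<open>H2\<close> requires.

  The analysis rests on three facts about the sine system. It is complete (\<open>sine_system_complete\<close>): in one
  variable, \<open>sin (\<pi> t)\<close> times a polynomial in \<open>cos (\<pi> t)\<close> is a combination of sines, so that
  Weierstrass' theorem leads to all step functions, and the variables can be treated one after the other. Every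
  sine is a limit of test functions in the norm of \<open>H1\<close> (\<open>mode_test_approximation\<close>). Consequently
  a function orthogonal to all test functions is orthogonal to all sines and vanishes, which makes weak derivatives
  unique (\<open>weak_pderiv_unique\<close>). Finally, for \<open>u\<close> in \<open>H10\<close> the sine series may be differentiated
  term by term (\<open>H10_pd_expansion\<close>): the cosine coefficients of a partial derivative are multiples of the
  sine coefficients of \<open>u\<close>, by Bessel's inequality and the completeness of the space of square integrable functions
  the differentiated series converges, and its sum is a weak derivative of \<open>u\<close>, hence the only one.
\<close>


section \<open>Smooth functions on the line\<close>

text \<open>Membership in \<open>C\<^sup>m\<close>. Asking for some derivative instead of fixing one lets the closure properties be
  proved by induction on \<open>m\<close> with the derivative given by the usual rules.\<close>

fun smooth_upto :: "nat \<Rightarrow> (real \<Rightarrow> real) \<Rightarrow> bool" where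
  "smooth_upto 0 f \<longleftrightarrow> continuous_on UNIV f"
| "smooth_upto (Suc m) f \<longleftrightarrow>
     (\<exists>f'. (\<forall>x. (f has_real_derivative f' x) (at x)) \<and> smooth_upto m f')"

definition smooth :: "(real \<Rightarrow> real) \<Rightarrow> bool" where
  "smooth f \<longleftrightarrow> (\<forall>m. smooth_upto m f)"

lemma smooth_upto_SucI:
  assumes "\<And>x. (f has_real_derivative f' x) (at x)" "smooth_upto m f'"
  shows "smooth_upto (Suc m) f"
  using assms by auto

lemma smooth_upto_Suc_imp: "smooth_upto (Suc m) f \<Longrightarrow> smooth_upto m f"
proof (induction m arbitrary: f)
  case 0
  then show ?case
    by (auto simp: continuous_on_eq_continuous_at intro: DERIV_isCont)
next
  case (Suc m)
  then show ?case by (metis smooth_upto.simps(2))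
qed

lemma smooth_deriv:
  assumes "smooth f"
  shows "(f has_real_derivative deriv f x) (at x)" "smooth (deriv f)"
proof -
  have "\<exists>f'. (\<forall>x. (f has_real_derivative f' x) (at x)) \<and> smooth_upto m f'" for m
    using assms by (metis smooth_def smooth_upto.simps(2))
  then have *: "(\<forall>x. (f has_real_derivative deriv f x) (at x)) \<and> smooth_upto m (deriv f)" for m
    by (metis DERIV_imp_deriv ext)
  then show "(f has_real_derivative deriv f x) (at x)" "smooth (deriv f)"
    by (auto simp: smooth_def)
qed

lemma smooth_continuous: "smooth f \<Longrightarrow> continuous_on A f"
  by (metis continuous_on_subset smooth_def smooth_upto.simps(1) subset_UNIV)

lemma smooth_upto_const: "smooth_upto m (\<lambda>x. c)"
proof (induction m arbitrary: c)
  case (Suc m)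
  then show ?case by (intro smooth_upto_SucI[where f' = "\<lambda>x. 0"]) auto
qed auto

lemma smooth_upto_add:
  "smooth_upto m f \<Longrightarrow> smooth_upto m g \<Longrightarrow> smooth_upto m (\<lambda>x. f x + g x)"
proof (induction m arbitrary: f g)
  case 0
  then show ?case by (auto intro: continuous_on_add)
next
  case (Suc m)
  then obtain f' g' where
    "\<And>x. (f has_real_derivative f' x) (at x)" "smooth_upto m f'"
    "\<And>x. (g has_real_derivative g' x) (at x)" "smooth_upto m g'"
    by auto
  then show ?case
    by (intro smooth_upto_SucI[where f' = "\<lambda>x. f' x + g' x"] DERIV_add Suc.IH) auto
qed

lemma smooth_upto_mult:
  "smooth_upto m f \<Longrightarrow> smooth_upto m g \<Longrightarrow> smooth_upto m (\<lambda>x. f x * g x)"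
proof (induction m arbitrary: f g)
  case 0
  then show ?case by (auto intro: continuous_on_mult)
next
  case (Suc m)
  then obtain f' g' where *:
    "\<And>x. (f has_real_derivative f' x) (at x)" "smooth_upto m f'"
    "\<And>x. (g has_real_derivative g' x) (at x)" "smooth_upto m g'"
    by auto
  have "smooth_upto m f" "smooth_upto m g"
    using Suc.prems smooth_upto_Suc_imp by blast+
  then have "smooth_upto m (\<lambda>x. f' x * g x + g' x * f x)"
    using * by (intro smooth_upto_add Suc.IH)
  then show ?case
    by (intro smooth_upto_SucI[where f' = "\<lambda>x. f' x * g x + g' x * f x"] DERIV_mult *)
qed

lemma smooth_upto_affine:
  "smooth_upto m f \<Longrightarrow> smooth_upto m (\<lambda>x. f (a * x + b))"
proof (induction m arbitrary: f)
  case 0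
  then have "continuous_on UNIV f" by simp
  then have "continuous_on UNIV (\<lambda>x. f (a * x + b))"
    by (rule continuous_on_compose2) (auto intro!: continuous_intros)
  then show ?case by simp
next
  case (Suc m)
  then obtain f' where *: "\<And>x. (f has_real_derivative f' x) (at x)" "smooth_upto m f'"
    by auto
  have "((\<lambda>x. f (a * x + b)) has_real_derivative f' (a * x + b) * a) (at x)" for x
    by (rule DERIV_chain2[OF *(1)]) (auto intro!: derivative_eq_intros)
  moreover have "smooth_upto m (\<lambda>x. f' (a * x + b) * a)"
    by (intro smooth_upto_mult smooth_upto_const Suc.IH *)
  ultimately show ?case by (rule smooth_upto_SucI)
qed

lemma smooth_mult: "smooth f \<Longrightarrow> smooth g \<Longrightarrow> smooth (\<lambda>x. f x * g x)"
  and smooth_affine: "smooth f \<Longrightarrow> smooth (\<lambda>x. f (a * x + b))"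
  and smooth_const: "smooth (\<lambda>x. c)"
  by (simp_all add: smooth_def smooth_upto_mult smooth_upto_affine
      smooth_upto_const)

lemma smooth_antideriv:
  assumes "\<And>x. (f has_real_derivative f' x) (at x)" "smooth f'"
  shows "smooth f"
proof -
  have "smooth_upto m f" for m
    using smooth_upto_SucI[of f f' m] assms smooth_upto_Suc_imp by (auto simp: smooth_def)
  then show ?thesis by (simp add: smooth_def)
qed

lemma smooth_sin: "smooth (\<lambda>x. sin (c * x))"
proof -
  have "smooth_upto m (\<lambda>x. a * sin (c * x)) \<and> smooth_upto m (\<lambda>x. a * cos (c * x))" for m a
  proof (induction m arbitrary: a)
    case 0
    then show ?case by (auto intro!: continuous_intros)
  next
    case (Suc m)
    have "((\<lambda>x. a * sin (c * x)) has_real_derivative (a * c) * cos (c * x)) (at x)"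
      "((\<lambda>x. a * cos (c * x)) has_real_derivative (- a * c) * sin (c * x)) (at x)" for x
      by (auto intro!: derivative_eq_intros)
    then show ?case
      using Suc[of "a * c"] Suc[of "- a * c"] smooth_upto_SucI by (meson conjI)
  qed
  from this[of _ 1] show ?thesis by (simp add: smooth_def)
qed

text \<open>The factor \<open>p (1 / x)\<close> makes this family closed under differentiation, so that the smoothness of
  \<open>exp (- 1 / x)\<close>, extended by zero, follows by induction for the whole family at once.\<close>

definition exp_flat :: "real poly \<Rightarrow> real \<Rightarrow> real" where
  "exp_flat p x = (if x > 0 then poly p (1 / x) * exp (- (1 / x)) else 0)"

lemma exp_flat_tendsto_0: "(exp_flat p \<longlongrightarrow> 0) (at_right 0)"
proof -
  have "((\<lambda>t. \<Sum>i\<le>degree p. coeff p i * (t ^ i / exp t)) \<longlongrightarrow> (\<Sum>i\<le>degree p. coeff p i * 0)) at_top"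
    by (intro tendsto_sum tendsto_mult tendsto_const tendsto_power_div_exp_0)
  then have "((\<lambda>t. poly p t * exp (- t)) \<longlongrightarrow> 0) at_top"
    by (simp add: poly_altdef sum_distrib_right exp_minus divide_inverse mult.assoc)
  then have "((\<lambda>x. poly p (inverse x) * exp (- inverse x)) \<longlongrightarrow> 0) (at_right 0)"
    by (rule filterlim_compose[OF _ filterlim_inverse_at_top_right])
  then show ?thesis
    by (rule Lim_transform_eventually)
       (auto simp: exp_flat_def eventually_at_right_field inverse_eq_divide intro: exI[of _ 1])
qed

lemma exp_flat_deriv:
  "(exp_flat p has_real_derivative exp_flat ([:0, 0, 1:] * (p - pderiv p)) x) (at x)"
proof (cases x "0::real" rule: linorder_cases)
  case less
  have "((\<lambda>x. 0) has_real_derivative 0) (at x)" by simp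
  then have "(exp_flat p has_real_derivative 0) (at x)"
    by (rule has_field_derivative_transform_within_open[where S = "{..<0}"])
       (use less in \<open>auto simp: exp_flat_def\<close>)
  then show ?thesis using less by (simp add: exp_flat_def)
next
  case equal
  have "((\<lambda>y. (exp_flat p y - exp_flat p 0) / (y - 0)) \<longlongrightarrow> 0) (at_right 0)"
    by (rule Lim_transform_eventually[OF exp_flat_tendsto_0[of "[:0, 1:] * p"]])
       (auto simp: exp_flat_def eventually_at_right_field intro: exI[of _ 1])
  moreover have "((\<lambda>y. (exp_flat p y - exp_flat p 0) / (y - 0)) \<longlongrightarrow> 0) (at_left 0)"
    by (rule Lim_transform_eventually[OF tendsto_const])
       (auto simp: exp_flat_def eventually_at_left_field intro: exI[of _ "-1"])
  ultimately show ?thesis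
    using equal by (simp add: has_field_derivative_iff filterlim_split_at exp_flat_def)
next
  case greater
  have "((\<lambda>x. poly p (1 / x) * exp (- (1 / x))) has_real_derivative
      poly ([:0, 0, 1:] * (p - pderiv p)) (1 / x) * exp (- (1 / x))) (at x)"
    using greater
    by (auto intro!: derivative_eq_intros DERIV_chain2[OF poly_DERIV]
        simp: algebra_simps power2_eq_square divide_simps)
  then have "(exp_flat p has_real_derivative
      poly ([:0, 0, 1:] * (p - pderiv p)) (1 / x) * exp (- (1 / x))) (at x)"
    by (rule has_field_derivative_transform_within_open[where S = "{0<..}"])
       (use greater in \<open>auto simp: exp_flat_def\<close>)
  then show ?thesis using greater by (simp add: exp_flat_def)
qed

lemma smooth_exp_flat: "smooth (exp_flat p)"
proof -
  have "smooth_upto m (exp_flat p)" for m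
  proof (induction m arbitrary: p)
    case 0
    show ?case
      using exp_flat_deriv by (auto simp: continuous_on_eq_continuous_at intro: DERIV_isCont)
  next
    case (Suc m)
    then show ?case by (blast intro: smooth_upto_SucI exp_flat_deriv)
  qed
  then show ?thesis by (simp add: smooth_def)
qed

text \<open>An antiderivative of a bump function, divided by the mass of the bump. The bound on \<open>t * deriv h t\<close> says
  that the derivatives of the rescaled steps \<open>h (M * t)\<close> are at most \<open>K / t\<close> for \<open>t > 0\<close>, uniformly in \<open>M\<close>.\<close>

lemma smooth_step_exists:
  obtains h :: "real \<Rightarrow> real" and K where "smooth h"
    "\<And>t. t \<le> 1 \<Longrightarrow> h t = 0" "\<And>t. t \<ge> 2 \<Longrightarrow> h t = 1" "\<And>t. \<bar>h t\<bar> \<le> 1"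
    "\<And>t. t \<notin> {1..2} \<Longrightarrow> deriv h t = 0" "\<And>t. \<bar>t * deriv h t\<bar> \<le> K"
proof -
  define b where "b x = exp_flat 1 (1 * x + (- 1)) * exp_flat 1 ((- 1) * x + 2)" for x
  have b_smooth: "smooth b"
    unfolding b_def by (intro smooth_mult smooth_affine smooth_exp_flat)
  have flat01: "0 \<le> exp_flat 1 x \<and> exp_flat 1 x \<le> 1" for x
    by (simp add: exp_flat_def)
  have b01: "0 \<le> b x \<and> b x \<le> 1" for x
    using flat01 by (simp add: b_def mult_le_one)
  have b_out: "b x = 0" if "x \<le> 1 \<or> x \<ge> 2" for x
    using that by (auto simp: b_def exp_flat_def)
  have b_pos: "b x > 0" if "1 < x" "x < 2" for x
    using that by (simp add: b_def exp_flat_def)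
  have b_cont: "continuous_on A b" for A
    by (rule smooth_continuous[OF b_smooth])
  define F where "F t = integral {0..t} b" for t
  have F0: "F t = 0" if "t \<le> 1" for t
    unfolding F_def using that b_out
    by (intro integral_unique has_integral_is_0) auto
  have F_deriv: "(F has_real_derivative b t) (at t)" for t
  proof (cases "t < 1")
    case True
    have "(F has_real_derivative 0) (at t)"
      by (rule has_field_derivative_transform_within_open[where S = "{..<1}" and f = "\<lambda>x. 0"])
         (use True F0 in auto)
    then show ?thesis using True b_out by simp
  next
    case False
    have "(F has_real_derivative b t) (at t within {0..t + 1})"
      unfolding F_def using False
      by (intro integral_has_real_derivative b_cont) auto
    then show ?thesis
      using False at_within_Icc_at[of 0 t "t + 1"] by simp
  qed
  have F_mono: "F s \<le> F t" if "s \<le> t" for s t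
    using that F_deriv b01 by (intro DERIV_nonneg_imp_nondecreasing[of s t F]) auto
  have F_const: "F t = F 2" if "t \<ge> 2" for t
  proof (cases "t = 2")
    case False
    with that have "2 < t" by simp
    then obtain z where "2 < z" "F t - F 2 = (t - 2) * b z"
      using MVT2[of 2 t F b] F_deriv by blast
    then show ?thesis using b_out by simp
  qed simp
  obtain z where "1 < z" "z < 2" "F 2 - F 1 = (2 - 1) * b z"
    using MVT2[of 1 2 F b] F_deriv by auto
  then have c: "F 2 > 0" using F0 b_pos by auto
  define h where "h t = F t * (1 / F 2)" for t
  have h_deriv: "(h has_real_derivative b t * (1 / F 2)) (at t)" for t
    unfolding h_def by (intro DERIV_cmult_right F_deriv)
  then have dh: "deriv h t = b t / F 2" for t
    by (simp add: DERIV_imp_deriv)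
  have range_F: "0 \<le> F t \<and> F t \<le> F 2" for t
  proof
    show "0 \<le> F t" using F_mono[of "min t 1" t] F0[of "min t 1"] by simp
    show "F t \<le> F 2" using F_mono[of t "max t 2"] F_const[of "max t 2"] by simp
  qed
  have 1: "smooth h"
    using smooth_antideriv[OF h_deriv] smooth_mult[OF b_smooth smooth_const] by blast
  have 2: "h t = 0" if "t \<le> 1" for t using that F0 by (simp add: h_def)
  have 3: "h t = 1" if "t \<ge> 2" for t using that c F_const[of t] by (simp add: h_def)
  have 4: "\<bar>h t\<bar> \<le> 1" for t
  proof -
    have "0 \<le> F t / F 2" "F t / F 2 \<le> 1"
      using range_F[of t] c by (blast intro: divide_nonneg_pos, metis divide_le_eq_1_pos)
    then show ?thesis by (simp add: h_def)
  qed
  have 5: "deriv h t = 0" if "t \<notin> {1..2}" for t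
    using that b_out[of t] by (auto simp: dh)
  have 6: "\<bar>t * deriv h t\<bar> \<le> 2 / F 2" for t
  proof (cases "t \<in> {1..2}")
    case True
    then have "t * b t \<le> 2 * 1" using b01 by (intro mult_mono) auto
    then show ?thesis using True b01[of t] c by (simp add: dh divide_right_mono abs_mult)
  next
    case False
    then have "b t = 0" using b_out by auto
    then show ?thesis using c by (simp add: dh)
  qed
  show ?thesis by (rule that[OF 1 2 3 4 5 6])
qed

text \<open>Multiply the sine by a cutoff that vanishes near both ends and rises from \<open>0\<close> to \<open>1\<close> within a distance of
  order \<open>1 / M\<close>. The derivative of the cutoff is large there, but at most a constant over the distance to the end, and
  the sine vanishes linearly at both ends; so the product has a bounded derivative. Bounded pointwise
  convergence of the functions and of their derivatives is what dominated convergence asks for later on.\<close>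

lemma sine_cutoff_exists:
  fixes k :: nat
  obtains f :: "nat \<Rightarrow> real \<Rightarrow> real" and C where
    "\<And>m. smooth (f m)"
    "\<And>m. \<exists>a>0. \<exists>b<1. \<forall>x. f m x \<noteq> 0 \<longrightarrow> a \<le> x \<and> x \<le> b"
    "\<And>m x. 0 < x \<Longrightarrow> x < 1 \<Longrightarrow> \<bar>f m x\<bar> \<le> C"
    "\<And>m x. 0 < x \<Longrightarrow> x < 1 \<Longrightarrow> \<bar>deriv (f m) x\<bar> \<le> C"
    "\<And>x. 0 < x \<Longrightarrow> x < 1 \<Longrightarrow> (\<lambda>m. f m x) \<longlonglongrightarrow> sin (real k * pi * x)"
    "\<And>x. 0 < x \<Longrightarrow> x < 1 \<Longrightarrow> (\<lambda>m. deriv (f m) x) \<longlonglongrightarrow> real k * pi * cos (real k * pi * x)"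
proof -
  obtain h K where h: "smooth h"
    "\<And>t. t \<le> 1 \<Longrightarrow> h t = 0" "\<And>t. t \<ge> 2 \<Longrightarrow> h t = 1" "\<And>t. \<bar>h t\<bar> \<le> 1"
    "\<And>t. t \<notin> {1..2} \<Longrightarrow> deriv h t = 0" "\<And>t. \<bar>t * deriv h t\<bar> \<le> K"
    by (rule smooth_step_exists) blast
  define c where "c = real k * pi"
  have c: "c \<ge> 0" by (simp add: c_def)
  define s where "s x = sin (c * x)" for x
  define M where "M m = real (Suc m)" for m
  have M: "M m > 0" for m by (simp add: M_def)
  define f where "f m x = s x * (h (M m * x + 0) * h (- M m * x + M m))" for m x
  have f_deriv: "(f m has_real_derivative
      c * cos (c * x) * (h (M m * x) * h (M m * (1 - x)))
      + s x * (M m * deriv h (M m * x)) * h (M m * (1 - x))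
      - s x * (M m * deriv h (M m * (1 - x))) * h (M m * x)) (at x)" for m x
  proof -
    have 1: "((\<lambda>x. h (M m * x + 0)) has_real_derivative deriv h (M m * x + 0) * M m) (at x)"
      by (rule DERIV_chain2[OF smooth_deriv(1)[OF h(1)]]) (auto intro!: derivative_eq_intros)
    have 2: "((\<lambda>x. h (- M m * x + M m)) has_real_derivative deriv h (- M m * x + M m) * - M m) (at x)"
      by (rule DERIV_chain2[OF smooth_deriv(1)[OF h(1)]]) (auto intro!: derivative_eq_intros)
    have 3: "(s has_real_derivative c * cos (c * x)) (at x)"
      unfolding s_def by (auto intro!: derivative_eq_intros)
    have e: "- M m * x + M m = M m * (1 - x)" by (simp add: algebra_simps)
    show ?thesis
      unfolding f_def
      by (rule DERIV_cong[OF DERIV_mult[OF 3 DERIV_mult[OF 1 2]]])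
         (simp add: e algebra_simps)
  qed
  have s_le: "\<bar>s x\<bar> \<le> c * x \<and> \<bar>s x\<bar> \<le> c * (1 - x)" if "0 < x" "x < 1" for x
  proof
    show "\<bar>s x\<bar> \<le> c * x"
      using abs_sin_x_le_abs_x[of "c * x"] c that by (simp add: s_def)
    have "s x = - (cos (c * 1) * sin (c * (1 - x)))"
    proof -
      have "sin c = 0" by (simp add: c_def)
      moreover have "s x = sin (c - c * (1 - x))" by (simp add: s_def algebra_simps)
      ultimately show ?thesis by (simp add: sin_diff)
    qed
    then have "\<bar>s x\<bar> \<le> 1 * \<bar>sin (c * (1 - x))\<bar>"
      by (simp add: abs_mult mult_left_le_one_le)
    also have "\<dots> \<le> c * (1 - x)"
      using abs_sin_x_le_abs_x[of "c * (1 - x)"] c that by simp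
    finally show "\<bar>s x\<bar> \<le> c * (1 - x)" .
  qed
  have sMd: "\<bar>s x * (M m * deriv h (M m * y))\<bar> \<le> c * K"
    if "0 < x" "x < 1" "y = x \<or> y = 1 - x" for m x y
  proof -
    have "\<bar>s x\<bar> * (M m * \<bar>deriv h (M m * y)\<bar>) \<le> (c * y) * (M m * \<bar>deriv h (M m * y)\<bar>)"
      using s_le that M[of m] by (intro mult_right_mono) auto
    also have "\<dots> = c * \<bar>(M m * y) * deriv h (M m * y)\<bar>"
      using that M[of m] by (auto simp: abs_mult)
    also have "\<dots> \<le> c * K" by (intro mult_left_mono h c)
    finally show ?thesis using M[of m] by (simp add: abs_mult)
  qed
  have K: "K \<ge> 0" using h(6)[of 0] by simp
  have ev: "\<forall>\<^sub>F m in sequentially. M m * x > 2" if pos: "x > 0" for x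
  proof -
    obtain n where "2 < real n * x"
      using ex_less_of_nat_mult[OF pos, of 2] by blast
    then have n: "2 < real (Suc n) * x" using that by (simp add: algebra_simps)
    show ?thesis
      unfolding eventually_sequentially M_def
    proof (intro exI[of _ n] allI impI)
      fix m assume "n \<le> m"
      then have "real (Suc n) * x \<le> real (Suc m) * x"
        using that by (intro mult_right_mono) auto
      then show "real (Suc m) * x > 2" using n by linarith
    qed
  qed
  show ?thesis
  proof
    show "smooth (f m)" for m
      unfolding f_def s_def by (intro smooth_mult smooth_sin smooth_affine h)
    show "\<exists>a>0. \<exists>b<1. \<forall>x. f m x \<noteq> 0 \<longrightarrow> a \<le> x \<and> x \<le> b" for m
    proof -
      have "1 / M m \<le> x \<and> x \<le> 1 - 1 / M m" if *: "f m x \<noteq> 0" for x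
      proof -
        have "M m * x > 1" "M m * (1 - x) > 1"
          using * h(2)[of "M m * x"] h(2)[of "M m * (1 - x)"]
          by (auto simp: f_def algebra_simps not_le[symmetric])
        then show ?thesis using M[of m] by (auto simp: field_simps)
      qed
      moreover have "1 / M m > 0" "1 - 1 / M m < 1" using M[of m] by auto
      ultimately show ?thesis by blast
    qed
    show "\<bar>f m x\<bar> \<le> 1 + c + c * K + c * K" if "0 < x" "x < 1" for m x
    proof -
      have "\<bar>f m x\<bar> \<le> 1 * (1 * 1)"
        unfolding f_def abs_mult by (intro mult_mono h) (auto simp: s_def)
      then show ?thesis using c K mult_nonneg_nonneg[OF c K] by linarith
    qed
    show "\<bar>deriv (f m) x\<bar> \<le> 1 + c + c * K + c * K" if x: "0 < x" "x < 1" for m x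
    proof -
      have "\<bar>c * cos (c * x) * (h (M m * x) * h (M m * (1 - x)))\<bar> \<le> (c * 1) * (1 * 1)"
        unfolding abs_mult using c by (intro mult_mono h) auto
      moreover have "\<bar>s x * (M m * deriv h (M m * x)) * h (M m * (1 - x))\<bar> \<le> (c * K) * 1"
        unfolding abs_mult[of "_ * _" "h _"] using c K x by (intro mult_mono h sMd) auto
      moreover have "\<bar>s x * (M m * deriv h (M m * (1 - x))) * h (M m * x)\<bar> \<le> (c * K) * 1"
        unfolding abs_mult[of "_ * _" "h _"] using c K x by (intro mult_mono h sMd) auto
      ultimately show ?thesis
        unfolding DERIV_imp_deriv[OF f_deriv] by linarith
    qed
    fix x :: real assume x: "0 < x" "x < 1"
    have e1: "\<forall>\<^sub>F m in sequentially. M m * x > 2" "\<forall>\<^sub>F m in sequentially. M m * (1 - x) > 2"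
      using ev x by auto
    show "(\<lambda>m. f m x) \<longlonglongrightarrow> sin (real k * pi * x)"
    proof (rule tendsto_eventually)
      show "\<forall>\<^sub>F m in sequentially. f m x = sin (real k * pi * x)"
        using e1
      proof eventually_elim
        case (elim m)
        have "- M m * x + M m = M m * (1 - x)" by (simp add: algebra_simps)
        then show ?case using elim h(3) by (simp add: f_def s_def c_def)
      qed
    qed
    show "(\<lambda>m. deriv (f m) x) \<longlonglongrightarrow> real k * pi * cos (real k * pi * x)"
    proof (rule tendsto_eventually)
      show "\<forall>\<^sub>F m in sequentially. deriv (f m) x = real k * pi * cos (real k * pi * x)"
        using e1
      proof eventually_elim
        case (elim m)
        then show ?case
          unfolding DERIV_imp_deriv[OF f_deriv] using h(3,5) by (simp add: c_def)
      qed
    qed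
  qed
qed

section \<open>The Hilbert space of square integrable functions\<close>

lemma L2_eq_refl_iff: "L2_eq f f \<longleftrightarrow> square_integrable f"
  by (simp add: L2_eq_def)

lemma L2_cube_cases:
  obtains f where "square_integrable f" "u = abs_L2_cube f"
proof -
  have "L2_eq (rep_L2_cube u) (rep_L2_cube u)"
    using Quotient_L2_cube by (metis Quotient_rel_rep)
  moreover have "abs_L2_cube (rep_L2_cube u) = u"
    using Quotient_L2_cube by (metis Quotient_abs_rep)
  ultimately show ?thesis using that by (metis L2_eq_refl_iff)
qed

lemma abs_L2_cube_eq_iff:
  assumes "square_integrable f" "square_integrable g"
  shows "abs_L2_cube f = abs_L2_cube g \<longleftrightarrow> (AE x in cube_measure. f x = g x)"
  using Quotient_rel[OF Quotient_L2_cube, of f g] assms by (auto simp: L2_eq_def)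

lemma abs_L2_cube_simps:
  assumes "square_integrable f" "square_integrable g"
  shows "abs_L2_cube f + abs_L2_cube g = abs_L2_cube (\<lambda>x. f x + g x)"
    "cscale c (abs_L2_cube f) = abs_L2_cube (\<lambda>x. c * f x)"
    "L2_inner (abs_L2_cube f) (abs_L2_cube g) = (LINT x|cube_measure. f x * cnj (g x))"
    "weak_pderiv i (abs_L2_cube f) (abs_L2_cube g) \<longleftrightarrow> (\<forall>\<phi>. test_fun \<phi> \<longrightarrow>
        (LINT x|cube_measure. f x * pderiv_cl i \<phi> x) = - (LINT x|cube_measure. g x * \<phi> x))"
  using assms
  by (simp_all add: plus_L2_cube.abs_eq cscale.abs_eq L2_inner.abs_eq weak_pderiv.abs_eq
      L2_eq_refl_iff)

lemma abs_L2_cube_cscale: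
  assumes "square_integrable f"
  shows "cscale c (abs_L2_cube f) = abs_L2_cube (\<lambda>x. c * f x)"
  by (rule abs_L2_cube_simps(2)[OF assms assms])

lemma abs_L2_cube_diff:
  assumes "square_integrable f" "square_integrable g"
  shows "abs_L2_cube f - abs_L2_cube g = abs_L2_cube (\<lambda>x. f x - g x)"
proof -
  have "abs_L2_cube f - abs_L2_cube g = abs_L2_cube (\<lambda>x. f x + (- 1) * g x)"
    unfolding minus_L2_cube_def uminus_L2_cube_def
    using assms square_integrable_cmult[OF assms(2), of "- 1"] by (simp only: abs_L2_cube_simps)
  then show ?thesis by simp
qed

lemma square_integrable_diff:
  assumes "square_integrable f" "square_integrable g"
  shows "square_integrable (\<lambda>x. f x - g x)"
  using square_integrable_add[OF assms(1) square_integrable_cmult[OF assms(2), of "-1"]] by simp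

lemma finite_measure_cube: "finite_measure (cube_measure :: (real ^ 'n::finite) measure)"
  by (rule finite_measureI)
     (simp add: emeasure_restrict_space cube_def emeasure_lborel_box_eq)

lemma measure_cube: "measure (cube_measure :: (real ^ 'n::finite) measure) (cube) = 1"
  by (simp add: measure_restrict_space cube_def content_cbox measure_lborel_box_eq
      Basis_vec_def inner_axis prod.neutral)

lemma borel_measurable_cnj [measurable (raw)]:
  "f \<in> borel_measurable M \<Longrightarrow> (\<lambda>x. cnj (f x)) \<in> borel_measurable M"
  by (rule borel_measurable_continuous_on[where f = cnj]) (auto intro!: continuous_intros)

lemma square_integrable_measurable [measurable_dest]:
  "square_integrable f \<Longrightarrow> f \<in> borel_measurable cube_measure"
  by (simp add: square_integrable_def)

lemma square_integrable_cnj: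
  assumes "square_integrable f" shows "square_integrable (\<lambda>x. cnj (f x))"
  using assms by (auto simp: square_integrable_def borel_measurable_cnj)

lemma square_integrable_cmod:
  assumes "square_integrable f" shows "square_integrable (\<lambda>x. of_real (cmod (f x)))"
  using assms by (auto simp: square_integrable_def)

lemma integrable_square_integrable_mult:
  assumes "square_integrable f" "square_integrable g"
  shows "integrable cube_measure (\<lambda>x. f x * g x)"
proof (rule Bochner_Integration.integrable_bound)
  show "integrable cube_measure (\<lambda>x. (cmod (f x))\<^sup>2 + (cmod (g x))\<^sup>2)"
    using assms by (auto simp: square_integrable_def)
  show "(\<lambda>x. f x * g x) \<in> borel_measurable cube_measure"
    using assms by measurable
  have "cmod (f x) * cmod (g x) \<le> (cmod (f x))\<^sup>2 + (cmod (g x))\<^sup>2" for x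
  proof -
    have "2 * cmod (f x) * cmod (g x) \<le> (cmod (f x))\<^sup>2 + (cmod (g x))\<^sup>2"
      by (rule sum_squares_bound)
    moreover have "0 \<le> cmod (f x) * cmod (g x)" by simp
    ultimately show ?thesis by linarith
  qed
  then show "AE x in cube_measure. norm (f x * g x) \<le> norm ((cmod (f x))\<^sup>2 + (cmod (g x))\<^sup>2)"
    by (auto simp: norm_mult)
qed

lemma square_integrable_bounded:
  assumes [measurable]: "f \<in> borel_measurable cube_measure"
    and "\<And>x. x \<in> cube \<Longrightarrow> cmod (f x) \<le> B"
  shows "square_integrable f"
  unfolding square_integrable_def
proof
  interpret finite_measure cube_measure by (rule finite_measure_cube)
  have "(cmod (f x))\<^sup>2 \<le> B\<^sup>2" if "x \<in> cube" for x
    using assms(2)[OF that] by (simp add: power_mono)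
  then show "integrable cube_measure (\<lambda>x. (cmod (f x))\<^sup>2)"
    by (intro integrable_const_bound[where B = "B\<^sup>2"]) (auto intro!: AE_I2)
qed (fact assms(1))

lemma square_integrable_integrable:
  assumes "square_integrable f" shows "integrable cube_measure f"
  using integrable_square_integrable_mult[OF assms square_integrable_bounded[of "\<lambda>x. 1" 1]]
  by simp

lemma L2_inner_add_left: "L2_inner (u + v) w = L2_inner u w + L2_inner v w"
proof -
  obtain f g h where *: "square_integrable f" "u = abs_L2_cube f" "square_integrable g"
    "v = abs_L2_cube g" "square_integrable h" "w = abs_L2_cube h"
    by (metis L2_cube_cases)
  then show ?thesis
    by (simp add: abs_L2_cube_simps square_integrable_add distrib_right
        integrable_square_integrable_mult square_integrable_cnj)
qed

lemma L2_inner_cscale_left: "L2_inner (cscale c u) v = c * L2_inner u v"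
proof -
  obtain f g where *: "square_integrable f" "u = abs_L2_cube f" "square_integrable g"
    "v = abs_L2_cube g"
    by (metis L2_cube_cases)
  then show ?thesis
    by (simp add: abs_L2_cube_simps square_integrable_cmult mult.assoc)
qed

lemma L2_inner_commute: "L2_inner v u = cnj (L2_inner u v)"
proof -
  obtain f g where *: "square_integrable f" "u = abs_L2_cube f" "square_integrable g"
    "v = abs_L2_cube g"
    by (metis L2_cube_cases)
  have "(LINT x|cube_measure. g x * cnj (f x)) = (LINT x|cube_measure. cnj (f x * cnj (g x)))"
    by (simp add: mult.commute)
  then show ?thesis
    by (simp only: * abs_L2_cube_simps Bochner_Integration.integral_cnj)
qed

lemma L2_inner_add_right: "L2_inner w (u + v) = L2_inner w u + L2_inner w v"
  by (metis L2_inner_add_left L2_inner_commute complex_cnj_add)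

lemma L2_inner_cscale_right: "L2_inner u (cscale c v) = cnj c * L2_inner u v"
  by (metis L2_inner_cscale_left L2_inner_commute complex_cnj_mult)

lemma L2_inner_abs_self:
  assumes "square_integrable f"
  shows "L2_inner (abs_L2_cube f) (abs_L2_cube f) = of_real (LINT x|cube_measure. (cmod (f x))\<^sup>2)"
  using assms
  by (simp add: abs_L2_cube_simps complex_norm_square[symmetric] del: of_real_power)

lemma L2_inner_self_real: "L2_inner u u = of_real (Re (L2_inner u u))"
  by (rule L2_cube_cases[of u]) (simp add: L2_inner_abs_self)

lemma L2_inner_self_nonneg: "0 \<le> Re (L2_inner u u)"
  by (rule L2_cube_cases[of u]) (simp add: L2_inner_abs_self)

lemma L2_inner_self_eq_0_iff: "L2_inner u u = 0 \<longleftrightarrow> u = 0"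
proof (rule L2_cube_cases[of u])
  fix f assume f: "square_integrable f" "u = abs_L2_cube f"
  have "L2_inner u u = 0 \<longleftrightarrow> (AE x in cube_measure. f x = 0)"
    using f integral_nonneg_eq_0_iff_AE[of cube_measure "\<lambda>x. (cmod (f x))\<^sup>2"]
    by (simp add: L2_inner_abs_self square_integrable_def)
  then show ?thesis
    using abs_L2_cube_eq_iff[OF f(1) square_integrable_zero] f(2)
    by (simp add: zero_L2_cube_def)
qed

text \<open>The real part of the inner product turns the space into a real inner product space, so that the general
  theory of norms, limits and infinite sums applies; complex scalars are tracked by \<open>cscale\<close>.\<close>

instantiation L2_cube :: (finite) real_inner
begin

definition inner_L2_cube :: "'a L2_cube \<Rightarrow> 'a L2_cube \<Rightarrow> real"
  where "inner_L2_cube u v = Re (L2_inner u v)"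

definition norm_L2_cube :: "'a L2_cube \<Rightarrow> real"
  where "norm_L2_cube u = L2_norm u"

definition sgn_L2_cube :: "'a L2_cube \<Rightarrow> 'a L2_cube"
  where "sgn_L2_cube u = u /\<^sub>R norm u"

definition dist_L2_cube :: "'a L2_cube \<Rightarrow> 'a L2_cube \<Rightarrow> real"
  where "dist_L2_cube u v = norm (u - v)"

definition uniformity_L2_cube :: "('a L2_cube \<times> 'a L2_cube) filter"
  where "uniformity_L2_cube = (INF e\<in>{0<..}. principal {(u, v). dist u v < e})"

definition open_L2_cube :: "'a L2_cube set \<Rightarrow> bool"
  where "open_L2_cube U = (\<forall>u\<in>U. eventually (\<lambda>(u', v). u' = u \<longrightarrow> v \<in> U) uniformity)"

instance
proof
  fix u v w :: "'a L2_cube" and r :: real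
  show "inner u v = inner v u"
    unfolding inner_L2_cube_def by (subst L2_inner_commute) simp
  show "inner (u + v) w = inner u w + inner v w"
    by (simp add: inner_L2_cube_def L2_inner_add_left)
  show "inner (r *\<^sub>R u) v = r * inner u v"
    by (simp add: inner_L2_cube_def scaleR_L2_cube_def L2_inner_cscale_left)
  show "0 \<le> inner u u"
    by (simp add: inner_L2_cube_def L2_inner_self_nonneg)
  show "inner u u = 0 \<longleftrightarrow> u = 0"
    unfolding inner_L2_cube_def by (metis L2_inner_self_eq_0_iff L2_inner_self_real of_real_0
        zero_complex.sel(1))
  show "norm u = sqrt (inner u u)"
    by (simp add: inner_L2_cube_def norm_L2_cube_def L2_norm_def)
qed (simp_all add: sgn_L2_cube_def dist_L2_cube_def uniformity_L2_cube_def open_L2_cube_def)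

end

lemma L2_inner_self: "L2_inner u u = of_real ((norm u)\<^sup>2)"
  using L2_inner_self_real[of u] L2_inner_self_nonneg[of u]
  by (simp add: norm_L2_cube_def L2_norm_def)

lemma norm_abs_L2_cube:
  assumes "square_integrable f"
  shows "(norm (abs_L2_cube f))\<^sup>2 = (LINT x|cube_measure. (cmod (f x))\<^sup>2)"
  using L2_inner_self[of "abs_L2_cube f"] L2_inner_abs_self[OF assms] of_real_eq_iff by metis

lemma cscale_simps [simp]:
  "cscale c (u + v) = cscale c u + cscale c v"
  "cscale (c + d) u = cscale c u + cscale d u"
  "cscale c (cscale d u) = cscale (c * d) u"
  "cscale 1 u = u" "cscale 0 u = 0" "cscale c 0 = 0"
  by (transfer; auto simp: L2_eq_def square_integrable_zero square_integrable_add
      square_integrable_cmult distrib_left distrib_right mult.assoc)+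

lemma scaleR_eq_cscale: "r *\<^sub>R u = cscale (of_real r) u"
  by (simp add: scaleR_L2_cube_def)

lemma cscale_minus_right [simp]: "cscale c (- u) = - cscale c u"
  and cscale_minus_left [simp]: "cscale (- c) u = - cscale c u"
  by (simp_all add: uminus_L2_cube_def)

lemma cscale_diff_right [simp]: "cscale c (u - v) = cscale c u - cscale c v"
  using cscale_simps(1)[of c u "- v"] by (simp del: cscale_simps)

lemma norm_cscale: "norm (cscale c u) = cmod c * norm u"
proof -
  have "complex_of_real ((norm (cscale c u))\<^sup>2) = of_real ((cmod c * norm u)\<^sup>2)"
    unfolding L2_inner_self[symmetric] L2_inner_cscale_left L2_inner_cscale_right
    by (simp add: L2_inner_self power_mult_distrib complex_norm_square mult.commute[of c "cnj c"]
        mult.assoc[symmetric] del: of_real_power)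
  then show ?thesis
    by (metis of_real_eq_iff norm_ge_zero mult_nonneg_nonneg power2_eq_imp_eq)
qed

text \<open>Rotating \<open>u\<close> by a phase makes the inner product real, which reduces the claim to the real inequality.\<close>

lemma L2_inner_Cauchy_Schwarz: "cmod (L2_inner u v) \<le> norm u * norm v"
proof (cases "L2_inner u v = 0")
  case False
  define c where "c = cnj (L2_inner u v) / of_real (cmod (L2_inner u v))"
  have "cmod c = 1" using False by (simp add: c_def norm_divide)
  have "c * L2_inner u v = of_real (cmod (L2_inner u v))"
    using False by (simp add: c_def complex_norm_square[symmetric] power2_eq_square mult.commute)
  then have "cmod (L2_inner u v) = Re (L2_inner (cscale c u) v)"
    by (simp add: L2_inner_cscale_left)
  also have "\<dots> \<le> norm (cscale c u) * norm v"
    using norm_cauchy_schwarz[of "cscale c u" v] by (simp add: inner_L2_cube_def)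
  finally show ?thesis using \<open>cmod c = 1\<close> by (simp add: norm_cscale)
qed simp

lemma bounded_linear_L2_inner_left: "bounded_linear (\<lambda>u. L2_inner u v)"
  by (rule bounded_linear_intro[where K = "norm v"])
     (auto simp: L2_inner_add_left scaleR_eq_cscale L2_inner_cscale_left scaleR_conv_of_real
        L2_inner_Cauchy_Schwarz)

lemma bounded_linear_L2_inner_right: "bounded_linear (\<lambda>u. L2_inner v u)"
  by (rule bounded_linear_intro[where K = "norm v"])
     (auto simp: L2_inner_add_right scaleR_eq_cscale L2_inner_cscale_right scaleR_conv_of_real
        L2_inner_Cauchy_Schwarz mult.commute intro: order_trans[OF L2_inner_Cauchy_Schwarz])

lemma bounded_linear_cscale: "bounded_linear (cscale c)"
  by (rule bounded_linear_intro[where K = "cmod c"])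
     (auto simp: scaleR_eq_cscale norm_cscale mult.commute)

lemmas L2_inner_sum_left = linear_sum[OF bounded_linear.linear[OF bounded_linear_L2_inner_left]]
lemmas L2_inner_sum_right = linear_sum[OF bounded_linear.linear[OF bounded_linear_L2_inner_right]]
lemmas L2_inner_simps =
  L2_inner_add_left L2_inner_add_right L2_inner_cscale_left L2_inner_cscale_right
  linear_0[OF bounded_linear.linear[OF bounded_linear_L2_inner_left]]
  linear_0[OF bounded_linear.linear[OF bounded_linear_L2_inner_right]]
  linear_diff[OF bounded_linear.linear[OF bounded_linear_L2_inner_left]]
  linear_diff[OF bounded_linear.linear[OF bounded_linear_L2_inner_right]]
  linear_neg[OF bounded_linear.linear[OF bounded_linear_L2_inner_left]]
  linear_neg[OF bounded_linear.linear[OF bounded_linear_L2_inner_right]]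

text \<open>Cauchy-Schwarz against the constant \<open>1\<close>, whose norm is \<open>1\<close> because the cube has unit volume.\<close>

lemma L1_le_L2_norm:
  fixes f :: "real ^ 'n::finite \<Rightarrow> complex"
  assumes f: "square_integrable f"
  shows "(LINT x|cube_measure. cmod (f x)) \<le> norm (abs_L2_cube f)"
proof -
  interpret finite_measure "cube_measure :: (real ^ 'n) measure" by (rule finite_measure_cube)
  let ?g = "\<lambda>x. complex_of_real (cmod (f x))" and ?one = "\<lambda>x :: real ^ 'n. 1 :: complex"
  have g: "square_integrable ?g" by (rule square_integrable_cmod[OF f])
  have one: "square_integrable ?one" by (rule square_integrable_bounded[of _ 1]) auto
  have "(norm (abs_L2_cube ?one))\<^sup>2 = 1"
    using measure_cube[where 'n = 'n] by (simp add: norm_abs_L2_cube[OF one])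
  then have n1: "norm (abs_L2_cube ?one) = 1"
    by (metis norm_ge_zero power2_eq_1_iff neg_0_le_iff_le not_one_le_zero)
  have "(norm (abs_L2_cube ?g))\<^sup>2 = (norm (abs_L2_cube f))\<^sup>2"
    by (simp add: norm_abs_L2_cube f g)
  then have n2: "norm (abs_L2_cube ?g) = norm (abs_L2_cube f)"
    by simp
  have "L2_inner (abs_L2_cube ?g) (abs_L2_cube ?one) = of_real (LINT x|cube_measure. cmod (f x))"
    using f by (simp add: abs_L2_cube_simps g one integral_complex_of_real)
  then show ?thesis
    using L2_inner_Cauchy_Schwarz[of "abs_L2_cube ?g" "abs_L2_cube ?one"]
    by (simp add: n1 n2)
qed

lemma nn_integral_norm_square:
  assumes "square_integrable f"
  shows "(\<integral>\<^sup>+x. ennreal ((cmod (f x))\<^sup>2) \<partial>cube_measure) = ennreal ((norm (abs_L2_cube f))\<^sup>2)"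
  using assms unfolding norm_abs_L2_cube[OF assms]
  by (intro nn_integral_eq_integral) (auto simp: square_integrable_def)

text \<open>The Riesz-Fischer theorem. A Cauchy sequence is also Cauchy in mean, so a subsequence converges almost
  everywhere; Fatou's lemma along this subsequence bounds the distance of the original sequence to the limit.\<close>

instance L2_cube :: (finite) complete_space
proof
  fix X :: "nat \<Rightarrow> 'a L2_cube" assume X: "Cauchy X"
  have "\<forall>n. \<exists>f. square_integrable f \<and> X n = abs_L2_cube f" by (metis L2_cube_cases)
  then obtain f where f: "\<And>n. square_integrable (f n)" "\<And>n. X n = abs_L2_cube (f n)"
    by metis
  have diff: "X i - X j = abs_L2_cube (\<lambda>x. f i x - f j x)" for i j
    by (simp add: f abs_L2_cube_diff)
  have [measurable]: "f n \<in> borel_measurable cube_measure" for n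
    using f(1) by (simp add: square_integrable_def)
  obtain r where r: "strict_mono r" "AE x in cube_measure. Cauchy (\<lambda>i. f (r i) x)"
  proof (rule cauchy_L1_AE_cauchy_subseq[of cube_measure f])
    show "integrable cube_measure (f n)" for n
      by (rule square_integrable_integrable[OF f(1)])
    show "\<exists>N. \<forall>i\<ge>N. \<forall>j\<ge>N. (LINT x|cube_measure. norm (f i x - f j x)) < e" if e: "e > 0" for e
    proof -
      obtain N where "\<forall>i\<ge>N. \<forall>j\<ge>N. norm (X i - X j) < e"
        using CauchyD[OF X e] by blast
      then show ?thesis
        using L1_le_L2_norm[OF square_integrable_diff[OF f(1) f(1)]] unfolding diff
        by (meson le_less_trans)
    qed
  qed blast
  define g where "g x = lim (\<lambda>i. f (r i) x)" for x
  have [measurable]: "g \<in> borel_measurable cube_measure"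
    unfolding g_def by (rule borel_measurable_lim_metric) auto
  have g: "AE x in cube_measure. (\<lambda>i. f (r i) x) \<longlonglongrightarrow> g x"
    using r(2) by eventually_elim (simp add: g_def convergent_LIMSEQ_iff Cauchy_convergent_iff)
  have key: "square_integrable (\<lambda>x. g x - f m x) \<and> norm (abs_L2_cube (\<lambda>x. g x - f m x)) \<le> e"
    if N: "\<forall>i\<ge>N. \<forall>j\<ge>N. norm (X i - X j) < e" and m: "m \<ge> N" and "e > 0" for e N m
  proof -
    have "(\<integral>\<^sup>+x. ennreal ((cmod (g x - f m x))\<^sup>2) \<partial>cube_measure)
        = (\<integral>\<^sup>+x. liminf (\<lambda>i. ennreal ((cmod (f (r i) x - f m x))\<^sup>2)) \<partial>cube_measure)"
    proof (rule nn_integral_cong_AE)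
      show "AE x in cube_measure. ennreal ((cmod (g x - f m x))\<^sup>2)
          = liminf (\<lambda>i. ennreal ((cmod (f (r i) x - f m x))\<^sup>2))"
        using g
      proof eventually_elim
        case (elim x)
        have "(\<lambda>i. ennreal ((cmod (f (r i) x - f m x))\<^sup>2)) \<longlonglongrightarrow> ennreal ((cmod (g x - f m x))\<^sup>2)"
          by (intro tendsto_ennrealI tendsto_intros elim)
        then show ?case using lim_imp_Liminf[OF sequentially_bot] by metis
      qed
    qed
    also have "\<dots> \<le> liminf (\<lambda>i. \<integral>\<^sup>+x. ennreal ((cmod (f (r i) x - f m x))\<^sup>2) \<partial>cube_measure)"
      by (rule nn_integral_liminf) measurable
    also have "\<dots> \<le> ennreal (e\<^sup>2)"
    proof (rule Liminf_le)
      show "\<forall>\<^sub>F i in sequentially.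
          (\<integral>\<^sup>+x. ennreal ((cmod (f (r i) x - f m x))\<^sup>2) \<partial>cube_measure) \<le> ennreal (e\<^sup>2)"
        unfolding eventually_sequentially
      proof (intro exI[of _ N] allI impI)
        fix i assume "N \<le> i"
        then have "r i \<ge> N" using seq_suble[OF r(1)] le_trans by blast
        then have "norm (X (r i) - X m) \<le> e" using N m less_imp_le by blast
        then show "(\<integral>\<^sup>+x. ennreal ((cmod (f (r i) x - f m x))\<^sup>2) \<partial>cube_measure) \<le> ennreal (e\<^sup>2)"
          using f(1) nn_integral_norm_square[OF square_integrable_diff[OF f(1) f(1)]]
          by (simp add: diff power_mono ennreal_leI)
      qed
    qed simp
    finally have le: "(\<integral>\<^sup>+x. ennreal ((cmod (g x - f m x))\<^sup>2) \<partial>cube_measure) \<le> ennreal (e\<^sup>2)" .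
    then have "(\<integral>\<^sup>+x. ennreal ((cmod (g x - f m x))\<^sup>2) \<partial>cube_measure) < \<infinity>"
      using le_less_trans ennreal_less_top by fastforce
    then have si: "square_integrable (\<lambda>x. g x - f m x)"
      unfolding square_integrable_def by (auto intro!: integrableI_bounded)
    then show ?thesis
    proof
      have "(norm (abs_L2_cube (\<lambda>x. g x - f m x)))\<^sup>2 \<le> e\<^sup>2"
        using le unfolding nn_integral_norm_square[OF si] by (simp add: ennreal_le_iff)
      then show "norm (abs_L2_cube (\<lambda>x. g x - f m x)) \<le> e"
        using \<open>e > 0\<close> by (meson less_imp_le power2_le_imp_le)
    qed
  qed
  obtain N0 where "\<forall>i\<ge>N0. \<forall>j\<ge>N0. norm (X i - X j) < 1"
    using CauchyD[OF X, of 1] by (meson zero_less_one)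
  then have "square_integrable (\<lambda>x. (g x - f N0 x) + f N0 x)"
    using key[of N0 1 N0] f(1) by (intro square_integrable_add) auto
  then have gs: "square_integrable g" by simp
  have "X \<longlonglongrightarrow> abs_L2_cube g"
  proof (rule LIMSEQ_I)
    fix e :: real assume e: "e > 0"
    then obtain N where "\<forall>i\<ge>N. \<forall>j\<ge>N. norm (X i - X j) < e / 2"
      using CauchyD[OF X, of "e / 2"] by auto
    then have "norm (abs_L2_cube g - X m) \<le> e / 2" if "m \<ge> N" for m
      using key[of N "e / 2" m] that e by (simp add: f abs_L2_cube_diff gs)
    then have "norm (X m - abs_L2_cube g) \<le> e / 2" if "m \<ge> N" for m
      using that by (simp only: norm_minus_commute)
    then show "\<exists>N. \<forall>m\<ge>N. norm (X m - abs_L2_cube g) < e"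
      using e by (intro exI[of _ N]) (smt (verit) field_sum_of_halves)
  qed
  then show "convergent X" by (auto simp: convergent_def)
qed

instance L2_cube :: (finite) banach ..

section \<open>Orthonormal expansions\<close>

definition orthonormal :: "('i \<Rightarrow> 'n::finite L2_cube) \<Rightarrow> 'i set \<Rightarrow> bool" where
  "orthonormal b I \<longleftrightarrow> (\<forall>i\<in>I. \<forall>j\<in>I. L2_inner (b i) (b j) = (if i = j then 1 else 0))"

lemma orthonormal_inner_sum:
  assumes "orthonormal b I" "finite F" "F \<subseteq> I" "i \<in> I"
  shows "L2_inner (\<Sum>j\<in>F. cscale (c j) (b j)) (b i) = (if i \<in> F then c i else 0)"
proof -
  have "L2_inner (\<Sum>j\<in>F. cscale (c j) (b j)) (b i) = (\<Sum>j\<in>F. if i = j then c j else 0)"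
    unfolding L2_inner_sum_left L2_inner_cscale_left
    using assms by (intro sum.cong) (auto simp: orthonormal_def subset_iff)
  then show ?thesis using assms(2) by simp
qed

lemma orthonormal_norm_sum:
  assumes "orthonormal b I" "finite F" "F \<subseteq> I"
  shows "(norm (\<Sum>i\<in>F. cscale (c i) (b i)))\<^sup>2 = (\<Sum>i\<in>F. (cmod (c i))\<^sup>2)"
proof -
  let ?S = "\<Sum>i\<in>F. cscale (c i) (b i)"
  have "L2_inner ?S ?S = (\<Sum>i\<in>F. cnj (c i) * L2_inner ?S (b i))"
    by (subst L2_inner_sum_right) (simp add: L2_inner_cscale_right)
  also have "\<dots> = (\<Sum>i\<in>F. of_real ((cmod (c i))\<^sup>2))"
    using assms by (intro sum.cong refl, subst orthonormal_inner_sum[OF assms])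
      (auto simp: complex_norm_square mult.commute simp del: of_real_power)
  finally show ?thesis
    by (metis L2_inner_self of_real_eq_iff of_real_sum)
qed

text \<open>The defect is the squared distance of \<open>x\<close> from its projection on the span of the family.\<close>

lemma Bessel_inequality:
  assumes "orthonormal b I" "finite F" "F \<subseteq> I"
  shows "(\<Sum>i\<in>F. (cmod (L2_inner x (b i)))\<^sup>2) \<le> (norm x)\<^sup>2"
proof -
  define S where "S = (\<Sum>i\<in>F. cscale (L2_inner x (b i)) (b i))"
  define B where "B = (\<Sum>i\<in>F. (cmod (L2_inner x (b i)))\<^sup>2)"
  have "L2_inner x S = (\<Sum>i\<in>F. of_real ((cmod (L2_inner x (b i)))\<^sup>2))"
    unfolding S_def L2_inner_sum_right L2_inner_cscale_right
    by (intro sum.cong refl)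
       (auto simp: complex_norm_square mult.commute simp del: of_real_power)
  then have xS: "inner x S = B"
    by (simp add: inner_L2_cube_def B_def)
  have SS: "inner S S = B"
    using orthonormal_norm_sum[OF assms] by (simp add: S_def B_def dot_square_norm)
  have "0 \<le> inner (x - S) (x - S)" by simp
  also have "\<dots> = inner x x - B"
    by (simp add: inner_diff_left inner_diff_right xS SS inner_commute[of S x])
  finally show ?thesis by (simp add: B_def dot_square_norm)
qed

lemma Bessel_summable:
  assumes "orthonormal b I"
  shows "(\<lambda>i. (cmod (L2_inner x (b i)))\<^sup>2) summable_on I"
  by (rule nonneg_bdd_above_summable_on)
     (auto intro!: bdd_aboveI2 Bessel_inequality[OF assms])

text \<open>By Pythagoras the squared distance of two partial sums is a piece of the tail of the sum of the squared
  coefficients, so the partial sums are Cauchy.\<close>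

lemma orthonormal_summable:
  assumes b: "orthonormal b I" and c: "(\<lambda>i. (cmod (c i))\<^sup>2) summable_on I"
  shows "(\<lambda>i. cscale (c i) (b i)) summable_on I"
proof -
  let ?f = "\<lambda>i. cscale (c i) (b i)"
  obtain s where s: "((\<lambda>i. (cmod (c i))\<^sup>2) has_sum s) I"
    using c by (auto simp: summable_on_def)
  have "\<exists>P. eventually P (finite_subsets_at_top I) \<and>
      (\<forall>F G. P F \<and> P G \<longrightarrow> dist (sum ?f F) (sum ?f G) < e)" if e: "e > 0" for e
  proof -
    have e3: "(e / 3)\<^sup>2 > 0" using e by simp
    obtain F0 where F0: "finite F0" "F0 \<subseteq> I"
      "dist (\<Sum>i\<in>F0. (cmod (c i))\<^sup>2) s \<le> (e / 3)\<^sup>2"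
      using has_sum_finite_approximation[OF s e3] by blast
    define P where "P F \<longleftrightarrow> finite F \<and> F0 \<subseteq> F \<and> F \<subseteq> I" for F
    have ev: "eventually P (finite_subsets_at_top I)"
      unfolding eventually_finite_subsets_at_top P_def using F0 by auto
    have near: "dist (sum ?f F) (sum ?f F0) \<le> e / 3" if "P F" for F
    proof -
      have F: "finite F" "F0 \<subseteq> F" "F \<subseteq> I" using that by (auto simp: P_def)
      have "(norm (sum ?f (F - F0)))\<^sup>2 = (\<Sum>i\<in>F - F0. (cmod (c i))\<^sup>2)"
        using F by (intro orthonormal_norm_sum[OF b]) auto
      also have "\<dots> = (\<Sum>i\<in>F. (cmod (c i))\<^sup>2) - (\<Sum>i\<in>F0. (cmod (c i))\<^sup>2)"
        using F by (simp add: sum_diff)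
      also have "\<dots> \<le> s - (\<Sum>i\<in>F0. (cmod (c i))\<^sup>2)"
        using finite_sum_le_has_sum[OF s F(1,3)] by simp
      also have "\<dots> \<le> (e / 3)\<^sup>2" using F0(3) by (simp add: dist_real_def)
      finally have "norm (sum ?f (F - F0)) \<le> e / 3"
        by (rule power2_le_imp_le) (use e in simp)
      then show ?thesis using F by (simp add: sum_diff dist_norm)
    qed
    have "dist (sum ?f F) (sum ?f G) < e" if "P F" "P G" for F G
      using dist_triangle2[of "sum ?f F" "sum ?f G" "sum ?f F0"] near[OF that(1)] near[OF that(2)] e
      by linarith
    then show ?thesis using ev by blast
  qed
  then have "cauchy_filter (filtermap (sum ?f) (finite_subsets_at_top I))"
    by (simp add: cauchy_filter_metric_filtermap)
  moreover have "complete (UNIV :: 'b L2_cube set)"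
    by (meson Cauchy_convergent UNIV_I complete_def convergent_def)
  ultimately obtain L where "(sum ?f \<longlongrightarrow> L) (finite_subsets_at_top I)"
    using complete_uniform[where S = UNIV] by (force simp add: filterlim_def)
  then show ?thesis using summable_on_def has_sum_def by blast
qed

lemma orthonormal_has_sum_coefficient:
  assumes b: "orthonormal b I" and x: "((\<lambda>i. cscale (c i) (b i)) has_sum x) I" and i: "i \<in> I"
  shows "L2_inner x (b i) = c i"
proof -
  have "((\<lambda>j. L2_inner (cscale (c j) (b j)) (b i)) has_sum L2_inner x (b i)) I"
    by (rule has_sum_bounded_linear[OF bounded_linear_L2_inner_left x])
  moreover have "((\<lambda>j. L2_inner (cscale (c j) (b j)) (b i)) has_sum c i) I
      \<longleftrightarrow> ((\<lambda>j. c j) has_sum c i) {i}"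
    using b i by (intro has_sum_cong_neutral) (auto simp: orthonormal_def L2_inner_cscale_left)
  moreover have "((\<lambda>j. c j) has_sum c i) {i}"
    by (rule has_sum_finiteI) auto
  ultimately show ?thesis using has_sum_unique by blast
qed

lemma orthonormal_has_sum_norm:
  assumes b: "orthonormal b I" and x: "((\<lambda>i. cscale (c i) (b i)) has_sum x) I"
  shows "((\<lambda>i. (cmod (c i))\<^sup>2) has_sum (norm x)\<^sup>2) I"
proof -
  have "((\<lambda>F. (norm (\<Sum>i\<in>F. cscale (c i) (b i)))\<^sup>2) \<longlongrightarrow> (norm x)\<^sup>2) (finite_subsets_at_top I)"
    using x unfolding has_sum_def by (intro tendsto_intros)
  then have "((\<lambda>F. \<Sum>i\<in>F. (cmod (c i))\<^sup>2) \<longlongrightarrow> (norm x)\<^sup>2) (finite_subsets_at_top I)"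
    by (rule Lim_transform_eventually)
       (auto simp: orthonormal_norm_sum[OF b] intro: eventually_finite_subsets_at_top_weakI)
  then show ?thesis by (simp add: has_sum_def)
qed

text \<open>The difference between \<open>x\<close> and the sum of its Fourier series is orthogonal to the whole family.\<close>

lemma orthonormal_basis_expansion:
  assumes b: "orthonormal b I"
    and complete: "\<And>x. (\<And>i. i \<in> I \<Longrightarrow> L2_inner x (b i) = 0) \<Longrightarrow> x = 0"
  shows "((\<lambda>i. cscale (L2_inner x (b i)) (b i)) has_sum x) I"
proof -
  obtain y where y: "((\<lambda>i. cscale (L2_inner x (b i)) (b i)) has_sum y) I"
    using orthonormal_summable[OF b Bessel_summable[OF b]] by (auto simp: summable_on_def)
  have "L2_inner (x - y) (b i) = 0" if "i \<in> I" for i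
    using orthonormal_has_sum_coefficient[OF b y that] by (simp add: L2_inner_simps)
  then have "x - y = 0" by (rule complete)
  then show ?thesis using y by simp
qed

section \<open>Products of functions of one variable and integration by parts\<close>

definition tensor :: "('n \<Rightarrow> real \<Rightarrow> real) \<Rightarrow> real ^ 'n::finite \<Rightarrow> complex" where
  "tensor \<psi> x = of_real (\<Prod>j\<in>UNIV. \<psi> j (x $ j))"

lemma tensor_has_derivative:
  fixes \<psi> :: "'n::finite \<Rightarrow> real \<Rightarrow> real"
  assumes "\<And>j t. (\<psi> j has_real_derivative \<psi>' j t) (at t)"
  shows "(tensor \<psi> has_derivative
    (\<lambda>h. of_real (\<Sum>i\<in>UNIV. (h $ i * \<psi>' i (x $ i)) * (\<Prod>j\<in>UNIV - {i}. \<psi> j (x $ j))))) (at x)"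
  unfolding tensor_def
proof (intro has_derivative_of_real has_derivative_prod)
  fix i
  have "((\<lambda>x :: real ^ 'n. x $ i) has_derivative (\<lambda>h. h $ i)) (at x)"
    by (rule bounded_linear.has_derivative[OF bounded_linear_vec_nth has_derivative_ident])
  then show "((\<lambda>x. \<psi> i (x $ i)) has_derivative (\<lambda>h. h $ i * \<psi>' i (x $ i))) (at x)"
    using has_derivative_compose[of "\<lambda>x. x $ i" "\<lambda>h. h $ i" x UNIV "\<psi> i" "(*) (\<psi>' i (x $ i))"]
      assms[of i "x $ i"]
    by (simp add: has_field_derivative_def mult.commute)
qed

lemma tensor_pderiv:
  fixes \<psi> :: "'n::finite \<Rightarrow> real \<Rightarrow> real"
  assumes "\<And>j t. (\<psi> j has_real_derivative \<psi>' j t) (at t)"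
  shows "tensor \<psi> differentiable (at x)" "pderiv_cl i (tensor \<psi>) = tensor (\<psi>(i := \<psi>' i))"
proof -
  show "tensor \<psi> differentiable (at x)"
    using tensor_has_derivative[of \<psi> \<psi>', OF assms] by (auto simp: differentiable_def)
  show "pderiv_cl i (tensor \<psi>) = tensor (\<psi>(i := \<psi>' i))"
  proof
    fix x
    have "pderiv_cl i (tensor \<psi>) x = of_real (\<Sum>k\<in>UNIV. (axis i 1 $ k * \<psi>' k (x $ k))
        * (\<Prod>j\<in>UNIV - {k}. \<psi> j (x $ j)))"
      unfolding pderiv_cl_def frechet_derivative_at[OF tensor_has_derivative[of \<psi> \<psi>', OF assms], symmetric] ..
    also have "(\<Sum>k\<in>UNIV. (axis i 1 $ k * \<psi>' k (x $ k)) * (\<Prod>j\<in>UNIV - {k}. \<psi> j (x $ j)))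
        = (\<Sum>k\<in>UNIV. if k = i then \<psi>' i (x $ i) * (\<Prod>j\<in>UNIV - {i}. \<psi> j (x $ j)) else 0)"
      by (intro sum.cong) (auto simp: axis_def)
    also have "\<dots> = \<psi>' i (x $ i) * (\<Prod>j\<in>UNIV - {i}. \<psi> j (x $ j))" by simp
    also have "\<dots> = (\<Prod>j\<in>UNIV. (\<psi>(i := \<psi>' i)) j (x $ j))"
      by (subst prod.remove[of UNIV i]) (auto intro!: prod.cong)
    finally show "pderiv_cl i (tensor \<psi>) x = tensor (\<psi>(i := \<psi>' i)) x"
      unfolding tensor_def[of "\<psi>(i := \<psi>' i)" x] .
  qed
qed

lemma tensor_continuous:
  assumes "\<And>j. continuous_on UNIV (\<psi> j)"
  shows "continuous_on A (tensor \<psi>)"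
proof -
  have "continuous_on UNIV (\<lambda>x. \<psi> j (x $ j))" for j
    by (rule continuous_on_compose2[OF assms]) (auto intro!: continuous_intros)
  then have "continuous_on UNIV (tensor \<psi>)"
    unfolding tensor_def by (intro continuous_intros)
  then show ?thesis by (rule continuous_on_subset) simp
qed

lemma Ck_tensor:
  fixes \<psi> :: "'n::finite \<Rightarrow> real \<Rightarrow> real"
  assumes "\<And>j. smooth (\<psi> j)"
  shows "Ck m (tensor \<psi>)"
  using assms
proof (induction m arbitrary: \<psi>)
  case 0
  then show ?case by (auto intro!: tensor_continuous smooth_continuous)
next
  case (Suc m)
  have d: "(\<psi> j has_real_derivative deriv (\<psi> j) t) (at t)" for j t
    by (rule smooth_deriv(1)[OF Suc.prems])
  have "Ck m (tensor (\<psi>(i := deriv (\<psi> i))))" for i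
    by (rule Suc.IH) (auto simp: Suc.prems smooth_deriv(2))
  then show ?case using tensor_pderiv[of \<psi> "\<lambda>j. deriv (\<psi> j)", OF d] by auto
qed

lemma test_fun_tensor:
  fixes \<psi> :: "'n::finite \<Rightarrow> real \<Rightarrow> real"
  assumes smooth: "\<And>j. smooth (\<psi> j)"
    and supp: "\<And>j. \<exists>a>0. \<exists>b<1. \<forall>t. \<psi> j t \<noteq> 0 \<longrightarrow> a \<le> t \<and> t \<le> b"
  shows "test_fun (tensor \<psi>)"
proof -
  obtain a b where ab: "\<And>j. a j > 0" "\<And>j. b j < 1"
    "\<And>j t. \<psi> j t \<noteq> 0 \<Longrightarrow> a j \<le> t \<and> t \<le> b j"
    using supp by metis
  define K where "K = cbox (\<chi> j. a j) (\<chi> j. b j)"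
  have "{x. tensor \<psi> x \<noteq> 0} \<subseteq> K"
    using ab(3) by (auto simp: K_def mem_box_cart tensor_def)
  then have sub: "closure {x. tensor \<psi> x \<noteq> 0} \<subseteq> K"
    unfolding K_def by (rule closure_minimal) (rule closed_cbox)
  have "K \<subseteq> cube"
  proof
    fix x assume "x \<in> K"
    then have "a j \<le> x $ j" "x $ j \<le> b j" for j by (auto simp: K_def mem_box_cart)
    then have "0 < x $ j \<and> x $ j < 1" for j
      using ab(1,2)[of j] by (meson less_le_trans le_less_trans)
    then show "x \<in> cube" by (simp add: cube_def mem_box_cart)
  qed
  moreover have "compact (closure {x. tensor \<psi> x \<noteq> 0})"
  proof -
    have "bounded (closure {x. tensor \<psi> x \<noteq> 0})"
      by (rule bounded_subset[OF _ sub]) (simp add: K_def bounded_cbox)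
    then show ?thesis by (simp add: compact_eq_bounded_closed)
  qed
  ultimately show ?thesis
    using sub Ck_tensor[OF smooth] by (auto simp: test_fun_def)
qed

text \<open>Lebesgue measure is the image of a product measure under the coordinate map, so this is Fubini's theorem for
  products.\<close>

lemma lborel_integral_prod:
  fixes g :: "'n::finite \<Rightarrow> real \<Rightarrow> real"
  assumes "\<And>j. integrable lborel (g j)"
  shows "(LINT x|lborel. (\<Prod>j\<in>UNIV. g j ((x :: real ^ 'n) $ j))) = (\<Prod>j\<in>UNIV. LINT t|lborel. g j t)"
proof -
  interpret product_sigma_finite "\<lambda>b :: real ^ 'n. lborel :: real measure" ..
  have [measurable]: "g j \<in> borel_measurable borel" for j
    using assms[of j] by (simp add: borel_measurable_integrable)
  have reindex: "(\<Prod>j\<in>UNIV. h j) = (\<Prod>b\<in>Basis. h (axis_index (b :: real ^ 'n)))" for h :: "'n \<Rightarrow> real"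
  proof -
    have "bij_betw (\<lambda>j. axis j 1) UNIV (Basis :: (real ^ 'n) set)"
      by (auto simp: bij_betw_def Basis_vec_def inj_def axis_eq_axis)
    from prod.reindex_bij_betw[OF this, of "\<lambda>b. h (axis_index b)"] show ?thesis
      by simp
  qed
  have comp: "(\<Sum>b\<in>Basis. f b *\<^sub>R b) $ axis_index c = f c" if Basis: "c \<in> Basis"
    for f :: "real ^ 'n \<Rightarrow> real" and c
  proof -
    obtain j where c: "c = axis j 1" using Basis by (auto simp: Basis_vec_def)
    have "(\<Sum>b\<in>Basis. f b *\<^sub>R b) $ j = (\<Sum>b\<in>Basis. f b *\<^sub>R b) \<bullet> axis j 1"
      by (simp add: inner_axis)
    also have "\<dots> = f (axis j 1)" by simp
    finally show ?thesis by (simp add: c)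
  qed
  have "(LINT x|lborel. (\<Prod>j\<in>UNIV. g j ((x :: real ^ 'n) $ j)))
      = (LINT f|(\<Pi>\<^sub>M b\<in>Basis. lborel). (\<Prod>j\<in>UNIV. g j ((\<Sum>b\<in>Basis. f b *\<^sub>R b) $ j)))"
    by (subst lborel_eq, subst integral_distr) auto
  also have "\<dots> = (LINT f|(\<Pi>\<^sub>M b\<in>Basis. lborel).
      (\<Prod>b\<in>Basis. g (axis_index (b :: real ^ 'n)) (f b)))"
    unfolding reindex
    by (rule Bochner_Integration.integral_cong[OF refl], rule prod.cong[OF refl], subst comp) auto
  also have "\<dots> = (\<Prod>b\<in>(Basis :: (real ^ 'n) set). LINT t|lborel. g (axis_index b) t)"
    by (rule product_integral_prod) (use assms in auto)
  finally show ?thesis by (simp add: reindex)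
qed

lemma cube_integral_lborel:
  fixes f :: "real ^ 'n::finite \<Rightarrow> complex"
  assumes "continuous_on UNIV f"
  shows "(LINT x|cube_measure. f x) = (LINT x|lborel. indicator cube x *\<^sub>R f x)"
proof -
  have [measurable]: "f \<in> borel_measurable borel"
    using assms by (rule borel_measurable_continuous_onI)
  have "cube \<in> sets borel" by (simp add: cube_def)
  then have "(\<lambda>x. indicator cube x *\<^sub>R f x) \<in> borel_measurable lborel" by measurable
  then show ?thesis
    by (simp add: integral_restrict_space integral_completion)
qed

lemma cube_integral_tensor:
  fixes \<psi> :: "'n::finite \<Rightarrow> real \<Rightarrow> real"
  assumes cont: "\<And>j. continuous_on UNIV (\<psi> j)"
    and I: "\<And>j. (\<psi> j has_integral I j) {0..1}"
  shows "(LINT x|cube_measure. tensor \<psi> x) = of_real (\<Prod>j\<in>UNIV. I j)"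
proof -
  have int: "set_integrable lborel {0<..<1} (\<psi> j)" for j
    by (rule set_integrable_subset[OF borel_integrable_atLeastAtMost'[of 0 1]])
       (auto intro: continuous_on_subset[OF cont])
  have I_eq: "(LINT t|lborel. indicator {0<..<1} t * \<psi> j t) = I j" for j
  proof -
    have "(LINT t|lborel. indicator {0<..<1} t * \<psi> j t) = integral {0<..<1} (\<psi> j)"
      using set_borel_integral_eq_integral(2)[OF int[of j]]
      by (simp add: set_lebesgue_integral_def)
    also have "\<dots> = I j"
      using integral_open_interval_real[of 0 1 "\<psi> j"] I[of j] by (simp add: integral_unique)
    finally show ?thesis .
  qed
  have ind: "indicator cube x *\<^sub>R tensor \<psi> x
      = complex_of_real (\<Prod>j\<in>UNIV. indicator {0<..<1} (x $ j) * \<psi> j (x $ j))" for x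
  proof (cases "x \<in> cube")
    case True
    then show ?thesis by (simp add: tensor_def cube_def mem_box_cart)
  next
    case False
    then obtain j where "indicator {0<..<1::real} (x $ j) = (0 :: real)"
      by (auto simp: cube_def mem_box_cart indicator_def)
    then have "(\<Prod>j\<in>UNIV. indicator {0<..<1} (x $ j) * \<psi> j (x $ j)) = 0"
      by (intro prod_zero) auto
    then show ?thesis using False by simp
  qed
  have "(LINT x|cube_measure. tensor \<psi> x) = of_real (LINT x|lborel.
      (\<Prod>j\<in>UNIV. indicator {0<..<1} ((x :: real ^ 'n) $ j) * \<psi> j (x $ j)))"
    unfolding cube_integral_lborel[OF tensor_continuous[OF cont]] ind
    by (rule integral_complex_of_real)
  also have "\<dots> = of_real (\<Prod>j\<in>UNIV. I j)"
    using int unfolding set_integrable_def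
    by (subst lborel_integral_prod) (auto simp: I_eq)
  finally show ?thesis .
qed

text \<open>By translation invariance every difference quotient of \<open>F\<close> in the direction \<open>i\<close> has integral zero, and the
  mean value theorem bounds the quotients uniformly; dominated convergence carries this over to the derivative.\<close>

lemma cube_integral_pderiv_eq_0:
  fixes F :: "real ^ 'n::finite \<Rightarrow> complex"
  assumes diff: "\<And>x. F differentiable (at x)" and cont: "continuous_on UNIV (pderiv_cl i F)"
    and K: "compact K" "{x. F x \<noteq> 0} \<subseteq> K" "K \<subseteq> cube"
  shows "(LINT x|cube_measure. pderiv_cl i F x) = 0"
proof -
  let ?g = "pderiv_cl i F" and ?e = "axis i 1 :: real ^ 'n"
  have F_der: "(F has_derivative frechet_derivative F (at x)) (at x)" for x
    using diff frechet_derivative_works by blast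
  have F_cont: "continuous_on UNIV F"
    using diff by (meson continuous_at_imp_continuous_on differentiable_imp_continuous_within)
  have line: "((\<lambda>s. F (x + s *\<^sub>R ?e)) has_vector_derivative ?g (x + s *\<^sub>R ?e)) (at s within A)" for x s A
  proof -
    have "((\<lambda>s. x + s *\<^sub>R ?e) has_derivative (\<lambda>h. h *\<^sub>R ?e)) (at s within A)"
      by (auto intro!: derivative_eq_intros)
    from has_derivative_compose[OF this F_der]
    have "((\<lambda>s. F (x + s *\<^sub>R ?e)) has_derivative
        (\<lambda>h. frechet_derivative F (at (x + s *\<^sub>R ?e)) (h *\<^sub>R ?e))) (at s within A)" .
    then show ?thesis
      unfolding has_vector_derivative_def pderiv_cl_def
      using linear_frechet_derivative[OF diff] by (simp add: linear_scale)
  qed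
  have g0: "?g x = 0" if "x \<notin> K" for x
  proof -
    have "(F has_derivative (\<lambda>h. 0)) (at x)"
      by (rule has_derivative_transform_within_open[where s = "- K" and f = "\<lambda>x. 0"])
         (use K that in \<open>auto simp: compact_imp_closed\<close>)
    then show ?thesis
      unfolding pderiv_cl_def by (metis frechet_derivative_at)
  qed
  obtain B where B: "\<And>x. x \<in> K \<Longrightarrow> cmod (?g x) \<le> B" "B > 0"
  proof -
    have "compact (?g ` K)"
      by (intro compact_continuous_image continuous_on_subset[OF cont] K) auto
    then obtain B where "\<And>x. x \<in> K \<Longrightarrow> cmod (?g x) \<le> B"
      using compact_imp_bounded by (metis bounded_iff imageI)
    then show ?thesis using that[of "max B 1"] by fastforce
  qed
  have gB: "cmod (?g x) \<le> B" for x
    using B g0 by (cases "x \<in> K") auto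
  define D where "D m x = real (Suc m) *\<^sub>R (F (x + (1 / real (Suc m)) *\<^sub>R ?e) - F x)" for m x
  have [measurable]: "F \<in> borel_measurable borel" "?g \<in> borel_measurable borel"
    using F_cont cont by (auto intro: borel_measurable_continuous_onI)
  have F_int: "integrable lborel F"
  proof -
    have "integrable lborel (\<lambda>x. indicator K x *\<^sub>R F x)"
      by (rule borel_integrable_compact[OF K(1) continuous_on_subset[OF F_cont]]) auto
    moreover have "(\<lambda>x. indicator K x *\<^sub>R F x) = F"
      using K(2) by (auto simp: indicator_def fun_eq_iff)
    ultimately show ?thesis by simp
  qed
  have shift: "integrable lborel (\<lambda>x. F (x + c)) \<and> (LINT x|lborel. F (x + c)) = (LINT x|lborel. F x)" for c
  proof -
    have "integrable (distr lborel borel ((+) c)) F"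
      unfolding lborel_distr_plus by (rule F_int)
    then have "integrable lborel (\<lambda>x. F (c + x))"
      by (subst (asm) integrable_distr_eq) auto
    moreover have "(LINT x|distr lborel borel ((+) c). F x) = (LINT x|lborel. F (c + x))"
      by (rule integral_distr) auto
    ultimately show ?thesis
      unfolding lborel_distr_plus by (simp add: add.commute)
  qed
  have D_int: "(LINT x|lborel. D m x) = 0" for m
    unfolding D_def using shift F_int by simp
  have "(\<lambda>m. LINT x|lborel. D m x) \<longlonglongrightarrow> (LINT x|lborel. ?g x)"
  proof (rule integral_dominated_convergence)
    \<comment> \<open>Shifts by at most \<open>1\<close> keep the supports of all difference quotients inside this box.\<close>
    show "integrable lborel (\<lambda>x :: real ^ 'n. indicator (cbox (- 1) 2) x * B)"
      using borel_integrable_compact[OF compact_cbox continuous_on_const, of "- 1" 2 B] by simp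
    show "D m \<in> borel_measurable lborel" for m unfolding D_def by measurable
    show "?g \<in> borel_measurable lborel" by simp
    show "AE x in lborel. (\<lambda>m. D m x) \<longlonglongrightarrow> ?g x"
    proof (rule AE_I2)
      fix x
      have "((\<lambda>s. F (x + s *\<^sub>R ?e)) has_vector_derivative ?g (x + 0 *\<^sub>R ?e)) (at 0)"
        by (rule line)
      then have "((\<lambda>s. (F (x + s *\<^sub>R ?e) - F x - s *\<^sub>R ?g x) /\<^sub>R \<bar>s\<bar>) \<longlongrightarrow> 0) (at 0)"
        by (simp add: has_vector_derivative_def has_derivative_def)
      then have "((\<lambda>s. norm ((F (x + s *\<^sub>R ?e) - F x - s *\<^sub>R ?g x) /\<^sub>R \<bar>s\<bar>)) \<longlongrightarrow> 0) (at 0)"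
        by (rule tendsto_norm_zero)
      then have "((\<lambda>s. norm ((F (x + s *\<^sub>R ?e) - F x) /\<^sub>R s - ?g x)) \<longlongrightarrow> 0) (at 0)"
      proof (rule Lim_transform_eventually)
        have "norm ((F (x + s *\<^sub>R ?e) - F x - s *\<^sub>R ?g x) /\<^sub>R \<bar>s\<bar>)
            = norm ((F (x + s *\<^sub>R ?e) - F x) /\<^sub>R s - ?g x)" if "s \<noteq> 0" for s
        proof -
          have "(F (x + s *\<^sub>R ?e) - F x) /\<^sub>R s - ?g x
              = (F (x + s *\<^sub>R ?e) - F x - s *\<^sub>R ?g x) /\<^sub>R s"
            using that by (simp add: scaleR_diff_right)
          then show ?thesis by simp
        qed
        then show "\<forall>\<^sub>F s in at 0. norm ((F (x + s *\<^sub>R ?e) - F x - s *\<^sub>R ?g x) /\<^sub>R \<bar>s\<bar>)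
            = norm ((F (x + s *\<^sub>R ?e) - F x) /\<^sub>R s - ?g x)"
          by (auto simp: eventually_at_filter)
      qed
      then have "((\<lambda>s. (F (x + s *\<^sub>R ?e) - F x) /\<^sub>R s) \<longlongrightarrow> ?g x) (at 0)"
        by (rule LIM_zero_cancel[OF tendsto_norm_zero_cancel])
      moreover have "filterlim (\<lambda>m. 1 / real (Suc m)) (at 0) sequentially"
        unfolding filterlim_at using LIMSEQ_inverse_real_of_nat
        by (auto simp: inverse_eq_divide)
      ultimately have "(\<lambda>m. (F (x + (1 / real (Suc m)) *\<^sub>R ?e) - F x) /\<^sub>R (1 / real (Suc m))) \<longlonglongrightarrow> ?g x"
        by (rule filterlim_compose)
      then show "(\<lambda>m. D m x) \<longlonglongrightarrow> ?g x" by (simp add: D_def)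
    qed
    show "AE x in lborel. norm (D m x) \<le> indicator (cbox (- 1) 2) x * B" for m
    proof (rule AE_I2)
      fix x
      let ?t = "1 / real (Suc m)"
      have "norm (F (x + ?t *\<^sub>R ?e) - F (x + 0 *\<^sub>R ?e)) \<le> B * norm (?t - 0)"
      proof (rule differentiable_bound[where S = UNIV])
        show "((\<lambda>s. F (x + s *\<^sub>R ?e)) has_derivative (\<lambda>h. h *\<^sub>R ?g (x + s *\<^sub>R ?e))) (at s within UNIV)" for s
          using line by (simp add: has_vector_derivative_def)
        show "onorm (\<lambda>h. h *\<^sub>R ?g (x + s *\<^sub>R ?e)) \<le> B" for s
          by (rule onorm_bound) (use gB B in \<open>auto simp: mult.commute[of B] mult_left_mono\<close>)
      qed auto
      then have le: "norm (D m x) \<le> B"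
        by (simp add: D_def divide_simps mult.commute)
      show "norm (D m x) \<le> indicator (cbox (- 1) 2) x * B"
      proof (cases "x \<in> cbox (- 1) 2")
        case False
        then obtain j where j: "x $ j < - 1 \<or> x $ j > 2"
          by (auto simp: mem_box_cart not_le)
        have "y \<notin> K" if "y $ j < 0 \<or> y $ j > 1" for y
        proof
          assume "y \<in> K"
          then have "y \<in> cube" using K(3) by blast
          then have "0 < y $ j" "y $ j < 1" by (auto simp: cube_def mem_box_cart)
          then show False using that by linarith
        qed
        then have y: "F y = 0" if "y $ j < 0 \<or> y $ j > 1" for y
          using that K(2) by blast
        have "0 \<le> (?t *\<^sub>R ?e) $ j \<and> (?t *\<^sub>R ?e) $ j \<le> 1"
          by (auto simp: axis_def)
        then have "(x + ?t *\<^sub>R ?e) $ j < 0 \<or> (x + ?t *\<^sub>R ?e) $ j > 1"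
          using j unfolding vector_add_component by linarith
        then have "F x = 0" "F (x + ?t *\<^sub>R ?e) = 0"
          using j by (auto intro!: y simp del: vector_add_component)
        then show ?thesis using B by (simp add: D_def)
      qed (use le in simp)
    qed
  qed
  then have "(LINT x|lborel. ?g x) = 0"
    by (simp add: D_int LIMSEQ_const_iff)
  moreover have "(\<lambda>x. indicator cube x *\<^sub>R ?g x) = ?g"
    using g0 K(3) by (auto simp: indicator_def fun_eq_iff)
  ultimately show ?thesis
    using cube_integral_lborel[OF cont] by simp
qed

lemma square_integrable_continuous:
  fixes f :: "real ^ 'n::finite \<Rightarrow> complex"
  assumes "continuous_on UNIV f"
  shows "square_integrable f"
proof -
  have "compact (f ` cbox 0 1)"
    by (intro compact_continuous_image continuous_on_subset[OF assms]) auto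
  then obtain B where "\<And>x. x \<in> cbox 0 1 \<Longrightarrow> cmod (f x) \<le> B"
    using compact_imp_bounded by (metis bounded_iff imageI)
  then show ?thesis
    using box_subset_cbox[of 0 1]
    by (intro square_integrable_bounded[where B = B] continuous_imp_cube_measurable assms)
       (auto simp: cube_def)
qed

lemma test_funD:
  assumes "test_fun \<phi>"
  shows "\<And>x. \<phi> differentiable (at x)" "continuous_on UNIV \<phi>" "continuous_on UNIV (pderiv_cl i \<phi>)"
    "compact (closure {x. \<phi> x \<noteq> 0})" "closure {x. \<phi> x \<noteq> 0} \<subseteq> cube"
    "{x. \<phi> x \<noteq> 0} \<subseteq> closure {x. \<phi> x \<noteq> 0}"
proof -
  have "Ck 0 \<phi>" "Ck (Suc 0) \<phi>" using assms by (auto simp: test_fun_def simp del: Ck.simps)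
  then show "\<And>x. \<phi> differentiable (at x)" "continuous_on UNIV \<phi>" "continuous_on UNIV (pderiv_cl i \<phi>)"
    by auto
qed (use assms in \<open>simp_all add: test_fun_def closure_subset\<close>)

text \<open>The product of \<open>f\<close> with a test function has compact support in the cube, so the integral of its derivative
  vanishes; Leibniz' rule turns this into integration by parts.\<close>

lemma classical_imp_weak_pderiv:
  fixes f :: "real ^ 'n::finite \<Rightarrow> complex"
  assumes diff: "\<And>x. f differentiable (at x)" and cont: "continuous_on UNIV (pderiv_cl i f)"
  shows "weak_pderiv i (abs_L2_cube f) (abs_L2_cube (pderiv_cl i f))"
proof -
  have f_cont: "continuous_on UNIV f"
    using diff by (meson continuous_at_imp_continuous_on differentiable_imp_continuous_within)
  have f: "square_integrable f" "square_integrable (pderiv_cl i f)"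
    by (intro square_integrable_continuous f_cont cont)+
  have "(LINT x|cube_measure. f x * pderiv_cl i \<phi> x) = - (LINT x|cube_measure. pderiv_cl i f x * \<phi> x)"
    if \<phi>: "test_fun \<phi>" for \<phi>
  proof -
    note \<phi>D = test_funD[OF \<phi>]
    have \<phi>s: "square_integrable \<phi>" "square_integrable (pderiv_cl i \<phi>)"
      by (intro square_integrable_continuous \<phi>D)+
    have pd: "pderiv_cl i (\<lambda>x. f x * \<phi> x) = (\<lambda>x. f x * pderiv_cl i \<phi> x + pderiv_cl i f x * \<phi> x)"
    proof
      fix x
      have "((\<lambda>x. f x * \<phi> x) has_derivative (\<lambda>h. f x * frechet_derivative \<phi> (at x) h
          + frechet_derivative f (at x) h * \<phi> x)) (at x)"
        by (intro has_derivative_mult) (use diff \<phi>D(1) frechet_derivative_works in blast)+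
      from frechet_derivative_at[OF this]
      show "pderiv_cl i (\<lambda>x. f x * \<phi> x) x = f x * pderiv_cl i \<phi> x + pderiv_cl i f x * \<phi> x"
        unfolding pderiv_cl_def by metis
    qed
    have "(LINT x|cube_measure. pderiv_cl i (\<lambda>x. f x * \<phi> x) x) = 0"
    proof (rule cube_integral_pderiv_eq_0)
      show "(\<lambda>x. f x * \<phi> x) differentiable (at x)" for x
        by (intro differentiable_mult diff \<phi>D)
      show "continuous_on UNIV (pderiv_cl i (\<lambda>x. f x * \<phi> x))"
        unfolding pd by (intro continuous_intros f_cont cont \<phi>D)
      show "{x. f x * \<phi> x \<noteq> 0} \<subseteq> closure {x. \<phi> x \<noteq> 0}"
        using \<phi>D(6) by auto
    qed (rule \<phi>D)+
    then show ?thesis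
      unfolding pd using f \<phi>s by (simp add: integrable_square_integrable_mult eq_neg_iff_add_eq_0)
  qed
  then show ?thesis using f by (simp add: abs_L2_cube_simps)
qed

section \<open>Completeness of the sine system\<close>

lemma tensor_upd:
  "tensor (\<psi>(j := w)) x = of_real (w (x $ j)) * of_real (\<Prod>i\<in>UNIV - {j}. \<psi> i (x $ i))"
proof -
  have "(\<Prod>i\<in>UNIV. (\<psi>(j := w)) i (x $ i)) = w (x $ j) * (\<Prod>i\<in>UNIV - {j}. (\<psi>(j := w)) i (x $ i))"
    by (subst prod.remove[of UNIV j]) auto
  also have "(\<Prod>i\<in>UNIV - {j}. (\<psi>(j := w)) i (x $ i)) = (\<Prod>i\<in>UNIV - {j}. \<psi> i (x $ i))"
    by (intro prod.cong) auto
  finally show ?thesis by (simp add: tensor_def)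
qed

lemma borel_imp_cube_measurable:
  fixes f :: "real ^ 'n::finite \<Rightarrow> 'b::topological_space"
  shows "f \<in> borel_measurable borel \<Longrightarrow> f \<in> borel_measurable cube_measure"
  by (intro measurable_restrict_space1 measurable_completion) simp

lemma tensor_measurable:
  fixes \<psi> :: "'n::finite \<Rightarrow> real \<Rightarrow> real"
  assumes [measurable]: "\<And>j. \<psi> j \<in> borel_measurable borel"
  shows "tensor \<psi> \<in> borel_measurable cube_measure"
proof (rule borel_imp_cube_measurable)
  have "(\<lambda>x :: real ^ 'n. x $ j) \<in> borel_measurable borel" for j
    by (intro borel_measurable_continuous_onI continuous_intros)
  then have "(\<lambda>x :: real ^ 'n. \<psi> j (x $ j)) \<in> borel_measurable borel" for j
    by measurable
  then show "tensor \<psi> \<in> borel_measurable borel"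
    unfolding tensor_def[abs_def] by measurable
qed

lemma cmod_tensor_le:
  fixes \<psi> :: "'n::finite \<Rightarrow> real \<Rightarrow> real"
  assumes "\<And>j t. 0 < t \<Longrightarrow> t < 1 \<Longrightarrow> \<bar>\<psi> j t\<bar> \<le> C j" "x \<in> cube"
  shows "cmod (tensor \<psi> x) \<le> (\<Prod>j\<in>UNIV. C j)"
  unfolding tensor_def norm_of_real abs_prod
  using assms by (intro prod_mono) (auto simp: cube_def mem_box_cart)

lemma integrable_mult_bounded:
  fixes f g :: "real ^ 'n::finite \<Rightarrow> complex"
  assumes g: "integrable cube_measure g" and f: "f \<in> borel_measurable cube_measure"
    "\<And>x. x \<in> cube \<Longrightarrow> cmod (f x) \<le> B"
  shows "integrable cube_measure (\<lambda>x. g x * f x)"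
proof (rule Bochner_Integration.integrable_bound)
  show "integrable cube_measure (\<lambda>x. B * cmod (g x))" using g by simp
  show "(\<lambda>x. g x * f x) \<in> borel_measurable cube_measure"
    using f borel_measurable_integrable[OF g] by measurable
  show "AE x in cube_measure. norm (g x * f x) \<le> norm (B * cmod (g x))"
  proof (rule AE_I2)
    fix x assume "x \<in> space (cube_measure :: (real ^ 'n) measure)"
    then have "cmod (f x) \<le> \<bar>B\<bar>" using f(2)[of x] by auto
    then show "norm (g x * f x) \<le> norm (B * cmod (g x))"
      by (simp add: norm_mult abs_mult mult.commute[of "cmod (g x)"] mult_right_mono)
  qed
qed

text \<open>Multiplying \<open>sin (k \<pi> t)\<close> by \<open>cos (\<pi> t)\<close> gives half the sum of the two neighbouring sines, so \<open>V\<close> contains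
  \<open>sin (\<pi> t)\<close> times each polynomial in \<open>cos (\<pi> t)\<close>, by Weierstrass' theorem also times each continuous function
  of \<open>cos (\<pi> t)\<close>. Since the cosine decreases on \<open>[0, \<pi>]\<close>, step functions in \<open>t\<close> are bounded limits of these.\<close>

lemma sine_closure_contains_step:
  fixes V :: "(real \<Rightarrow> real) \<Rightarrow> bool"
  assumes sine: "\<And>k :: nat. k \<ge> 1 \<Longrightarrow> V (\<lambda>t. sin (real k * pi * t))"
    and lin: "\<And>v w a b. V v \<Longrightarrow> V w \<Longrightarrow> V (\<lambda>t. a * v t + b * w t)"
    and lim: "\<And>v w C. (\<And>m :: nat. V (v m)) \<Longrightarrow> (\<And>m t. 0 < t \<Longrightarrow> t < 1 \<Longrightarrow> \<bar>v m t\<bar> \<le> C) \<Longrightarrow>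
      (\<And>t. 0 < t \<Longrightarrow> t < 1 \<Longrightarrow> (\<lambda>m. v m t) \<longlonglongrightarrow> w t) \<Longrightarrow> w \<in> borel_measurable borel \<Longrightarrow> V w"
  shows "V (\<lambda>t. sin (pi * t) * indicator {..b} t)"
proof -
  have zero: "V (\<lambda>t. 0)"
    using lin[OF sine[of 1] sine[of 1], of 0 0] by simp
  \<comment> \<open>The case \<open>k = 0\<close> is included because it is the lower neighbour of \<open>k = 1\<close>.\<close>
  have cos_pow: "V (\<lambda>t. sin (real k * pi * t) * cos (pi * t) ^ m)" for k m
  proof (induction m arbitrary: k)
    case 0
    then show ?case using sine[of k] zero by (cases "k = 0") auto
  next
    case (Suc m)
    show ?case
    proof (cases k)
      case 0
      then show ?thesis using zero by simp
    next
      case (Suc l)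
      have "sin (real k * pi * t) * cos (pi * t) ^ Suc m
          = 1 / 2 * (sin (real (Suc k) * pi * t) * cos (pi * t) ^ m)
            + 1 / 2 * (sin (real l * pi * t) * cos (pi * t) ^ m)" for t
      proof -
        have "sin (real k * pi * t) * cos (pi * t)
            = (sin (real k * pi * t + pi * t) + sin (real k * pi * t - pi * t)) / 2"
          by (rule sin_times_cos)
        also have "real k * pi * t + pi * t = real (Suc k) * pi * t" by (simp add: algebra_simps)
        also have "real k * pi * t - pi * t = real l * pi * t" by (simp add: Suc algebra_simps)
        finally have e: "sin (real k * pi * t) * cos (pi * t)
            = (sin (real (Suc k) * pi * t) + sin (real l * pi * t)) / 2" .
        have "sin (real k * pi * t) * cos (pi * t) ^ Suc m
            = (sin (real k * pi * t) * cos (pi * t)) * cos (pi * t) ^ m"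
          by simp
        then show ?thesis unfolding e by (simp add: distrib_right add_divide_distrib)
      qed
      then show ?thesis
        using lin[OF Suc.IH[of "Suc k"] Suc.IH[of l], of "1 / 2" "1 / 2"] by presburger
    qed
  qed
  have poly: "V (\<lambda>t. sin (pi * t) * p (cos (pi * t)))" if p: "real_polynomial_function p" for p
  proof -
    obtain a n where "p = (\<lambda>x. \<Sum>i\<le>n. a i * x ^ i)"
      using p unfolding real_polynomial_function_iff_sum by blast
    moreover have "V (\<lambda>t. \<Sum>i\<le>n. a i * (sin (pi * t) * cos (pi * t) ^ i))" for n :: nat
    proof (induction n)
      case 0
      show ?case using lin[OF cos_pow[of 1 0] zero, of "a 0" 0] by simp
    next
      case (Suc n)
      show ?case using lin[OF Suc cos_pow[of 1 "Suc n"], of 1 "a (Suc n)"] by simp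
    qed
    ultimately show ?thesis by (simp add: sum_distrib_left mult.left_commute)
  qed
  have cont: "V (\<lambda>t. sin (pi * t) * q (cos (pi * t)))" if q: "continuous_on UNIV q" for q :: "real \<Rightarrow> real"
  proof -
    have "\<exists>p. real_polynomial_function p \<and> (\<forall>x\<in>{-1..1}. \<bar>q x - p x\<bar> < 1 / real (Suc m))" for m
      using Stone_Weierstrass_real_polynomial_function[of "{-1..1}" q "1 / real (Suc m)"]
        continuous_on_subset[OF q] by (metis compact_Icc of_nat_0_less_iff subset_UNIV
          zero_less_Suc zero_less_divide_1_iff)
    then obtain p where p: "\<And>m. real_polynomial_function (p m)"
      "\<And>m x. x \<in> {-1..1} \<Longrightarrow> \<bar>q x - p m x\<bar> < 1 / real (Suc m)"
      by metis
    obtain B where B: "\<And>x. x \<in> {-1..1} \<Longrightarrow> \<bar>q x\<bar> \<le> B"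
    proof -
      have "compact (q ` {-1..1})"
        by (intro compact_continuous_image continuous_on_subset[OF q]) auto
      then show ?thesis using that compact_imp_bounded by (metis bounded_iff imageI real_norm_def)
    qed
    show ?thesis
    proof (rule lim)
      show "V (\<lambda>t. sin (pi * t) * p m (cos (pi * t)))" for m by (rule poly[OF p(1)])
      show "\<bar>sin (pi * t) * p m (cos (pi * t))\<bar> \<le> 1 * (B + 1)" for m t
      proof -
        have c: "cos (pi * t) \<in> {-1..1}" by simp
        have "1 / real (Suc m) \<le> 1" by simp
        then have "\<bar>p m (cos (pi * t))\<bar> \<le> B + 1"
          using p(2)[OF c, of m] B[OF c] by linarith
        then show ?thesis unfolding abs_mult by (intro mult_mono) auto
      qed
      show "(\<lambda>m. sin (pi * t) * p m (cos (pi * t))) \<longlonglongrightarrow> sin (pi * t) * q (cos (pi * t))" for t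
      proof (intro tendsto_mult tendsto_const LIM_zero_cancel[where l = "q (cos (pi * t))"])
        show "(\<lambda>m. p m (cos (pi * t)) - q (cos (pi * t))) \<longlonglongrightarrow> 0"
        proof (rule Lim_null_comparison)
          show "\<forall>\<^sub>F m in sequentially. norm (p m (cos (pi * t)) - q (cos (pi * t))) \<le> 1 / real (Suc m)"
            using p(2)[of "cos (pi * t)"]
            by (auto simp: abs_minus_commute intro!: always_eventually less_imp_le)
          show "(\<lambda>m. 1 / real (Suc m)) \<longlonglongrightarrow> 0"
            using LIMSEQ_inverse_real_of_nat by (simp add: inverse_eq_divide)
        qed
      qed
      show "(\<lambda>t. sin (pi * t) * q (cos (pi * t))) \<in> borel_measurable borel"
        by (intro borel_measurable_continuous_onI continuous_intros continuous_on_compose2[OF q]) auto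
    qed
  qed
  have meas: "(\<lambda>t. sin (pi * t) * indicator {..b} t) \<in> borel_measurable borel" for b
    by (intro borel_measurable_times borel_measurable_continuous_onI continuous_intros
        borel_measurable_indicator) simp
  have unit: "V (\<lambda>t. sin (pi * t) * indicator {..b} t)" if b: "0 \<le> b" "b \<le> 1" for b
  proof (rule lim)
    \<comment> \<open>\<open>Q m\<close> is \<open>1\<close> from \<open>cos (\<pi> b)\<close> upwards and falls to \<open>0\<close> within distance \<open>1 / m\<close> below.\<close>
    define Q where "Q m x = max 0 (min 1 (1 + real m * (x - cos (pi * b))))" for m :: nat and x
    show "V (\<lambda>t. sin (pi * t) * Q m (cos (pi * t)))" for m
      unfolding Q_def by (rule cont) (intro continuous_intros)
    show "\<bar>sin (pi * t) * Q m (cos (pi * t))\<bar> \<le> 1 * 1" for m t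
      unfolding abs_mult by (intro mult_mono) (auto simp: Q_def)
    show "(\<lambda>m. sin (pi * t) * Q m (cos (pi * t))) \<longlonglongrightarrow> sin (pi * t) * indicator {..b} t"
      if t: "0 < t" "t < 1" for t
    proof (intro tendsto_mult tendsto_const)
      have iff: "t \<le> b \<longleftrightarrow> cos (pi * b) \<le> cos (pi * t)"
        using t b by (subst cos_mono_le_eq) auto
      show "(\<lambda>m. Q m (cos (pi * t))) \<longlonglongrightarrow> indicator {..b} t"
      proof (cases "t \<le> b")
        case True
        then have "Q m (cos (pi * t)) = 1" for m using iff by (simp add: Q_def)
        then show ?thesis using True by simp
      next
        case False
        then have d: "cos (pi * b) - cos (pi * t) > 0" using iff by simp
        obtain n where n: "1 < real n * (cos (pi * b) - cos (pi * t))"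
          using ex_less_of_nat_mult[OF d] by blast
        have "Q m (cos (pi * t)) = 0" if "m \<ge> n" for m
        proof -
          have "real n * (cos (pi * b) - cos (pi * t)) \<le> real m * (cos (pi * b) - cos (pi * t))"
            using that d by (intro mult_right_mono) auto
          then have "1 + real m * (cos (pi * t) - cos (pi * b)) < 0"
            using n by (simp add: algebra_simps)
          then show ?thesis by (simp add: Q_def)
        qed
        then have "\<forall>\<^sub>F m in sequentially. Q m (cos (pi * t)) = 0"
          by (auto simp: eventually_sequentially)
        then show ?thesis using False by (simp add: tendsto_eventually)
      qed
    qed
  qed (rule meas)
  \<comment> \<open>Only values on \<open>(0, 1)\<close> matter, so \<open>b\<close> may be moved into \<open>[0, 1]\<close>.\<close>
  define c where "c = max 0 (min 1 b)"
  show ?thesis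
  proof (rule lim)
    show "V (\<lambda>t. sin (pi * t) * indicator {..c} t)" for m :: nat
      by (rule unit) (auto simp: c_def)
    show "\<bar>sin (pi * t) * indicator {..c} t\<bar> \<le> 1 * 1" for t
      unfolding abs_mult by (intro mult_mono) (auto simp: indicator_def)
    show "(\<lambda>m. sin (pi * t) * indicator {..c} t) \<longlonglongrightarrow> sin (pi * t) * indicator {..b} t"
      if "0 < t" "t < 1" for t
      using that by (auto simp: c_def indicator_def)
  qed (rule meas)
qed

text \<open>The variables are treated one at a time. When the factors in all other variables are fixed, the functions
  of the remaining variable for which the integral vanishes form a class as in the preceding lemma. The induction
  runs over the set \<open>J\<close> of variables in which the sine has already been replaced by a step.\<close>

lemma sine_orthogonal_imp_step_orthogonal:
  fixes g :: "real ^ 'n::finite \<Rightarrow> complex"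
  assumes g: "integrable cube_measure g"
    and orth: "\<And>k :: 'n \<Rightarrow> nat. (\<And>j. 1 \<le> k j) \<Longrightarrow>
      (LINT x|cube_measure. g x * tensor (\<lambda>j t. sin (real (k j) * pi * t)) x) = 0"
  shows "(LINT x|cube_measure. g x * tensor (\<lambda>j t. sin (pi * t) * indicator {..b $ j} t) x) = 0"
proof -
  define sine where "sine \<psi> \<longleftrightarrow> (\<exists>k :: nat. 1 \<le> k \<and> \<psi> = (\<lambda>t. sin (real k * pi * t)))" for \<psi>
  define step where "step \<psi> \<longleftrightarrow> (\<exists>b. \<psi> = (\<lambda>t. sin (pi * t) * indicator {..b :: real} t))" for \<psi>
  define bm where "bm \<psi> \<longleftrightarrow> \<psi> \<in> borel_measurable borel \<and>
    (\<exists>C. \<forall>t. 0 < t \<longrightarrow> t < 1 \<longrightarrow> \<bar>\<psi> t\<bar> \<le> C)" for \<psi> :: "real \<Rightarrow> real"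
  have bm_ss: "bm \<psi>" if "sine \<psi> \<or> step \<psi>" for \<psi>
  proof -
    have "(\<lambda>t. sin (c * t)) \<in> borel_measurable borel"
      "(\<lambda>t. sin (c * t) * indicator {..b} t) \<in> borel_measurable borel" for c b :: real
      by measurable
    then have "\<psi> \<in> borel_measurable borel"
      using that by (auto simp: sine_def step_def)
    moreover have "\<bar>\<psi> t\<bar> \<le> 1" for t
      using that by (auto simp: sine_def step_def indicator_def)
    ultimately show ?thesis by (auto simp: bm_def)
  qed
  have int: "integrable cube_measure (\<lambda>x. g x * tensor \<psi> x)" if bm: "\<And>j. bm (\<psi> j)" for \<psi>
  proof -
    have "\<forall>j. \<exists>C. \<forall>t. 0 < t \<longrightarrow> t < 1 \<longrightarrow> \<bar>\<psi> j t\<bar> \<le> C"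
      using bm by (auto simp: bm_def)
    then obtain C where "\<And>j t. 0 < t \<Longrightarrow> t < 1 \<Longrightarrow> \<bar>\<psi> j t\<bar> \<le> C j" by metis
    then show ?thesis
      using bm by (intro integrable_mult_bounded[OF g tensor_measurable cmod_tensor_le])
        (auto simp: bm_def)
  qed
  have "(LINT x|cube_measure. g x * tensor \<psi> x) = 0"
    if "finite J" "\<And>j. j \<in> J \<Longrightarrow> step (\<psi> j)" "\<And>j. j \<notin> J \<Longrightarrow> sine (\<psi> j)" for J \<psi>
    using that
  proof (induction J arbitrary: \<psi> rule: finite_induct)
    case empty
    then have "\<forall>j. \<exists>k :: nat. 1 \<le> k \<and> \<psi> j = (\<lambda>t. sin (real k * pi * t))"
      by (simp add: sine_def)
    then obtain k :: "'n \<Rightarrow> nat" where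
      "\<And>j. 1 \<le> k j" "\<And>j. \<psi> j = (\<lambda>t. sin (real (k j) * pi * t))" by metis
    moreover from this have "\<psi> = (\<lambda>j t. sin (real (k j) * pi * t))" by auto
    ultimately show ?case using orth by simp
  next
    case (insert j J)
    define V where "V w \<longleftrightarrow> bm w \<and> (LINT x|cube_measure. g x * tensor (\<psi>(j := w)) x) = 0" for w
    have bm: "bm (\<psi> i)" for i
      using insert.prems[of i] bm_ss by (cases "i \<in> insert j J") auto
    have bm_upd: "bm ((\<psi>(j := w)) i)" if "bm w" for w i
      using that bm by simp
    have "V (\<lambda>t. sin (pi * t) * indicator {..b} t)" for b
    proof (rule sine_closure_contains_step)
      fix k :: nat assume k: "k \<ge> 1"
      then have s: "sine (\<lambda>t. sin (real k * pi * t))" by (auto simp: sine_def)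
      have "(LINT x|cube_measure. g x * tensor (\<psi>(j := (\<lambda>t. sin (real k * pi * t)))) x) = 0"
        using insert s by (intro insert.IH) auto
      then show "V (\<lambda>t. sin (real k * pi * t))"
        using bm_ss s by (simp add: V_def)
    next
      fix v w a b assume V: "V v" "V w"
      obtain C D where "\<And>t. 0 < t \<Longrightarrow> t < 1 \<Longrightarrow> \<bar>v t\<bar> \<le> C" "\<And>t. 0 < t \<Longrightarrow> t < 1 \<Longrightarrow> \<bar>w t\<bar> \<le> D"
        using V by (auto simp: V_def bm_def)
      then have "\<bar>a * v t + b * w t\<bar> \<le> \<bar>a\<bar> * C + \<bar>b\<bar> * D" if "0 < t" "t < 1" for t
        using that by (intro order_trans[OF abs_triangle_ineq] add_mono)
          (auto simp: abs_mult mult_left_mono)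
      moreover have "(\<lambda>t. a * v t + b * w t) \<in> borel_measurable borel"
        using V by (auto simp: V_def bm_def)
      ultimately have "bm (\<lambda>t. a * v t + b * w t)"
        by (auto simp: bm_def)
      moreover have "g x * tensor (\<psi>(j := \<lambda>t. a * v t + b * w t)) x
          = of_real a * (g x * tensor (\<psi>(j := v)) x) + of_real b * (g x * tensor (\<psi>(j := w)) x)" for x
        by (simp add: tensor_upd algebra_simps)
      moreover have "integrable cube_measure (\<lambda>x. g x * tensor (\<psi>(j := v)) x)"
        "integrable cube_measure (\<lambda>x. g x * tensor (\<psi>(j := w)) x)"
        using V by (intro int bm_upd; simp add: V_def)+
      ultimately show "V (\<lambda>t. a * v t + b * w t)"
        using V by (simp add: V_def)
    next
      fix v :: "nat \<Rightarrow> real \<Rightarrow> real" and w C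
      assume V: "\<And>m. V (v m)" and C: "\<And>m t. 0 < t \<Longrightarrow> t < 1 \<Longrightarrow> \<bar>v m t\<bar> \<le> C"
        and lim: "\<And>t. 0 < t \<Longrightarrow> t < 1 \<Longrightarrow> (\<lambda>m. v m t) \<longlonglongrightarrow> w t"
        and w: "w \<in> borel_measurable borel"
      have "\<bar>w t\<bar> \<le> C" if "0 < t" "t < 1" for t
        using LIMSEQ_le_const2[OF tendsto_rabs[OF lim[OF that]]] C[OF that] by blast
      then have bmw: "bm w" using w by (auto simp: bm_def)
      have "(\<lambda>m. LINT x|cube_measure. g x * tensor (\<psi>(j := v m)) x)
          \<longlonglongrightarrow> (LINT x|cube_measure. g x * tensor (\<psi>(j := w)) x)"
      proof (rule integral_dominated_convergence)
        have "bm (\<lambda>t. C)" by (auto simp: bm_def)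
        then show "integrable cube_measure (\<lambda>x. cmod (g x * tensor (\<psi>(j := \<lambda>t. C)) x))"
          by (intro integrable_norm int bm_upd)
        show "(\<lambda>x. g x * tensor (\<psi>(j := w)) x) \<in> borel_measurable cube_measure"
          by (intro borel_measurable_integrable int bm_upd bmw)
        show "(\<lambda>x. g x * tensor (\<psi>(j := v m)) x) \<in> borel_measurable cube_measure" for m
          using V by (intro borel_measurable_integrable int bm_upd) (auto simp: V_def)
        show "AE x in cube_measure. (\<lambda>m. g x * tensor (\<psi>(j := v m)) x)
            \<longlonglongrightarrow> g x * tensor (\<psi>(j := w)) x"
          unfolding tensor_upd
          by (intro AE_I2 tendsto_intros lim) (auto simp: cube_def mem_box_cart)
        show "AE x in cube_measure. norm (g x * tensor (\<psi>(j := v m)) x)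
            \<le> cmod (g x * tensor (\<psi>(j := \<lambda>t. C)) x)" for m
          unfolding tensor_upd norm_mult norm_of_real
          using C[of "_ $ j" m]
          by (intro AE_I2 mult_left_mono mult_right_mono order_trans[OF C abs_ge_self])
             (auto simp: cube_def mem_box_cart)
      qed
      then show "V w"
        using V bmw by (simp add: V_def LIMSEQ_const_iff)
    qed
    then have "V (\<psi> j)"
      using insert.prems(1)[of j] by (auto simp: step_def)
    then show ?case by (simp add: V_def)
  qed
  from this[of UNIV "\<lambda>j t. sin (pi * t) * indicator {..b $ j} t"] show ?thesis
    by (auto simp: step_def)
qed

text \<open>The sets \<open>{..b}\<close> are stable under intersection and generate the Borel sets, so by Dynkin's argument the
  integral over every Borel set vanishes. The argument is run with a Borel function that equals \<open>h\<close> almost everywhere,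
  as \<open>h\<close> is only Lebesgue measurable.\<close>

lemma integral_atMost_zero_imp_AE_zero:
  fixes h :: "real ^ 'n::finite \<Rightarrow> real"
  assumes h: "integrable cube_measure h"
    and zero: "\<And>b. (LINT x|cube_measure. h x * indicator {..b} x) = 0"
  shows "AE x in cube_measure. h x = 0"
proof -
  define f where "f x = indicator cube x *\<^sub>R h x" for x
  have f_int: "integrable lebesgue f"
    using h unfolding f_def by (subst (asm) integrable_restrict_space) auto
  then have "f \<in> borel_measurable (completion lborel)"
    by (rule borel_measurable_integrable)
  then obtain f' where [measurable]: "f' \<in> borel_measurable lborel" and f': "AE x in lborel. f x = f' x"
    using completion_ex_borel_measurable_real by blast
  have f'_int: "integrable lborel f'"
  proof -
    have "integrable lebesgue f'"
      by (rule integrable_cong_AE_imp[OF f_int])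
         (use f' in \<open>auto simp: AE_completion intro: measurable_completion\<close>)
    then show ?thesis by (simp add: integrable_completion)
  qed
  have eq: "(LINT x:A|lborel. f' x) = (LINT x|cube_measure. h x * indicator A x)"
    if "A \<in> sets borel" for A
  proof -
    have [measurable]: "A \<in> sets lborel" using that by simp
    have "(LINT x:A|lborel. f' x) = (LINT x|lebesgue. indicator A x *\<^sub>R f' x)"
      unfolding set_lebesgue_integral_def by (rule integral_completion[symmetric]) measurable
    also have "\<dots> = (LINT x|lebesgue. indicator A x *\<^sub>R f x)"
    proof (rule integral_cong_AE)
      have A: "A \<in> sets lebesgue" using that by simp
      show "(\<lambda>x. indicator A x *\<^sub>R f' x) \<in> borel_measurable lebesgue"
        by (rule measurable_completion) measurable
      show "(\<lambda>x. indicator A x *\<^sub>R f x) \<in> borel_measurable lebesgue"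
        using A borel_measurable_integrable[OF f_int] by measurable
      show "AE x in lebesgue. indicator A x *\<^sub>R f' x = indicator A x *\<^sub>R f x"
        using AE_completion[OF f'] by eventually_elim simp
    qed
    also have "\<dots> = (LINT x|lebesgue. indicator cube x *\<^sub>R (h x * indicator A x))"
      by (simp add: f_def mult.left_commute mult.commute)
    also have "\<dots> = (LINT x|cube_measure. h x * indicator A x)"
      by (subst integral_restrict_space) auto
    finally show ?thesis .
  qed
  have sub: "set_integrable lborel A f'" if "A \<in> sets borel" for A
    using f'_int that unfolding set_integrable_def
    by (intro integrable_mult_indicator) auto
  have UNIV: "(LINT x|lborel. f' x) = 0"
  proof -
    have "(LINT x|lborel. f' x) = (LINT x|cube_measure. h x * indicator UNIV x)"
      using eq[of UNIV] by (simp add: set_lebesgue_integral_def)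
    also have "\<dots> = (LINT x|cube_measure. h x * indicator {..1} x)"
      by (intro Bochner_Integration.integral_cong refl)
         (auto simp: indicator_def cube_def mem_box_cart less_eq_vec_def less_imp_le)
    finally show ?thesis using zero by simp
  qed
  let ?E = "range (\<lambda>b :: real ^ 'n. {..b})"
  have borel_E: "sets (borel :: (real ^ 'n) measure) = sigma_sets UNIV ?E"
    by (subst borel_eq_atMost) simp
  have all0: "(LINT x:A|lborel. f' x) = 0" if "A \<in> sets borel" for A
  proof -
    have "Int_stable ?E"
    proof -
      have "{..a} \<inter> {..b} = {..inf a b}" for a b :: "real ^ 'n"
        by auto
      then show ?thesis by (auto simp: Int_stable_def)
    qed
    moreover have "?E \<subseteq> Pow UNIV" by simp
    moreover have "A \<in> sigma_sets UNIV ?E" using that borel_E by simp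
    ultimately show ?thesis
    proof (induction rule: sigma_sets_induct_disjoint)
      case (basic A)
      then obtain b where A: "A = {..b}" by auto
      have "A \<in> sets borel" unfolding borel_E using basic by (auto intro: sigma_sets.Basic)
      then show ?case using eq zero by (simp add: A)
    next
      case empty
      show ?case by (simp add: set_lebesgue_integral_def)
    next
      case (compl A)
      then have A: "A \<in> sets borel" using borel_E by simp
      have "(LINT x:UNIV - A|lborel. f' x) = (LINT x|lborel. f' x) - (LINT x:A|lborel. f' x)"
      proof -
        have "(LINT x:UNIV - A|lborel. f' x) = (LINT x|lborel. f' x - indicator A x *\<^sub>R f' x)"
          unfolding set_lebesgue_integral_def
          by (intro Bochner_Integration.integral_cong) (auto simp: indicator_def)
        then show ?thesis
          using f'_int sub[OF A] by (simp add: set_lebesgue_integral_def set_integrable_def)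
      qed
      then show ?case using compl UNIV by simp
    next
      case (union A)
      then have A: "A i \<in> sets borel" for i using borel_E by auto
      have "(LINT x:(\<Union>i. A i)|lborel. f' x) = (\<Sum>i. (LINT x:(A i)|lborel. f' x))"
        using A union by (intro lebesgue_integral_countable_add sub)
          (auto simp: disjoint_family_on_def)
      then show ?case using union by simp
    qed
  qed
  have "AE x in lborel. f' x = 0"
    using all0 by (intro density_unique_real[OF f'_int]) (auto simp: set_lebesgue_integral_def)
  then have "AE x in lborel. f x = 0" using f' by eventually_elim simp
  then have "AE x in lebesgue. f x = 0" by (rule AE_completion)
  then show ?thesis
    by (auto simp: AE_restrict_space_iff f_def)
qed

text \<open>The product \<open>G\<close> of \<open>g\<close> with the lowest sine mode integrates to zero over every lower orthant, so it vanishes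
  almost everywhere, and the lowest sine mode is positive on the cube.\<close>

lemma sine_system_complete:
  fixes g :: "real ^ 'n::finite \<Rightarrow> complex"
  assumes g: "integrable cube_measure g"
    and orth: "\<And>k :: 'n \<Rightarrow> nat. (\<And>j. 1 \<le> k j) \<Longrightarrow>
      (LINT x|cube_measure. g x * tensor (\<lambda>j t. sin (real (k j) * pi * t)) x) = 0"
  shows "AE x in cube_measure. g x = 0"
proof -
  define s where "s = tensor (\<lambda>j :: 'n. \<lambda>t. sin (pi * t))"
  define G where "G x = g x * s x" for x
  have sc: "continuous_on UNIV s"
    unfolding s_def by (intro tensor_continuous continuous_intros)
  have G: "integrable cube_measure G"
    unfolding G_def s_def
    by (rule integrable_mult_bounded[OF g tensor_measurable cmod_tensor_le[where C = "\<lambda>j. 1"]])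
       (auto intro!: borel_measurable_continuous_onI continuous_intros)
  have G_step: "(LINT x|cube_measure. G x * indicator {..b} x) = 0" for b
  proof -
    have ind: "(\<Prod>j\<in>UNIV. indicator {..b $ j} (x $ j)) = (indicator {..b} x :: real)" for x :: "real ^ 'n"
      by (cases "x \<le> b") (auto simp: indicator_def less_eq_vec_def intro!: prod_zero)
    have "G x * indicator {..b} x = g x * tensor (\<lambda>j t. sin (pi * t) * indicator {..b $ j} t) x" for x
    proof -
      have "tensor (\<lambda>j t. sin (pi * t) * indicator {..b $ j} t) x
          = s x * of_real (indicator {..b} x)"
        by (simp add: tensor_def s_def prod.distrib ind[symmetric])
      then show ?thesis by (simp add: G_def of_real_indicator)
    qed
    then show ?thesis
      using sine_orthogonal_imp_step_orthogonal[OF g orth] by simp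
  qed
  have int: "integrable cube_measure (\<lambda>x. G x * indicator {..b} x)" for b
  proof (rule integrable_mult_bounded[OF G, where B = 1])
    show "(indicator {..b} :: _ \<Rightarrow> complex) \<in> borel_measurable cube_measure"
      by (intro borel_imp_cube_measurable borel_measurable_indicator)
         (simp add: interval_cbox_cart borel_eq_atMost)
  qed (auto simp: indicator_def)
  have "AE x in cube_measure. Re (G x) = 0" "AE x in cube_measure. Im (G x) = 0"
  proof -
    have "(LINT x|cube_measure. Re (G x) * indicator {..b} x) = Re (LINT x|cube_measure. G x * indicator {..b} x)"
      "(LINT x|cube_measure. Im (G x) * indicator {..b} x) = Im (LINT x|cube_measure. G x * indicator {..b} x)" for b
      using int[of b] by (auto simp flip: integral_Re integral_Im
          intro!: Bochner_Integration.integral_cong simp: indicator_def)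
    then show "AE x in cube_measure. Re (G x) = 0" "AE x in cube_measure. Im (G x) = 0"
      using G by (auto intro!: integral_atMost_zero_imp_AE_zero simp: G_step)
  qed
  moreover have "AE x in cube_measure. s x \<noteq> 0"
  proof (rule AE_I2)
    fix x :: "real ^ 'n" assume "x \<in> space cube_measure"
    then have "sin (pi * x $ j) > 0" for j
      by (intro sin_gt_zero) (auto simp: cube_def mem_box_cart)
    then have "sin (pi * x $ j) \<noteq> 0" for j by (metis less_irrefl)
    then show "s x \<noteq> 0" by (simp add: s_def tensor_def)
  qed
  ultimately show ?thesis
  proof eventually_elim
    case (elim x)
    then have "G x = 0" by (simp add: complex_eq_iff)
    then show ?case using elim by (simp add: G_def)
  qed
qed

section \<open>The trigonometric systems\<close>

definition trig :: "bool \<Rightarrow> nat \<Rightarrow> real \<Rightarrow> real" where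
  "trig c k t = sqrt 2 * (if c then cos (real k * pi * t) else sin (real k * pi * t))"

text \<open>In the directions in \<open>S\<close> the sine is replaced by the cosine. Allowing every \<open>S\<close> makes the family closed under
  partial derivatives up to factors, which covers the mixed second derivatives in \<open>H2\<close>.\<close>

definition mode_fun :: "'n::finite set \<Rightarrow> 'n multi_nat \<Rightarrow> real ^ 'n \<Rightarrow> complex" where
  "mode_fun S \<kappa> = tensor (\<lambda>j. trig (j \<in> S) (\<kappa> $ j))"

definition mode :: "'n::finite set \<Rightarrow> 'n multi_nat \<Rightarrow> 'n L2_cube" where
  "mode S \<kappa> = abs_L2_cube (mode_fun S \<kappa>)"

definition toggle :: "'n \<Rightarrow> 'n set \<Rightarrow> 'n set" where
  "toggle i S = (if i \<in> S then S - {i} else insert i S)"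

text \<open>The constant by which the derivative of \<open>mode_fun S \<kappa>\<close> in the direction \<open>i\<close> differs from
  \<open>mode_fun (toggle i S) \<kappa>\<close>.\<close>

definition dfactor :: "'n::finite \<Rightarrow> 'n set \<Rightarrow> 'n multi_nat \<Rightarrow> real" where
  "dfactor i S \<kappa> = (if i \<in> S then - 1 else 1) * (real (\<kappa> $ i) * pi)"

lemma sine_fun_eq_mode_fun: "sine_fun \<kappa> = mode_fun {} \<kappa>"
proof
  fix x :: "real ^ 'a"
  have "(2 :: real) powr (real CARD('a) / 2) = (\<Prod>j\<in>(UNIV :: 'a set). sqrt 2)"
    by (simp add: powr_half_sqrt[symmetric] powr_powr powr_realpow[symmetric])
  then show "sine_fun \<kappa> x = mode_fun {} \<kappa> x"
    by (simp add: sine_fun_def mode_fun_def tensor_def trig_def prod.distrib)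
qed

lemma trig_deriv:
  "(trig c k has_real_derivative (if c then - 1 else 1) * (real k * pi) * trig (\<not> c) k t) (at t)"
  unfolding trig_def[abs_def] by (cases c) (auto intro!: derivative_eq_intros)

lemma trig_continuous: "continuous_on A (trig c k)"
  unfolding trig_def[abs_def] by (cases c) (auto intro!: continuous_intros)

lemma cos_integer_integral:
  "((\<lambda>t. cos (of_int l * pi * t)) has_integral (if l = 0 then 1 else 0)) {0..1}"
proof (cases "l = 0")
  case True
  then show ?thesis using has_integral_const_real[of "1 :: real" 0 1] by simp
next
  case False
  have "((\<lambda>t. cos (of_int l * pi * t)) has_integral
      sin (of_int l * pi * 1) / (of_int l * pi) - sin (of_int l * pi * 0) / (of_int l * pi)) {0..1}"
    using False
    by (intro fundamental_theorem_of_calculus)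
       (auto intro!: derivative_eq_intros simp flip: has_real_derivative_iff_has_vector_derivative)
  moreover have "sin (of_int l * pi) = 0"
    by (simp add: sin_zero_iff_int2)
  ultimately show ?thesis using False by simp
qed

lemma trig_orthonormal:
  assumes "1 \<le> k" "1 \<le> m"
  shows "((\<lambda>t. trig c k t * trig c m t) has_integral (if k = m then 1 else 0)) {0..1}"
proof -
  let ?s = "if c then 1 else - 1 :: real"
  have "trig c k t * trig c m t
      = cos (of_int (int k - int m) * pi * t) + ?s * cos (of_int (int k + int m) * pi * t)" for t
  proof -
    have e: "of_int (int k - int m) * pi * t = real k * pi * t - real m * pi * t"
      "of_int (int k + int m) * pi * t = real k * pi * t + real m * pi * t"
      by (simp_all add: algebra_simps)
    have "sqrt 2 * x * (sqrt 2 * y) = 2 * (x * y)" for x y :: real by simp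
    then show ?thesis
      unfolding trig_def e cos_diff cos_add by (cases c) simp_all
  qed
  moreover have "((\<lambda>t. cos (of_int (int k - int m) * pi * t)
      + ?s * cos (of_int (int k + int m) * pi * t)) has_integral
      (if int k - int m = 0 then 1 else 0) + ?s * (if int k + int m = 0 then 1 else 0)) {0..1}"
    by (intro has_integral_add has_integral_mult_right cos_integer_integral)
  ultimately show ?thesis using assms by simp
qed

lemma mode_fun_square_integrable: "square_integrable (mode_fun S \<kappa>)"
  unfolding mode_fun_def
  by (intro square_integrable_continuous tensor_continuous trig_continuous)

lemma mode_fun_cnj [simp]: "cnj (mode_fun S \<kappa> x) = mode_fun S \<kappa> x"
  by (simp add: mode_fun_def tensor_def del: of_real_prod)

text \<open>By Fubini's theorem the inner product is a product of one-dimensional integrals, one of which vanishes as soon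
  as the multi-indices differ in a coordinate.\<close>

lemma mode_orthonormal: "orthonormal (mode S) multi_indices"
  unfolding orthonormal_def
proof (intro ballI)
  fix \<kappa> \<mu> :: "'a multi_nat" assume *: "\<kappa> \<in> multi_indices" "\<mu> \<in> multi_indices"
  have "mode_fun S \<kappa> x * mode_fun S \<mu> x
      = tensor (\<lambda>j t. trig (j \<in> S) (\<kappa> $ j) t * trig (j \<in> S) (\<mu> $ j) t) x" for x
    by (simp add: mode_fun_def tensor_def prod.distrib)
  then have "L2_inner (mode S \<kappa>) (mode S \<mu>)
      = (LINT x|cube_measure. tensor (\<lambda>j t. trig (j \<in> S) (\<kappa> $ j) t * trig (j \<in> S) (\<mu> $ j) t) x)"
    by (simp add: mode_def abs_L2_cube_simps mode_fun_square_integrable)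
  also have "\<dots> = of_real (\<Prod>j\<in>UNIV. if \<kappa> $ j = \<mu> $ j then 1 else 0)"
    using * by (intro cube_integral_tensor continuous_intros trig_continuous trig_orthonormal)
      (auto simp: multi_indices_def)
  also have "(\<Prod>j\<in>UNIV. if \<kappa> $ j = \<mu> $ j then 1 else 0 :: real) = (if \<kappa> = \<mu> then 1 else 0)"
  proof (cases "\<kappa> = \<mu>")
    case False
    then obtain j where "\<kappa> $ j \<noteq> \<mu> $ j" by (auto simp: vec_eq_iff)
    then show ?thesis using False by (auto intro!: prod_zero)
  qed auto
  finally show "L2_inner (mode S \<kappa>) (mode S \<mu>) = (if \<kappa> = \<mu> then 1 else 0)"
    by simp
qed

lemma mode_fun_pderiv:
  "mode_fun S \<kappa> differentiable (at x)"
  "pderiv_cl i (mode_fun S \<kappa>) = (\<lambda>x. of_real (dfactor i S \<kappa>) * mode_fun (toggle i S) \<kappa> x)"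
proof -
  let ?\<psi> = "\<lambda>j. trig (j \<in> S) (\<kappa> $ j)"
  let ?\<psi>' = "\<lambda>j t. (if j \<in> S then - 1 else 1) * (real (\<kappa> $ j) * pi) * trig (j \<notin> S) (\<kappa> $ j) t"
  have d: "(?\<psi> j has_real_derivative ?\<psi>' j t) (at t)" for j t
    by (rule trig_deriv)
  note td = tensor_pderiv[of ?\<psi> ?\<psi>', OF d]
  show "mode_fun S \<kappa> differentiable (at x)" unfolding mode_fun_def by (rule td(1))
  have "mode_fun (toggle i S) \<kappa> x = tensor (?\<psi>(i := trig (i \<notin> S) (\<kappa> $ i))) x" for x
    unfolding mode_fun_def
    by (intro arg_cong2[where f = tensor] refl) (auto simp: toggle_def fun_eq_iff)
  then show "pderiv_cl i (mode_fun S \<kappa>) = (\<lambda>x. of_real (dfactor i S \<kappa>) * mode_fun (toggle i S) \<kappa> x)"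
    unfolding mode_fun_def[of S] td(2) by (auto simp: tensor_upd dfactor_def fun_eq_iff)
qed

lemma mode_weak_pderiv:
  "weak_pderiv i (mode S \<kappa>) (cscale (of_real (dfactor i S \<kappa>)) (mode (toggle i S) \<kappa>))"
proof -
  have "continuous_on UNIV (pderiv_cl i (mode_fun S \<kappa>))"
    unfolding mode_fun_pderiv unfolding mode_fun_def
    by (intro continuous_intros tensor_continuous trig_continuous)
  from classical_imp_weak_pderiv[OF mode_fun_pderiv(1) this]
  show ?thesis
    unfolding mode_def mode_fun_pderiv
    by (simp only: abs_L2_cube_cscale mode_fun_square_integrable)
qed

lemma mode_complete:
  assumes "\<And>\<kappa>. \<kappa> \<in> multi_indices \<Longrightarrow> L2_inner u (mode {} \<kappa>) = 0"
  shows "u = 0"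
proof -
  obtain f where f: "square_integrable f" "u = abs_L2_cube f" by (rule L2_cube_cases)
  have "AE x in cube_measure. f x = 0"
  proof (rule sine_system_complete[OF square_integrable_integrable[OF f(1)]])
    fix k :: "'a \<Rightarrow> nat" assume k: "\<And>j. 1 \<le> k j"
    define \<kappa> where "\<kappa> = (\<chi> j. k j)"
    define c where "c = complex_of_real (\<Prod>j\<in>(UNIV :: 'a set). sqrt 2)"
    have c: "c \<noteq> 0" by (simp add: c_def)
    have "mode_fun {} \<kappa> x = c * tensor (\<lambda>j t. sin (real (k j) * pi * t)) x" for x
      by (simp add: mode_fun_def tensor_def trig_def \<kappa>_def c_def prod.distrib)
    then have "L2_inner u (mode {} \<kappa>)
        = (LINT x|cube_measure. f x * (c * tensor (\<lambda>j t. sin (real (k j) * pi * t)) x))"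
      unfolding f(2) mode_def abs_L2_cube_simps(3)[OF f(1) mode_fun_square_integrable] mode_fun_cnj by simp
    also have "\<dots> = c * (LINT x|cube_measure. f x * tensor (\<lambda>j t. sin (real (k j) * pi * t)) x)"
      by (simp add: mult.left_commute)
    finally show "(LINT x|cube_measure. f x * tensor (\<lambda>j t. sin (real (k j) * pi * t)) x) = 0"
      using c assms[of \<kappa>] k by (simp add: multi_indices_def \<kappa>_def)
  qed
  then show ?thesis
    using abs_L2_cube_eq_iff[OF f(1) square_integrable_zero] by (simp add: f(2) zero_L2_cube_def)
qed

lemma mode_expansion: "((\<lambda>\<kappa>. cscale (L2_inner u (mode {} \<kappa>)) (mode {} \<kappa>)) has_sum u) multi_indices"
  by (rule orthonormal_basis_expansion[OF mode_orthonormal mode_complete])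

section \<open>Test functions\<close>

lemma square_integrable_test_fun:
  assumes "test_fun \<phi>"
  shows "square_integrable \<phi>" "square_integrable (pderiv_cl i \<phi>)"
    "square_integrable (\<lambda>x. cnj (\<phi> x))" "square_integrable (\<lambda>x. cnj (pderiv_cl i \<phi> x))"
  using test_funD[OF assms]
  by (auto intro: square_integrable_cnj square_integrable_continuous)

text \<open>Dominated convergence on a set of finite measure, with the product of the bounds as majorant.\<close>

lemma tensor_tendsto_L2:
  fixes \<psi> :: "nat \<Rightarrow> 'n::finite \<Rightarrow> real \<Rightarrow> real"
  assumes cont: "\<And>m j. continuous_on UNIV (\<psi> m j)" "\<And>j. continuous_on UNIV (\<psi>' j)"
    and bound: "\<And>m j t. 0 < t \<Longrightarrow> t < 1 \<Longrightarrow> \<bar>\<psi> m j t\<bar> \<le> C j"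
    and lim: "\<And>j t. 0 < t \<Longrightarrow> t < 1 \<Longrightarrow> (\<lambda>m. \<psi> m j t) \<longlonglongrightarrow> \<psi>' j t"
  shows "(\<lambda>m. abs_L2_cube (tensor (\<psi> m))) \<longlonglongrightarrow> abs_L2_cube (tensor \<psi>')"
proof -
  interpret finite_measure "cube_measure :: (real ^ 'n) measure" by (rule finite_measure_cube)
  have si: "square_integrable (tensor (\<psi> m))" "square_integrable (tensor \<psi>')" for m
    by (intro square_integrable_continuous tensor_continuous cont)+
  have diff: "square_integrable (\<lambda>x. tensor (\<psi> m) x - tensor \<psi>' x)" for m
    by (intro square_integrable_diff si)
  define B where "B = (\<Prod>j\<in>UNIV. C j)"
  have lim': "(\<lambda>m. tensor (\<psi> m) x) \<longlonglongrightarrow> tensor \<psi>' x" if "x \<in> cube" for x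
    unfolding tensor_def using that
    by (intro tendsto_of_real tendsto_prod lim) (auto simp: cube_def mem_box_cart)
  have le: "cmod (tensor (\<psi> m) x) \<le> B" if "x \<in> cube" for m x
    unfolding B_def by (rule cmod_tensor_le[OF bound that])
  have le': "cmod (tensor \<psi>' x) \<le> B" if "x \<in> cube" for x
    using LIMSEQ_le_const2[OF tendsto_norm[OF lim'[OF that]]] le[OF that] by blast
  have "(\<lambda>m. LINT x|cube_measure. (cmod (tensor (\<psi> m) x - tensor \<psi>' x))\<^sup>2)
      \<longlonglongrightarrow> (LINT x|(cube_measure :: (real ^ 'n) measure). (0 :: real))"
  proof (rule integral_dominated_convergence)
    show "integrable cube_measure (\<lambda>x :: real ^ 'n. (B + B)\<^sup>2)" by simp
    show "(\<lambda>x. (cmod (tensor (\<psi> m) x - tensor \<psi>' x))\<^sup>2) \<in> borel_measurable cube_measure" for m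
      using diff[of m] by (auto simp: square_integrable_def)
    show "AE x in cube_measure. (\<lambda>m. (cmod (tensor (\<psi> m) x - tensor \<psi>' x))\<^sup>2) \<longlonglongrightarrow> 0"
    proof (rule AE_I2)
      fix x :: "real ^ 'n" assume "x \<in> space cube_measure"
      then have "(\<lambda>m. (cmod (tensor (\<psi> m) x - tensor \<psi>' x))\<^sup>2)
          \<longlonglongrightarrow> (cmod (tensor \<psi>' x - tensor \<psi>' x))\<^sup>2"
        by (intro tendsto_intros lim') simp
      then show "(\<lambda>m. (cmod (tensor (\<psi> m) x - tensor \<psi>' x))\<^sup>2) \<longlonglongrightarrow> 0" by simp
    qed
    show "AE x in cube_measure. norm ((cmod (tensor (\<psi> m) x - tensor \<psi>' x))\<^sup>2) \<le> (B + B)\<^sup>2" for m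
    proof (rule AE_I2)
      fix x :: "real ^ 'n" assume "x \<in> space cube_measure"
      then have x: "x \<in> cube" by simp
      have "cmod (tensor (\<psi> m) x - tensor \<psi>' x) \<le> B + B"
        using norm_triangle_ineq4[of "tensor (\<psi> m) x" "tensor \<psi>' x"] le[OF x, of m] le'[OF x]
        by linarith
      then have "(cmod (tensor (\<psi> m) x - tensor \<psi>' x))\<^sup>2 \<le> (B + B)\<^sup>2"
        by (rule power_mono) simp
      then show "norm ((cmod (tensor (\<psi> m) x - tensor \<psi>' x))\<^sup>2) \<le> (B + B)\<^sup>2"
        by simp
    qed
  qed simp
  then have "(\<lambda>m. (norm (abs_L2_cube (tensor (\<psi> m)) - abs_L2_cube (tensor \<psi>')))\<^sup>2) \<longlonglongrightarrow> 0"
    by (simp add: abs_L2_cube_diff si norm_abs_L2_cube[OF diff])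
  from tendsto_real_sqrt[OF this]
  have "(\<lambda>m. norm (abs_L2_cube (tensor (\<psi> m)) - abs_L2_cube (tensor \<psi>'))) \<longlonglongrightarrow> 0"
    by simp
  then show ?thesis by (rule LIM_zero_cancel[OF tendsto_norm_zero_cancel])
qed

text \<open>Tensor products of the one-dimensional cutoffs of the sines. They are real-valued, so complex
  conjugation does not disturb them when they serve as second argument of the inner product.\<close>

lemma mode_test_approximation:
  fixes \<kappa> :: "'n::finite multi_nat"
  obtains \<Phi> where "\<And>m. test_fun (\<Phi> m)" "\<And>m x. cnj (\<Phi> m x) = \<Phi> m x"
    "\<And>m i x. cnj (pderiv_cl i (\<Phi> m) x) = pderiv_cl i (\<Phi> m) x"
    "(\<lambda>m. abs_L2_cube (\<Phi> m)) \<longlonglongrightarrow> mode {} \<kappa>"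
    "\<And>i. (\<lambda>m. abs_L2_cube (pderiv_cl i (\<Phi> m)))
        \<longlonglongrightarrow> cscale (of_real (dfactor i {} \<kappa>)) (mode {i} \<kappa>)"
proof -
  define P where "P k f C \<longleftrightarrow> (\<forall>m. smooth (f m)) \<and>
    (\<forall>m. \<exists>a>0. \<exists>b<1. \<forall>t. f m t \<noteq> 0 \<longrightarrow> a \<le> t \<and> t \<le> b) \<and>
    (\<forall>m t. 0 < t \<longrightarrow> t < 1 \<longrightarrow> \<bar>f m t\<bar> \<le> C) \<and>
    (\<forall>m t. 0 < t \<longrightarrow> t < 1 \<longrightarrow> \<bar>deriv (f m) t\<bar> \<le> C) \<and>
    (\<forall>t. 0 < t \<longrightarrow> t < 1 \<longrightarrow> (\<lambda>m. f m t) \<longlonglongrightarrow> sin (real k * pi * t)) \<and>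
    (\<forall>t. 0 < t \<longrightarrow> t < 1 \<longrightarrow> (\<lambda>m. deriv (f m) t) \<longlonglongrightarrow> real k * pi * cos (real k * pi * t))"
    for k :: nat and f :: "nat \<Rightarrow> real \<Rightarrow> real" and C
  have "\<exists>f C. P k f C" for k
    unfolding P_def by (rule sine_cutoff_exists[of k]) blast
  then obtain f C where P: "\<And>k. P k (f k) (C k)" by metis
  have f: "\<And>k m. smooth (f k m)"
    "\<And>k m. \<exists>a>0. \<exists>b<1. \<forall>t. f k m t \<noteq> 0 \<longrightarrow> a \<le> t \<and> t \<le> b"
    "\<And>k m t. 0 < t \<Longrightarrow> t < 1 \<Longrightarrow> \<bar>f k m t\<bar> \<le> C k"
    "\<And>k m t. 0 < t \<Longrightarrow> t < 1 \<Longrightarrow> \<bar>deriv (f k m) t\<bar> \<le> C k"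
    "\<And>k t. 0 < t \<Longrightarrow> t < 1 \<Longrightarrow> (\<lambda>m. f k m t) \<longlonglongrightarrow> sin (real k * pi * t)"
    "\<And>k t. 0 < t \<Longrightarrow> t < 1 \<Longrightarrow> (\<lambda>m. deriv (f k m) t) \<longlonglongrightarrow> real k * pi * cos (real k * pi * t)"
    using P unfolding P_def by blast+
  define \<psi> where "\<psi> m j t = sqrt 2 * f (\<kappa> $ j) m t" for m j t
  define \<psi>' where "\<psi>' m j t = sqrt 2 * deriv (f (\<kappa> $ j) m) t" for m j t
  have \<psi>_smooth: "smooth (\<psi> m j)" for m j
    unfolding \<psi>_def[abs_def] by (intro smooth_mult smooth_const f)
  have \<psi>_deriv: "(\<psi> m j has_real_derivative \<psi>' m j t) (at t)" for m j t
    unfolding \<psi>_def \<psi>'_def by (intro DERIV_cmult smooth_deriv f)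
  have \<psi>'_cont: "continuous_on UNIV (\<psi>' m j)" for m j
    unfolding \<psi>'_def[abs_def] by (intro continuous_intros smooth_continuous smooth_deriv f)
  have pd: "pderiv_cl i (tensor (\<psi> m)) = tensor ((\<psi> m)(i := \<psi>' m i))" for i m
    by (rule tensor_pderiv(2)[of "\<psi> m" "\<psi>' m", OF \<psi>_deriv])
  show ?thesis
  proof (rule that[of "\<lambda>m. tensor (\<psi> m)"])
    show "test_fun (tensor (\<psi> m))" for m
      using f(2) by (intro test_fun_tensor \<psi>_smooth) (simp add: \<psi>_def)
    show "cnj (tensor (\<psi> m) x) = tensor (\<psi> m) x" for m x
      by (simp add: tensor_def del: of_real_prod)
    show "cnj (pderiv_cl i (tensor (\<psi> m)) x) = pderiv_cl i (tensor (\<psi> m)) x" for m i x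
      unfolding pd by (simp add: tensor_def del: of_real_prod)
    show "(\<lambda>m. abs_L2_cube (tensor (\<psi> m))) \<longlonglongrightarrow> mode {} \<kappa>"
      unfolding mode_def mode_fun_def
    proof (rule tensor_tendsto_L2)
      show "\<bar>\<psi> m j t\<bar> \<le> sqrt 2 * C (\<kappa> $ j)" if "0 < t" "t < 1" for m j t
        using f(3)[OF that] by (simp add: \<psi>_def abs_mult)
      show "(\<lambda>m. \<psi> m j t) \<longlonglongrightarrow> trig (j \<in> {}) (\<kappa> $ j) t" if "0 < t" "t < 1" for j t
        using f(5)[OF that] unfolding \<psi>_def trig_def by (auto intro!: tendsto_intros)
    qed (intro smooth_continuous \<psi>_smooth trig_continuous)+
    show "(\<lambda>m. abs_L2_cube (pderiv_cl i (tensor (\<psi> m))))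
        \<longlonglongrightarrow> cscale (of_real (dfactor i {} \<kappa>)) (mode {i} \<kappa>)" for i
    proof -
      let ?\<chi> = "(\<lambda>j. trig False (\<kappa> $ j))(i := \<lambda>t. dfactor i {} \<kappa> * trig True (\<kappa> $ i) t)"
      have "(\<lambda>m. abs_L2_cube (tensor ((\<psi> m)(i := \<psi>' m i)))) \<longlonglongrightarrow> abs_L2_cube (tensor ?\<chi>)"
      proof (rule tensor_tendsto_L2)
        show "continuous_on UNIV (((\<psi> m)(i := \<psi>' m i)) j)" for m j
          using \<psi>'_cont smooth_continuous[OF \<psi>_smooth] by auto
        show "continuous_on UNIV (?\<chi> j)" for j
          by (auto intro!: continuous_intros trig_continuous)
        show "\<bar>((\<psi> m)(i := \<psi>' m i)) j t\<bar> \<le> sqrt 2 * C (\<kappa> $ j)" if "0 < t" "t < 1" for m j t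
          using f(3)[OF that] f(4)[OF that] by (auto simp: \<psi>_def \<psi>'_def abs_mult)
        show "(\<lambda>m. ((\<psi> m)(i := \<psi>' m i)) j t) \<longlonglongrightarrow> ?\<chi> j t" if "0 < t" "t < 1" for j t
          using tendsto_mult[OF tendsto_const[of "sqrt 2"] f(5)[OF that, of "\<kappa> $ j"]]
            tendsto_mult[OF tendsto_const[of "sqrt 2"] f(6)[OF that, of "\<kappa> $ j"]]
          by (auto simp: \<psi>_def \<psi>'_def trig_def dfactor_def mult_ac)
      qed
      moreover have "tensor ?\<chi> = (\<lambda>x. of_real (dfactor i {} \<kappa>) * mode_fun {i} \<kappa> x)"
      proof -
        have "mode_fun {i} \<kappa> x = tensor ((\<lambda>j. trig False (\<kappa> $ j))(i := trig True (\<kappa> $ i))) x" for x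
          unfolding mode_fun_def by (intro arg_cong2[where f = tensor] refl) auto
        then show ?thesis by (auto simp: tensor_upd fun_eq_iff)
      qed
      ultimately show ?thesis
        unfolding pd mode_def
        by (simp only: abs_L2_cube_cscale mode_fun_square_integrable)
    qed
  qed
qed

text \<open>A vector orthogonal to all test functions is orthogonal to their limits, in particular to all sine modes,
  and these are complete. This is the fundamental lemma of the calculus of variations on the cube.\<close>

lemma test_functions_separate:
  assumes "\<And>\<phi>. test_fun \<phi> \<Longrightarrow> L2_inner w (abs_L2_cube (\<lambda>x. cnj (\<phi> x))) = 0"
  shows "w = 0"
proof (rule mode_complete)
  fix \<kappa> :: "'a multi_nat"
  obtain \<Phi> where \<Phi>: "\<And>m. test_fun (\<Phi> m)" "\<And>m x. cnj (\<Phi> m x) = \<Phi> m x"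
    "(\<lambda>m. abs_L2_cube (\<Phi> m)) \<longlonglongrightarrow> mode {} \<kappa>"
    by (rule mode_test_approximation[of \<kappa>]) blast
  have "(\<lambda>m. L2_inner w (abs_L2_cube (\<Phi> m))) \<longlonglongrightarrow> L2_inner w (mode {} \<kappa>)"
    by (rule bounded_linear.tendsto[OF bounded_linear_L2_inner_right \<Phi>(3)])
  moreover have "L2_inner w (abs_L2_cube (\<Phi> m)) = 0" for m
    using assms[OF \<Phi>(1)[of m]] by (simp add: \<Phi>(2))
  ultimately show "L2_inner w (mode {} \<kappa>) = 0" by (simp add: LIMSEQ_const_iff)
qed

lemma Ck_lincomb: "Ck m f \<Longrightarrow> Ck m g \<Longrightarrow> Ck m (\<lambda>x. a * f x + b * g x)"
  and pderiv_cl_lincomb: "(\<And>x. f differentiable (at x)) \<Longrightarrow> (\<And>x. g differentiable (at x)) \<Longrightarrow>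
    pderiv_cl i (\<lambda>x. a * f x + b * g x) = (\<lambda>x. a * pderiv_cl i f x + b * pderiv_cl i g x)"
proof -
  show *: "pderiv_cl i (\<lambda>x. a * f x + b * g x) = (\<lambda>x. a * pderiv_cl i f x + b * pderiv_cl i g x)"
    if "\<And>x. f differentiable (at x)" "\<And>x. g differentiable (at x)" for f g i
  proof
    fix x
    have "((\<lambda>x. a * f x + b * g x) has_derivative (\<lambda>h. a * frechet_derivative f (at x) h
        + b * frechet_derivative g (at x) h)) (at x)"
      using that[unfolded frechet_derivative_works]
      by (intro has_derivative_add has_derivative_mult_right) auto
    from frechet_derivative_at[OF this]
    show "pderiv_cl i (\<lambda>x. a * f x + b * g x) x = a * pderiv_cl i f x + b * pderiv_cl i g x"
      unfolding pderiv_cl_def by metis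
  qed
  show "Ck m f \<Longrightarrow> Ck m g \<Longrightarrow> Ck m (\<lambda>x. a * f x + b * g x)"
  proof (induction m arbitrary: f g)
    case 0
    then show ?case by (auto intro!: continuous_intros)
  next
    case (Suc m)
    then show ?case by (auto simp: *)
  qed
qed

lemma test_fun_lincomb:
  assumes f: "test_fun f" and g: "test_fun g"
  shows "test_fun (\<lambda>x. a * f x + b * g x)"
proof -
  let ?S = "closure {x. f x \<noteq> 0} \<union> closure {x. g x \<noteq> 0}"
  have "{x. a * f x + b * g x \<noteq> 0} \<subseteq> {x. f x \<noteq> 0} \<union> {x. g x \<noteq> 0}"
    by auto
  then have "{x. a * f x + b * g x \<noteq> 0} \<subseteq> ?S"
    using test_funD(6)[OF f] test_funD(6)[OF g] by blast
  then have sub: "closure {x. a * f x + b * g x \<noteq> 0} \<subseteq> ?S"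
    by (rule closure_minimal) auto
  moreover have "compact ?S" using test_funD[OF f] test_funD[OF g] by auto
  ultimately have "compact (closure {x. a * f x + b * g x \<noteq> 0})"
    by (meson bounded_subset closed_closure compact_eq_bounded_closed)
  then show ?thesis
    using sub f g by (auto simp: test_fun_def intro: Ck_lincomb)
qed

section \<open>Weak derivatives and Sobolev spaces\<close>

text \<open>Written with inner products against fixed vectors, the relation is visibly linear and closed.\<close>

lemma weak_pderiv_iff:
  "weak_pderiv i u v \<longleftrightarrow> (\<forall>\<phi>. test_fun \<phi> \<longrightarrow>
    L2_inner u (abs_L2_cube (\<lambda>x. cnj (pderiv_cl i \<phi> x))) = - L2_inner v (abs_L2_cube (\<lambda>x. cnj (\<phi> x))))"
proof -
  obtain f g where "square_integrable f" "u = abs_L2_cube f" "square_integrable g"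
    "v = abs_L2_cube g" by (metis L2_cube_cases)
  then show ?thesis
    by (auto simp: abs_L2_cube_simps square_integrable_test_fun)
qed

lemma weak_pderiv_unique:
  assumes "weak_pderiv i u v" "weak_pderiv i u w"
  shows "v = w"
proof -
  have "v - w = 0"
    using assms by (intro test_functions_separate) (auto simp: weak_pderiv_iff L2_inner_simps)
  then show ?thesis by simp
qed

lemma weak_pderiv_lincomb:
  assumes "weak_pderiv i u v" "weak_pderiv i u' v'"
  shows "weak_pderiv i (cscale a u + cscale b u') (cscale a v + cscale b v')"
  using assms by (auto simp: weak_pderiv_iff L2_inner_simps)

lemma weak_pderiv_limit:
  fixes u v :: "'n::finite L2_cube"
  assumes "F \<noteq> bot" "\<forall>\<^sub>F x in F. weak_pderiv i (U x) (V x)" "(U \<longlongrightarrow> u) F" "(V \<longlongrightarrow> v) F"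
  shows "weak_pderiv i u v"
  unfolding weak_pderiv_iff
proof (intro allI impI)
  fix \<phi> :: "real ^ 'n \<Rightarrow> complex" assume \<phi>: "test_fun \<phi>"
  let ?d = "abs_L2_cube (\<lambda>x. cnj (pderiv_cl i \<phi> x))" and ?c = "abs_L2_cube (\<lambda>x. cnj (\<phi> x))"
  have "((\<lambda>x. L2_inner (U x) ?d) \<longlongrightarrow> L2_inner u ?d) F"
    by (rule bounded_linear.tendsto[OF bounded_linear_L2_inner_left assms(3)])
  moreover have "((\<lambda>x. - L2_inner (V x) ?c) \<longlongrightarrow> - L2_inner v ?c) F"
    by (intro tendsto_minus bounded_linear.tendsto[OF bounded_linear_L2_inner_left assms(4)])
  then have "((\<lambda>x. L2_inner (U x) ?d) \<longlongrightarrow> - L2_inner v ?c) F"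
  proof (rule Lim_transform_eventually)
    show "\<forall>\<^sub>F x in F. - L2_inner (V x) ?c = L2_inner (U x) ?d"
      using assms(2) by eventually_elim (use \<phi> in \<open>simp add: weak_pderiv_iff\<close>)
  qed
  ultimately show "L2_inner u ?d = - L2_inner v ?c"
    by (rule tendsto_unique[OF assms(1)])
qed

lemma pd_eq: "weak_pderiv i u v \<Longrightarrow> pd i u = v"
  unfolding pd_def using weak_pderiv_unique by blast

lemma weak_pderiv_pd: "u \<in> H1 \<Longrightarrow> weak_pderiv i u (pd i u)"
  using pd_eq by (fastforce simp: H1_def)

lemma pd_lincomb:
  assumes "u \<in> H1" "v \<in> H1"
  shows "cscale a u + cscale b v \<in> H1" "pd i (cscale a u + cscale b v) = cscale a (pd i u) + cscale b (pd i v)"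
  using weak_pderiv_lincomb[OF weak_pderiv_pd[OF assms(1)] weak_pderiv_pd[OF assms(2)]]
  by (auto simp: H1_def intro: pd_eq)

lemma test_fun_weak_pderiv:
  "test_fun \<phi> \<Longrightarrow> weak_pderiv i (abs_L2_cube \<phi>) (abs_L2_cube (pderiv_cl i \<phi>))"
  by (intro classical_imp_weak_pderiv test_funD)

text \<open>The Sobolev norm is equivalent to the maximum of the norms of the function and of its partial
  derivatives.\<close>

lemma H10_iff:
  "u \<in> H10 \<longleftrightarrow> u \<in> H1 \<and> (\<forall>e>0. \<exists>\<phi>. test_fun \<phi> \<and> norm (u - abs_L2_cube \<phi>) < e \<and>
    (\<forall>i. norm (pd i u - abs_L2_cube (pderiv_cl i \<phi>)) < e))" (is "_ \<longleftrightarrow> _ \<and> ?A")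
proof (cases "u \<in> H1")
  case u: True
  have pd: "pd i (u - abs_L2_cube \<phi>) = pd i u - abs_L2_cube (pderiv_cl i \<phi>)" if "test_fun \<phi>" for i \<phi>
    using weak_pderiv_lincomb[OF weak_pderiv_pd[OF u] test_fun_weak_pderiv[OF that], of i 1 "- 1"]
    by (intro pd_eq) simp
  let ?n = "\<lambda>\<phi>. norm (u - abs_L2_cube \<phi>)"
  let ?d = "\<lambda>\<phi> i. norm (pd i u - abs_L2_cube (pderiv_cl i \<phi>))"
  have H1n: "H1_norm (u - abs_L2_cube \<phi>) = sqrt ((?n \<phi>)\<^sup>2 + (\<Sum>i\<in>UNIV. (?d \<phi> i)\<^sup>2))" if "test_fun \<phi>" for \<phi>
    using pd[OF that] by (simp add: H1_norm_def norm_L2_cube_def)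
  have le: "?n \<phi> \<le> H1_norm (u - abs_L2_cube \<phi>)" "?d \<phi> i \<le> H1_norm (u - abs_L2_cube \<phi>)"
    if "test_fun \<phi>" for \<phi> i
  proof -
    have "(?d \<phi> i)\<^sup>2 \<le> (\<Sum>i\<in>UNIV. (?d \<phi> i)\<^sup>2)" by (rule member_le_sum) auto
    then show "?d \<phi> i \<le> H1_norm (u - abs_L2_cube \<phi>)"
      unfolding H1n[OF that] by (auto intro!: real_le_rsqrt add_increasing)
    show "?n \<phi> \<le> H1_norm (u - abs_L2_cube \<phi>)"
      unfolding H1n[OF that] by (intro real_le_rsqrt) (simp add: sum_nonneg)
  qed
  have ge: "H1_norm (u - abs_L2_cube \<phi>) \<le> ?n \<phi> + (\<Sum>i\<in>UNIV. ?d \<phi> i)" if "test_fun \<phi>" for \<phi>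
  proof -
    have "H1_norm (u - abs_L2_cube \<phi>) \<le> sqrt ((?n \<phi>)\<^sup>2) + sqrt (\<Sum>i\<in>UNIV. (?d \<phi> i)\<^sup>2)"
      unfolding H1n[OF that] by (intro sqrt_add_le_add_sqrt sum_nonneg) auto
    also have "sqrt (\<Sum>i\<in>UNIV. (?d \<phi> i)\<^sup>2) \<le> (\<Sum>i\<in>UNIV. ?d \<phi> i)"
      using L2_set_le_sum[of UNIV "?d \<phi>"] by (simp add: L2_set_def)
    finally show ?thesis by simp
  qed
  have "u \<in> H10 \<longleftrightarrow> (\<forall>e>0. \<exists>\<phi>. test_fun \<phi> \<and> H1_norm (u - abs_L2_cube \<phi>) < e)"
    using u by (simp add: H10_def)
  also have "\<dots> \<longleftrightarrow> ?A"
  proof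
    assume *: "\<forall>e>0. \<exists>\<phi>. test_fun \<phi> \<and> H1_norm (u - abs_L2_cube \<phi>) < e"
    show ?A
    proof (intro allI impI)
      fix e :: real assume "e > 0"
      then obtain \<phi> where \<phi>: "test_fun \<phi>" "H1_norm (u - abs_L2_cube \<phi>) < e" using * by blast
      then show "\<exists>\<phi>. test_fun \<phi> \<and> ?n \<phi> < e \<and> (\<forall>i. ?d \<phi> i < e)"
        using le[OF \<phi>(1)] le_less_trans by blast
    qed
  next
    assume *: ?A
    show "\<forall>e>0. \<exists>\<phi>. test_fun \<phi> \<and> H1_norm (u - abs_L2_cube \<phi>) < e"
    proof (intro allI impI)
      fix e :: real assume e: "e > 0"
      define d where "d = e / (1 + real CARD('a))"
      have d: "d > 0" using e by (simp add: d_def divide_pos_pos)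
      then obtain \<phi> where \<phi>: "test_fun \<phi>" "?n \<phi> < d" "\<And>i. ?d \<phi> i < d" using * by blast
      have "(\<Sum>i\<in>UNIV. ?d \<phi> i) \<le> (\<Sum>i\<in>(UNIV :: 'a set). d)"
        using \<phi>(3) by (intro sum_mono) (simp add: less_imp_le)
      then have "H1_norm (u - abs_L2_cube \<phi>) < d + real CARD('a) * d"
        using ge[OF \<phi>(1)] \<phi>(2) by simp
      also have "\<dots> = d * (1 + real CARD('a))" by (simp add: algebra_simps)
      also have "\<dots> = e" by (simp add: d_def)
      finally show "\<exists>\<phi>. test_fun \<phi> \<and> H1_norm (u - abs_L2_cube \<phi>) < e" using \<phi>(1) by blast
    qed
  qed
  finally show ?thesis using u by simp
next
  case False
  then show ?thesis by (simp add: H10_def)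
qed

lemma H10_imp_H1: "u \<in> H10 \<Longrightarrow> u \<in> H1"
  by (simp add: H10_def)

lemma H10_approximating_sequence:
  assumes "u \<in> H10"
  obtains \<Phi> where "\<And>m :: nat. test_fun (\<Phi> m)" "(\<lambda>m. abs_L2_cube (\<Phi> m)) \<longlonglongrightarrow> u"
    "\<And>i. (\<lambda>m. abs_L2_cube (pderiv_cl i (\<Phi> m))) \<longlonglongrightarrow> pd i u"
proof -
  have "\<exists>\<phi>. test_fun \<phi> \<and> norm (u - abs_L2_cube \<phi>) < 1 / real (Suc m) \<and>
    (\<forall>i. norm (pd i u - abs_L2_cube (pderiv_cl i \<phi>)) < 1 / real (Suc m))" for m
    using assms by (simp add: H10_iff)
  then obtain \<Phi> where \<Phi>: "\<And>m. test_fun (\<Phi> m)" "\<And>m. norm (u - abs_L2_cube (\<Phi> m)) < 1 / real (Suc m)"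
    "\<And>m i. norm (pd i u - abs_L2_cube (pderiv_cl i (\<Phi> m))) < 1 / real (Suc m)"
    by metis
  have lim: "X \<longlonglongrightarrow> x" if "\<And>m. norm (x - X m) < 1 / real (Suc m)" for x :: "'a L2_cube" and X
  proof (rule LIM_zero_cancel, rule Lim_null_comparison)
    show "(\<lambda>m. 1 / real (Suc m)) \<longlonglongrightarrow> 0"
      using LIMSEQ_inverse_real_of_nat by (simp add: inverse_eq_divide)
    show "\<forall>\<^sub>F m in sequentially. norm (X m - x) \<le> 1 / real (Suc m)"
      using that by (auto simp: norm_minus_commute intro!: always_eventually less_imp_le)
  qed
  show ?thesis using \<Phi> by (intro that[of \<Phi>] lim)
qed

lemma H10_I_sequence:
  assumes test: "\<And>m :: nat. test_fun (\<Phi> m)" and lim: "(\<lambda>m. abs_L2_cube (\<Phi> m)) \<longlonglongrightarrow> u"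
    and dlim: "\<And>i. (\<lambda>m. abs_L2_cube (pderiv_cl i (\<Phi> m))) \<longlonglongrightarrow> v i"
  shows "u \<in> H10" "pd i u = v i"
proof -
  have w: "weak_pderiv i u (v i)" for i
    by (rule weak_pderiv_limit[OF _ _ lim dlim]) (auto intro!: always_eventually test_fun_weak_pderiv test)
  then show "pd i u = v i" by (rule pd_eq)
  have pd: "pd i u = v i" for i by (rule pd_eq[OF w])
  show "u \<in> H10"
    unfolding H10_iff
  proof (intro conjI allI impI)
    show "u \<in> H1" using w by (auto simp: H1_def)
    fix e :: real assume e: "e > 0"
    have "\<forall>\<^sub>F m in sequentially. norm (u - abs_L2_cube (\<Phi> m)) < e"
      using tendstoD[OF lim e] by (simp add: dist_norm norm_minus_commute)
    moreover have "\<forall>\<^sub>F m in sequentially. \<forall>i. norm (pd i u - abs_L2_cube (pderiv_cl i (\<Phi> m))) < e"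
      unfolding pd using tendstoD[OF dlim e]
      by (intro eventually_all_finite) (simp add: dist_norm norm_minus_commute)
    ultimately have "\<forall>\<^sub>F m in sequentially. norm (u - abs_L2_cube (\<Phi> m)) < e \<and>
        (\<forall>i. norm (pd i u - abs_L2_cube (pderiv_cl i (\<Phi> m))) < e)"
      by eventually_elim auto
    then show "\<exists>\<phi>. test_fun \<phi> \<and> norm (u - abs_L2_cube \<phi>) < e \<and>
        (\<forall>i. norm (pd i u - abs_L2_cube (pderiv_cl i \<phi>)) < e)"
      using test by (auto simp: eventually_sequentially)
  qed
qed

lemma H10_lincomb:
  assumes "u \<in> H10" "v \<in> H10"
  shows "cscale a u + cscale b v \<in> H10"
proof -
  obtain \<Phi> where \<Phi>: "\<And>m :: nat. test_fun (\<Phi> m)" "(\<lambda>m. abs_L2_cube (\<Phi> m)) \<longlonglongrightarrow> u"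
    "\<And>i. (\<lambda>m. abs_L2_cube (pderiv_cl i (\<Phi> m))) \<longlonglongrightarrow> pd i u"
    by (rule H10_approximating_sequence[OF assms(1)]) blast
  obtain \<Psi> where \<Psi>: "\<And>m :: nat. test_fun (\<Psi> m)" "(\<lambda>m. abs_L2_cube (\<Psi> m)) \<longlonglongrightarrow> v"
    "\<And>i. (\<lambda>m. abs_L2_cube (pderiv_cl i (\<Psi> m))) \<longlonglongrightarrow> pd i v"
    by (rule H10_approximating_sequence[OF assms(2)]) blast
  note bl = bounded_linear.tendsto[OF bounded_linear_cscale]
  have e: "abs_L2_cube (\<lambda>x. a * f x + b * g x) = cscale a (abs_L2_cube f) + cscale b (abs_L2_cube g)"
    if "square_integrable f" "square_integrable g" for f g
    using that by (simp add: abs_L2_cube_simps square_integrable_cmult)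
  show ?thesis
  proof (rule H10_I_sequence(1)[of "\<lambda>m x. a * \<Phi> m x + b * \<Psi> m x"])
    show "test_fun (\<lambda>x. a * \<Phi> m x + b * \<Psi> m x)" for m by (intro test_fun_lincomb \<Phi> \<Psi>)
    show "(\<lambda>m. abs_L2_cube (\<lambda>x. a * \<Phi> m x + b * \<Psi> m x)) \<longlonglongrightarrow> cscale a u + cscale b v"
      unfolding e[OF square_integrable_test_fun(1)[OF \<Phi>(1)] square_integrable_test_fun(1)[OF \<Psi>(1)]]
      by (intro tendsto_add bl \<Phi> \<Psi>)
    show "(\<lambda>m. abs_L2_cube (pderiv_cl i (\<lambda>x. a * \<Phi> m x + b * \<Psi> m x)))
        \<longlonglongrightarrow> cscale a (pd i u) + cscale b (pd i v)" for i
      unfolding pderiv_cl_lincomb[OF test_funD(1)[OF \<Phi>(1)] test_funD(1)[OF \<Psi>(1)]]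
        e[OF square_integrable_test_fun(2)[OF \<Phi>(1)] square_integrable_test_fun(2)[OF \<Psi>(1)]]
      by (intro tendsto_add bl \<Phi> \<Psi>)
  qed
qed

lemma mode_in_H10:
  "mode {} \<kappa> \<in> H10" "pd i (mode {} \<kappa>) = cscale (of_real (dfactor i {} \<kappa>)) (mode {i} \<kappa>)"
proof -
  obtain \<Phi> where \<Phi>: "\<And>m. test_fun (\<Phi> m)" "(\<lambda>m. abs_L2_cube (\<Phi> m)) \<longlonglongrightarrow> mode {} \<kappa>"
    "\<And>i. (\<lambda>m. abs_L2_cube (pderiv_cl i (\<Phi> m)))
        \<longlonglongrightarrow> cscale (of_real (dfactor i {} \<kappa>)) (mode {i} \<kappa>)"
    by (rule mode_test_approximation[of \<kappa>]) blast
  show "mode {} \<kappa> \<in> H10" "pd i (mode {} \<kappa>) = cscale (of_real (dfactor i {} \<kappa>)) (mode {i} \<kappa>)"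
    by (rule H10_I_sequence[OF \<Phi>])+
qed

section \<open>Sine series in Sobolev spaces\<close>

text \<open>Integration by parts against the cosine mode. There is no boundary term although the cosine does not vanish
  on the boundary, because \<open>u\<close> is approximated by test functions.\<close>

lemma H10_coefficient:
  assumes "u \<in> H10"
  shows "L2_inner (pd i u) (mode {i} \<kappa>) = of_real (dfactor i {} \<kappa>) * L2_inner u (mode {} \<kappa>)"
proof -
  obtain \<Phi> where \<Phi>: "\<And>m :: nat. test_fun (\<Phi> m)" "(\<lambda>m. abs_L2_cube (\<Phi> m)) \<longlonglongrightarrow> u"
    "\<And>i. (\<lambda>m. abs_L2_cube (pderiv_cl i (\<Phi> m))) \<longlonglongrightarrow> pd i u"
    by (rule H10_approximating_sequence[OF assms]) blast
  note si = square_integrable_test_fun[OF \<Phi>(1)] mode_fun_square_integrable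
  have eq: "L2_inner (abs_L2_cube (pderiv_cl i (\<Phi> m))) (mode {i} \<kappa>)
      = of_real (dfactor i {} \<kappa>) * L2_inner (abs_L2_cube (\<Phi> m)) (mode {} \<kappa>)" for m
  proof -
    have "weak_pderiv i (abs_L2_cube (mode_fun {i} \<kappa>))
        (abs_L2_cube (\<lambda>x. of_real (dfactor i {i} \<kappa>) * mode_fun {} \<kappa> x))"
      using mode_weak_pderiv[of i "{i}" \<kappa>]
      by (simp add: mode_def toggle_def abs_L2_cube_cscale mode_fun_square_integrable)
    then have "(LINT x|cube_measure. mode_fun {i} \<kappa> x * pderiv_cl i (\<Phi> m) x)
        = - (LINT x|cube_measure. (of_real (dfactor i {i} \<kappa>) * mode_fun {} \<kappa> x) * \<Phi> m x)"
      unfolding abs_L2_cube_simps(4)[OF mode_fun_square_integrable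
          square_integrable_cmult[OF mode_fun_square_integrable]]
      using \<Phi>(1) by blast
    also have "(\<lambda>x. (of_real (dfactor i {i} \<kappa>) * mode_fun {} \<kappa> x) * \<Phi> m x)
        = (\<lambda>x. - of_real (dfactor i {} \<kappa>) * (\<Phi> m x * mode_fun {} \<kappa> x))"
      by (simp add: dfactor_def mult_ac)
    finally show ?thesis
      unfolding mode_def abs_L2_cube_simps(3)[OF si(2) mode_fun_square_integrable]
        abs_L2_cube_simps(3)[OF si(1) mode_fun_square_integrable]
      by (simp add: mult.commute[of "mode_fun _ _ _"])
  qed
  have "(\<lambda>m. L2_inner (abs_L2_cube (pderiv_cl i (\<Phi> m))) (mode {i} \<kappa>))
      \<longlonglongrightarrow> L2_inner (pd i u) (mode {i} \<kappa>)"
    by (rule bounded_linear.tendsto[OF bounded_linear_L2_inner_left \<Phi>(3)])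
  moreover have "(\<lambda>m. L2_inner (abs_L2_cube (pderiv_cl i (\<Phi> m))) (mode {i} \<kappa>))
      \<longlonglongrightarrow> of_real (dfactor i {} \<kappa>) * L2_inner u (mode {} \<kappa>)"
    unfolding eq
    by (intro tendsto_mult tendsto_const bounded_linear.tendsto[OF bounded_linear_L2_inner_left \<Phi>(2)])
  ultimately show ?thesis by (rule LIMSEQ_unique)
qed

text \<open>Here the sine mode is the factor that is approximated by test functions, so \<open>w\<close> may be any element of
  \<open>H1\<close>, for instance a partial derivative of an element of \<open>H2\<close>.\<close>

lemma H1_coefficient:
  assumes "w \<in> H1"
  shows "L2_inner (pd i w) (mode {} \<kappa>) = - of_real (dfactor i {} \<kappa>) * L2_inner w (mode {i} \<kappa>)"
proof -
  obtain \<Phi> where \<Phi>: "\<And>m. test_fun (\<Phi> m)" "\<And>m x. cnj (\<Phi> m x) = \<Phi> m x"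
    "\<And>m i x. cnj (pderiv_cl i (\<Phi> m) x) = pderiv_cl i (\<Phi> m) x"
    "(\<lambda>m. abs_L2_cube (\<Phi> m)) \<longlonglongrightarrow> mode {} \<kappa>"
    "\<And>i. (\<lambda>m. abs_L2_cube (pderiv_cl i (\<Phi> m)))
        \<longlonglongrightarrow> cscale (of_real (dfactor i {} \<kappa>)) (mode {i} \<kappa>)"
    by (rule mode_test_approximation[of \<kappa>]) blast
  have eq: "L2_inner (pd i w) (abs_L2_cube (\<Phi> m)) = - L2_inner w (abs_L2_cube (pderiv_cl i (\<Phi> m)))" for m
    using weak_pderiv_pd[OF assms, of i] \<Phi>(1)[of m] unfolding weak_pderiv_iff
    by (metis (no_types, lifting) \<Phi>(2,3) add.inverse_inverse ext)
  have "(\<lambda>m. L2_inner (pd i w) (abs_L2_cube (\<Phi> m))) \<longlonglongrightarrow> L2_inner (pd i w) (mode {} \<kappa>)"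
    by (rule bounded_linear.tendsto[OF bounded_linear_L2_inner_right \<Phi>(4)])
  moreover have "(\<lambda>m. L2_inner (pd i w) (abs_L2_cube (\<Phi> m)))
      \<longlonglongrightarrow> - L2_inner w (cscale (of_real (dfactor i {} \<kappa>)) (mode {i} \<kappa>))"
    unfolding eq
    by (intro tendsto_minus bounded_linear.tendsto[OF bounded_linear_L2_inner_right \<Phi>(5)])
  ultimately have "L2_inner (pd i w) (mode {} \<kappa>)
      = - L2_inner w (cscale (of_real (dfactor i {} \<kappa>)) (mode {i} \<kappa>))"
    by (rule LIMSEQ_unique)
  then show ?thesis by (simp add: L2_inner_simps)
qed

lemma laplacian_coefficient:
  assumes "u \<in> H2" "u \<in> H10"
  shows "L2_inner (laplacian u) (mode {} \<kappa>)
    = - of_real (pi\<^sup>2 * real (sq_sum \<kappa>)) * L2_inner u (mode {} \<kappa>)"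
proof -
  have "L2_inner (pd i (pd i u)) (mode {} \<kappa>)
      = - of_real ((dfactor i {} \<kappa>)\<^sup>2) * L2_inner u (mode {} \<kappa>)" for i
    using assms by (simp add: H1_coefficient H10_coefficient H2_def power2_eq_square)
  then have "L2_inner (laplacian u) (mode {} \<kappa>)
      = (\<Sum>i\<in>UNIV. - of_real ((dfactor i {} \<kappa>)\<^sup>2) * L2_inner u (mode {} \<kappa>))"
    by (simp add: laplacian_def L2_inner_sum_left)
  also have "\<dots> = - of_real (\<Sum>i\<in>UNIV. (dfactor i {} \<kappa>)\<^sup>2) * L2_inner u (mode {} \<kappa>)"
    by (simp add: sum_distrib_right sum_negf)
  also have "(\<Sum>i\<in>UNIV. (dfactor i {} \<kappa>)\<^sup>2) = pi\<^sup>2 * real (sq_sum \<kappa>)"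
    by (simp add: dfactor_def sq_sum_def power_mult_distrib sum_distrib_left mult.commute)
  finally show ?thesis .
qed

lemma has_sum_finite_sum:
  assumes "finite A" "\<And>i. i \<in> A \<Longrightarrow> (f i has_sum s i) I"
  shows "((\<lambda>x. \<Sum>i\<in>A. f i x) has_sum (\<Sum>i\<in>A. s i :: 'b :: topological_comm_monoid_add)) I"
  using assms by (induction A rule: finite_induct) (auto intro: has_sum_add)

lemma weak_pderiv_sum:
  assumes "finite A" "\<And>x. x \<in> A \<Longrightarrow> weak_pderiv i (U x) (V x)"
  shows "weak_pderiv i (\<Sum>x\<in>A. U x) (\<Sum>x\<in>A. V x)"
  using assms
proof (induction A rule: finite_induct)
  case empty
  show ?case by (simp add: weak_pderiv_iff L2_inner_simps)
next
  case (insert x A)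
  then show ?case using weak_pderiv_lincomb[of i "U x" "V x" "sum U A" "sum V A" 1 1] by simp
qed

text \<open>Termwise differentiation: the partial sums satisfy the claim and the weak derivative is closed.\<close>

lemma mode_series_weak_pderiv:
  assumes "((\<lambda>\<kappa>. cscale (c \<kappa>) (mode S \<kappa>)) has_sum u) I"
    "((\<lambda>\<kappa>. cscale (c \<kappa> * of_real (dfactor i S \<kappa>)) (mode (toggle i S) \<kappa>)) has_sum v) I"
  shows "weak_pderiv i u v"
proof (rule weak_pderiv_limit[OF finite_subsets_at_top_neq_bot])
  show "(sum (\<lambda>\<kappa>. cscale (c \<kappa>) (mode S \<kappa>)) \<longlongrightarrow> u) (finite_subsets_at_top I)"
    "(sum (\<lambda>\<kappa>. cscale (c \<kappa> * of_real (dfactor i S \<kappa>)) (mode (toggle i S) \<kappa>)) \<longlongrightarrow> v) (finite_subsets_at_top I)"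
    using assms by (auto simp: has_sum_def)
  have "weak_pderiv i (cscale (c \<kappa>) (mode S \<kappa>))
      (cscale (c \<kappa> * of_real (dfactor i S \<kappa>)) (mode (toggle i S) \<kappa>))" for \<kappa>
    using weak_pderiv_lincomb[OF mode_weak_pderiv[of i S \<kappa>] mode_weak_pderiv[of i S \<kappa>], of "c \<kappa>" 0] by simp
  then show "\<forall>\<^sub>F F in finite_subsets_at_top I. weak_pderiv i (\<Sum>\<kappa>\<in>F. cscale (c \<kappa>) (mode S \<kappa>))
      (\<Sum>\<kappa>\<in>F. cscale (c \<kappa> * of_real (dfactor i S \<kappa>)) (mode (toggle i S) \<kappa>))"
    by (intro eventually_finite_subsets_at_top_weakI weak_pderiv_sum)
qed

text \<open>Bessel's inequality for \<open>pd i u\<close> and the cosine modes yields square summable coefficients, so the differentiated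
  series has a sum; it is a weak derivative of \<open>u\<close>, and weak derivatives are unique.\<close>

lemma H10_pd_expansion:
  assumes "u \<in> H10"
  shows "((\<lambda>\<kappa>. cscale (L2_inner u (mode {} \<kappa>) * of_real (dfactor i {} \<kappa>)) (mode {i} \<kappa>))
    has_sum pd i u) multi_indices"
proof -
  let ?c = "\<lambda>\<kappa>. L2_inner u (mode {} \<kappa>) * of_real (dfactor i {} \<kappa>)"
  have "(\<lambda>\<kappa>. (cmod (?c \<kappa>))\<^sup>2) summable_on multi_indices"
    using Bessel_summable[OF mode_orthonormal, of "pd i u" "{i}"]
    by (simp add: H10_coefficient[OF assms] mult.commute)
  from orthonormal_summable[OF mode_orthonormal this, of "{i}"]
  obtain v where v: "((\<lambda>\<kappa>. cscale (?c \<kappa>) (mode {i} \<kappa>)) has_sum v) multi_indices"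
    by (auto simp: summable_on_def)
  have "weak_pderiv i u v"
    by (rule mode_series_weak_pderiv[OF mode_expansion]) (use v in \<open>simp add: toggle_def\<close>)
  then show ?thesis using v pd_eq by blast
qed

lemma H10_gradient_Parseval:
  assumes "u \<in> H10"
  shows "((\<lambda>\<kappa>. pi\<^sup>2 * real (sq_sum \<kappa>) * (cmod (L2_inner u (mode {} \<kappa>)))\<^sup>2)
    has_sum (\<Sum>i\<in>UNIV. (norm (pd i u))\<^sup>2)) multi_indices"
proof -
  have "((\<lambda>\<kappa>. \<Sum>i\<in>UNIV. (cmod (L2_inner u (mode {} \<kappa>) * of_real (dfactor i {} \<kappa>)))\<^sup>2)
      has_sum (\<Sum>i\<in>UNIV. (norm (pd i u))\<^sup>2)) multi_indices"
    by (intro has_sum_finite_sum orthonormal_has_sum_norm[OF mode_orthonormal H10_pd_expansion] assms) simp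
  moreover have "(\<Sum>i\<in>UNIV. (cmod (L2_inner u (mode {} \<kappa>) * of_real (dfactor i {} \<kappa>)))\<^sup>2)
      = pi\<^sup>2 * real (sq_sum \<kappa>) * (cmod (L2_inner u (mode {} \<kappa>)))\<^sup>2" for \<kappa>
    by (simp add: norm_mult power_mult_distrib dfactor_def sq_sum_def sum_distrib_left
        sum_distrib_right mult_ac)
  ultimately show ?thesis by simp
qed

lemma L2_Parseval:
  "((\<lambda>\<kappa>. (cmod (L2_inner u (mode {} \<kappa>)))\<^sup>2) has_sum (norm u)\<^sup>2) multi_indices"
  by (rule orthonormal_has_sum_norm[OF mode_orthonormal mode_expansion])

lemma H10_limit:
  assumes F: "F \<noteq> bot" and U: "\<forall>\<^sub>F x in F. U x \<in> H10" and lim: "(U \<longlongrightarrow> u) F"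
    and dlim: "\<And>i. ((\<lambda>x. pd i (U x)) \<longlongrightarrow> v i) F"
  shows "u \<in> H10" "pd i u = v i"
proof -
  have w: "weak_pderiv i u (v i)" for i
    by (rule weak_pderiv_limit[OF F _ lim dlim])
       (use U in \<open>auto elim!: eventually_mono intro: weak_pderiv_pd H10_imp_H1\<close>)
  then show "pd i u = v i" by (rule pd_eq)
  have pd: "pd i u = v i" for i by (rule pd_eq[OF w])
  show "u \<in> H10"
    unfolding H10_iff
  proof (intro conjI allI impI)
    show "u \<in> H1" using w by (auto simp: H1_def)
    fix e :: real assume e: "e > 0"
    then have e2: "e / 2 > 0" by simp
    have "\<forall>\<^sub>F x in F. \<forall>i. norm (pd i u - pd i (U x)) < e / 2"
      unfolding pd using tendstoD[OF dlim e2]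
      by (intro eventually_all_finite) (simp add: dist_norm norm_minus_commute)
    moreover have "\<forall>\<^sub>F x in F. norm (u - U x) < e / 2"
      using tendstoD[OF lim e2] by (simp add: dist_norm norm_minus_commute)
    ultimately have "\<forall>\<^sub>F x in F. U x \<in> H10 \<and> norm (u - U x) < e / 2 \<and>
        (\<forall>i. norm (pd i u - pd i (U x)) < e / 2)"
      using U by eventually_elim auto
    then obtain x where x: "U x \<in> H10" "norm (u - U x) < e / 2"
      "\<And>i. norm (pd i u - pd i (U x)) < e / 2"
      using eventually_happens'[OF F] by blast
    obtain \<phi> where \<phi>: "test_fun \<phi>" "norm (U x - abs_L2_cube \<phi>) < e / 2"
      "\<And>i. norm (pd i (U x) - abs_L2_cube (pderiv_cl i \<phi>)) < e / 2"
      using x(1) e2 unfolding H10_iff by blast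
    have tri: "norm (a - c) < e" if "norm (a - b) < e / 2" "norm (b - c) < e / 2" for a b c :: "'b L2_cube"
      using norm_triangle_ineq[of "a - b" "b - c"] that by simp
    show "\<exists>\<phi>. test_fun \<phi> \<and> norm (u - abs_L2_cube \<phi>) < e \<and>
        (\<forall>i. norm (pd i u - abs_L2_cube (pderiv_cl i \<phi>)) < e)"
      using \<phi>(1) tri[OF x(2) \<phi>(2)] tri[OF x(3) \<phi>(3)] by blast
  qed
qed

lemma zero_in_H10: "0 \<in> H10"
  using H10_lincomb[OF mode_in_H10(1) mode_in_H10(1), where a = 0 and b = 0] by simp

lemma H10_sum:
  assumes "finite A" "\<And>x. x \<in> A \<Longrightarrow> U x \<in> H10"
  shows "(\<Sum>x\<in>A. U x) \<in> H10"
  using assms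
proof (induction A rule: finite_induct)
  case (insert x A)
  then show ?case using H10_lincomb[of "U x" "sum U A" 1 1] by simp
qed (simp add: zero_in_H10)

text \<open>The factor \<open>(1 + sq_sum \<kappa>)\<^sup>2\<close> dominates, up to a constant, the squared factors that two differentiations
  produce, so the series of all derivatives of order at most two converge. The partial sums belong to \<open>H10\<close>, which
  is closed under the resulting convergence in \<open>H1\<close>.\<close>

lemma mode_series_in_H2_H10:
  fixes c :: "'n::finite multi_nat \<Rightarrow> complex"
  assumes c: "(\<lambda>\<kappa>. (cmod (c \<kappa>))\<^sup>2 * (1 + real (sq_sum \<kappa>))\<^sup>2) summable_on multi_indices"
  obtains u where "u \<in> H2" "u \<in> H10" "\<And>\<kappa>. \<kappa> \<in> multi_indices \<Longrightarrow> L2_inner u (mode {} \<kappa>) = c \<kappa>"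
proof -
  have comp: "(\<lambda>\<kappa>. (cmod (c \<kappa> * of_real (d \<kappa>)))\<^sup>2) summable_on multi_indices"
    if d: "\<And>\<kappa>. (d \<kappa>)\<^sup>2 \<le> B * (1 + real (sq_sum \<kappa>))\<^sup>2" for d B
  proof (rule summable_on_comparison_test)
    show "(\<lambda>\<kappa>. B * ((cmod (c \<kappa>))\<^sup>2 * (1 + real (sq_sum \<kappa>))\<^sup>2)) summable_on multi_indices"
      by (rule summable_on_cmult_right[OF c])
    show "(cmod (c \<kappa> * of_real (d \<kappa>)))\<^sup>2 \<le> B * ((cmod (c \<kappa>))\<^sup>2 * (1 + real (sq_sum \<kappa>))\<^sup>2)" for \<kappa>
      using mult_left_mono[OF d[of \<kappa>], of "(cmod (c \<kappa>))\<^sup>2"]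
      by (simp add: norm_mult power_mult_distrib mult.left_commute)
  qed auto
  have \<kappa>_le: "(real (\<kappa> $ i))\<^sup>2 \<le> 1 + real (sq_sum \<kappa>)" for \<kappa> :: "'n multi_nat" and i
  proof -
    have "(\<kappa> $ i)\<^sup>2 \<le> sq_sum \<kappa>" unfolding sq_sum_def by (rule member_le_sum) auto
    then have "real ((\<kappa> $ i)\<^sup>2) \<le> real (sq_sum \<kappa>)" by (rule of_nat_mono)
    then show ?thesis unfolding of_nat_power by linarith
  qed
  have df_le: "(dfactor i S \<kappa>)\<^sup>2 \<le> pi\<^sup>2 * (1 + real (sq_sum \<kappa>))" for i S and \<kappa> :: "'n multi_nat"
    using \<kappa>_le[of \<kappa> i] by (simp add: dfactor_def power_mult_distrib mult.commute mult_left_mono)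
  have one_le: "1 + real (sq_sum \<kappa>) \<le> (1 + real (sq_sum \<kappa>))\<^sup>2" for \<kappa> :: "'n multi_nat"
    by (rule self_le_power) auto
  have d1: "(dfactor i S \<kappa>)\<^sup>2 \<le> pi\<^sup>2 * (1 + real (sq_sum \<kappa>))\<^sup>2" for i S and \<kappa> :: "'n multi_nat"
    by (rule order_trans[OF df_le mult_left_mono[OF one_le zero_le_power2]])
  have d2: "(dfactor i S \<kappa> * dfactor j T \<kappa>)\<^sup>2 \<le> (pi\<^sup>2)\<^sup>2 * (1 + real (sq_sum \<kappa>))\<^sup>2"
    for i S j T and \<kappa> :: "'n multi_nat"
  proof -
    have "(dfactor i S \<kappa>)\<^sup>2 * (dfactor j T \<kappa>)\<^sup>2 \<le> (pi\<^sup>2 * (1 + real (sq_sum \<kappa>))) * (pi\<^sup>2 * (1 + real (sq_sum \<kappa>)))"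
      by (intro mult_mono df_le) auto
    then show ?thesis by (simp add: power_mult_distrib power2_eq_square mult_ac)
  qed
  have "(\<lambda>\<kappa>. (cmod (c \<kappa>))\<^sup>2) summable_on multi_indices"
    using comp[of "\<lambda>_. 1" 1] one_le by (smt (verit) mult_1 mult_1_right of_nat_0_le_iff of_real_1 power_one summable_on_cong)
  from orthonormal_summable[OF mode_orthonormal this, of "{}"]
  obtain u where u: "((\<lambda>\<kappa>. cscale (c \<kappa>) (mode {} \<kappa>)) has_sum u) multi_indices"
    by (auto simp: summable_on_def)
  have "\<exists>v. ((\<lambda>\<kappa>. cscale (c \<kappa> * of_real (dfactor i {} \<kappa>)) (mode {i} \<kappa>)) has_sum v) multi_indices" for i
    using orthonormal_summable[OF mode_orthonormal comp[of "dfactor i {}", OF d1], of "{i}"] by (auto simp: summable_on_def)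
  then obtain v where v:
    "\<And>i. ((\<lambda>\<kappa>. cscale (c \<kappa> * of_real (dfactor i {} \<kappa>)) (mode {i} \<kappa>)) has_sum v i) multi_indices"
    by metis
  have uv: "u \<in> H10" "pd i u = v i" for i
  proof -
    let ?U = "\<lambda>F. \<Sum>\<kappa>\<in>F. cscale (c \<kappa>) (mode {} \<kappa>)"
    have m: "cscale (c \<kappa>) (mode {} \<kappa>) \<in> H10" for \<kappa>
      using H10_lincomb[OF mode_in_H10(1)[of \<kappa>] mode_in_H10(1)[of \<kappa>], of "c \<kappa>" 0] by simp
    have pdU: "pd i (?U F) = (\<Sum>\<kappa>\<in>F. cscale (c \<kappa> * of_real (dfactor i {} \<kappa>)) (mode {i} \<kappa>))"
      if "finite F" for F i
    proof (intro pd_eq weak_pderiv_sum that)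
      show "weak_pderiv i (cscale (c \<kappa>) (mode {} \<kappa>))
          (cscale (c \<kappa> * of_real (dfactor i {} \<kappa>)) (mode {i} \<kappa>))" for \<kappa>
        using weak_pderiv_lincomb[OF mode_weak_pderiv[of i "{}" \<kappa>] mode_weak_pderiv[of i "{}" \<kappa>], of "c \<kappa>" 0]
        by (simp add: toggle_def)
    qed
    have 1: "\<forall>\<^sub>F F in finite_subsets_at_top multi_indices. ?U F \<in> H10"
      by (intro eventually_finite_subsets_at_top_weakI H10_sum m)
    have 2: "(?U \<longlongrightarrow> u) (finite_subsets_at_top multi_indices)"
      using u by (simp add: has_sum_def)
    have 3: "((\<lambda>F. pd i (?U F)) \<longlongrightarrow> v i) (finite_subsets_at_top multi_indices)" for i
      by (rule Lim_transform_eventually[OF v[of i, unfolded has_sum_def]])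
         (auto intro: eventually_finite_subsets_at_top_weakI simp: pdU)
    show "u \<in> H10" "pd i u = v i"
      by (rule H10_limit[OF finite_subsets_at_top_neq_bot 1 2 3])+
  qed
  have "v i \<in> H1" for i
  proof -
    have "\<exists>w. weak_pderiv j (v i) w" for j
    proof -
      obtain w where "((\<lambda>\<kappa>. cscale (c \<kappa> * of_real (dfactor i {} \<kappa> * dfactor j {i} \<kappa>))
          (mode (toggle j {i}) \<kappa>)) has_sum w) multi_indices"
        using orthonormal_summable[OF mode_orthonormal
            comp[of "\<lambda>\<kappa>. dfactor i {} \<kappa> * dfactor j {i} \<kappa>", OF d2], of "toggle j {i}"]
        by (auto simp: summable_on_def)
      then have "weak_pderiv j (v i) w"
        by (intro mode_series_weak_pderiv[OF v]) (simp add: mult.assoc)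
      then show ?thesis by blast
    qed
    then show ?thesis by (simp add: H1_def)
  qed
  then have "u \<in> H2" using uv H10_imp_H1 by (auto simp: H2_def)
  then show ?thesis
    using that uv(1) orthonormal_has_sum_coefficient[OF mode_orthonormal u] by blast
qed

section \<open>The enumeration of the multi-indices\<close>

lemma precedes_irrefl: "\<not> precedes \<kappa> \<kappa>"
  by (simp add: precedes_def less_fun_irrefl)

lemma precedes_trans: "precedes \<kappa> \<mu> \<Longrightarrow> precedes \<mu> \<nu> \<Longrightarrow> precedes \<kappa> \<nu>"
  unfolding precedes_def using less_fun_trans by fastforce

lemma precedes_total:
  assumes "\<kappa> \<noteq> \<mu>" shows "precedes \<kappa> \<mu> \<or> precedes \<mu> \<kappa>"
proof -
  have "less_fun (($) \<kappa>) (($) \<mu>) \<or> ($) \<kappa> = ($) \<mu> \<or> less_fun (($) \<mu>) (($) \<kappa>)"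
    by (rule less_fun_trichotomy) simp
  moreover have "($) \<kappa> \<noteq> ($) \<mu>" using assms vec_nth_inject by blast
  ultimately show ?thesis unfolding precedes_def by (meson linorder_neqE_nat)
qed

lemma le_sq_sum: "\<kappa> $ j \<le> sq_sum \<kappa>"
proof -
  have "\<kappa> $ j \<le> (\<kappa> $ j)\<^sup>2" by (simp add: power2_eq_square)
  also have "\<dots> \<le> sq_sum \<kappa>" unfolding sq_sum_def by (rule member_le_sum) auto
  finally show ?thesis .
qed

lemma finite_predecessors: "finite (predecessors \<kappa>)"
proof (rule finite_subset)
  show "predecessors \<kappa> \<subseteq> (\<lambda>f. \<chi> j. f j) ` (\<Pi>\<^sub>E j\<in>UNIV. {..sq_sum \<kappa>})"
  proof
    fix \<mu> assume "\<mu> \<in> predecessors \<kappa>"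
    then have "sq_sum \<mu> \<le> sq_sum \<kappa>" by (auto simp: predecessors_def precedes_def)
    then have "\<mu> $ j \<le> sq_sum \<kappa>" for j using le_sq_sum[of \<mu> j] by linarith
    then show "\<mu> \<in> (\<lambda>f. \<chi> j. f j) ` (\<Pi>\<^sub>E j\<in>UNIV. {..sq_sum \<kappa>})"
      by (intro image_eqI[of _ _ "($) \<mu>"]) auto
  qed
  show "finite ((\<lambda>f. \<chi> j. f j) ` (\<Pi>\<^sub>E j\<in>UNIV. {..sq_sum \<kappa>}))"
    by (intro finite_imageI finite_PiE) auto
qed

lemma infinite_multi_indices: "infinite (multi_indices :: 'n::finite multi_nat set)"
proof
  assume "finite (multi_indices :: 'n multi_nat set)"
  moreover have "range (\<lambda>n. (\<chi> j. Suc n) :: 'n multi_nat) \<subseteq> multi_indices"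
    by (auto simp: multi_indices_def)
  moreover have "inj (\<lambda>n. (\<chi> j. Suc n) :: 'n multi_nat)"
    by (auto simp: inj_def vec_eq_iff)
  ultimately show False using finite_subset finite_imageD infinite_UNIV_nat by metis
qed

lemma card_predecessors_less:
  assumes "precedes \<mu> \<kappa>" "\<mu> \<in> multi_indices"
  shows "card (predecessors \<mu>) < card (predecessors \<kappa>)"
proof (rule psubset_card_mono[OF finite_predecessors])
  have "predecessors \<mu> \<subseteq> predecessors \<kappa>"
    using assms precedes_trans by (auto simp: predecessors_def)
  moreover have "\<mu> \<in> predecessors \<kappa>" "\<mu> \<notin> predecessors \<mu>"
    using assms precedes_irrefl by (auto simp: predecessors_def)
  ultimately show "predecessors \<mu> \<subset> predecessors \<kappa>" by blast
qed

text \<open>Ranks are strictly increasing, so the rank is injective and maps the predecessors of \<open>\<kappa>\<close> onto all numbers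
  below the rank of \<open>\<kappa>\<close>. As there are infinitely many multi-indices, every number is reached.\<close>

lemma bij_betw_card_predecessors:
  "bij_betw (\<lambda>\<kappa>. card (predecessors \<kappa>)) (multi_indices :: 'n::{finite,linorder} multi_nat set) UNIV"
proof -
  let ?r = "\<lambda>\<kappa> :: 'n multi_nat. card (predecessors \<kappa>)"
  have inj: "inj_on ?r multi_indices"
  proof (rule inj_onI, rule ccontr)
    fix \<kappa> \<mu> :: "'n multi_nat"
    assume *: "\<kappa> \<in> multi_indices" "\<mu> \<in> multi_indices" "?r \<kappa> = ?r \<mu>" "\<kappa> \<noteq> \<mu>"
    then show False
      using precedes_total[of \<kappa> \<mu>] card_predecessors_less[of \<kappa> \<mu>] card_predecessors_less[of \<mu> \<kappa>]
      by auto
  qed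
  have down: "m \<in> ?r ` multi_indices" if "\<kappa> \<in> multi_indices" "m < ?r \<kappa>" for \<kappa> m
  proof -
    have sub: "predecessors \<kappa> \<subseteq> multi_indices" by (auto simp: predecessors_def)
    have "?r ` predecessors \<kappa> = {..<?r \<kappa>}"
    proof (rule card_subset_eq)
      show "?r ` predecessors \<kappa> \<subseteq> {..<?r \<kappa>}"
        using card_predecessors_less by (auto simp: predecessors_def)
      show "card (?r ` predecessors \<kappa>) = card {..<?r \<kappa>}"
        using card_image[OF inj_on_subset[OF inj sub]] by simp
    qed simp
    then show ?thesis using that sub by blast
  qed
  have "m \<in> ?r ` multi_indices" for m
  proof -
    have "infinite (?r ` multi_indices)"
      using infinite_multi_indices inj finite_imageD by blast
    then obtain x where "x \<in> ?r ` multi_indices" "m < x"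
      unfolding infinite_nat_iff_unbounded by blast
    then show ?thesis using down by blast
  qed
  then show ?thesis using inj by (auto simp: bij_betw_def)
qed

lemma bij_betw_multi_index: "bij_betw multi_index UNIV (multi_indices :: 'n::{finite,linorder} multi_nat set)"
proof -
  let ?r = "\<lambda>\<kappa> :: 'n multi_nat. card (predecessors \<kappa>)"
  have "(multi_index m :: 'n multi_nat) = the_inv_into multi_indices ?r m" for m
    by (simp add: multi_index_def the_inv_into_def)
  then have "(multi_index :: nat \<Rightarrow> 'n multi_nat) = the_inv_into multi_indices ?r" by (rule ext)
  then show ?thesis
    using bij_betw_the_inv_into[OF bij_betw_card_predecessors] by metis
qed

lemma mode_index_in: "mode_index k \<in> multi_indices"
  using bij_betw_multi_index by (auto simp: mode_index_def bij_betw_def)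

lemma mode_index_surj:
  assumes "\<kappa> \<in> multi_indices"
  shows "\<exists>k\<ge>1. mode_index k = \<kappa>"
proof -
  obtain m where "\<kappa> = multi_index m"
    using assms bij_betw_multi_index unfolding bij_betw_def by blast
  then show ?thesis by (intro exI[of _ "2 * m + 1"]) (simp add: mode_index_def)
qed

text \<open>The even positions of the sequence carry the plus branch and the odd ones the minus branch. Since all terms
  are nonnegative, both halves are summable on their own and may be recombined.\<close>

lemma mode_sums:
  fixes a :: "bool \<Rightarrow> 'n::{finite,linorder} multi_nat \<Rightarrow> real"
  assumes nonneg: "\<And>b \<kappa>. 0 \<le> a b \<kappa>"
    and sum: "((\<lambda>\<kappa>. a True \<kappa> + a False \<kappa>) has_sum S) multi_indices"
  shows "(\<lambda>j. a (odd (Suc j)) (mode_index (Suc j))) sums S"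
proof -
  let ?b = "\<lambda>j. a (odd (Suc j)) (mode_index (Suc j))"
  have "(a b) summable_on multi_indices" for b
    by (rule summable_on_comparison_test[OF has_sum_imp_summable[OF sum]])
       (cases b; simp add: nonneg)+
  then obtain s where s: "\<And>b. ((a b) has_sum s b) multi_indices"
    unfolding summable_on_def by metis
  have S: "S = s True + s False"
    by (rule has_sum_unique[OF sum has_sum_add[OF s s]])
  have "((\<lambda>m. a b (multi_index m)) has_sum s b) UNIV" for b
    using s[of b] has_sum_reindex_bij_betw[OF bij_betw_multi_index, of "a b"] by simp
  then have e: "((\<lambda>m. ?b (2 * m)) has_sum s True) UNIV" "((\<lambda>m. ?b (Suc (2 * m))) has_sum s False) UNIV"
    by (simp_all add: mode_index_def)
  have "bij_betw (\<lambda>m. 2 * m) UNIV {j :: nat. even j}"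
    by (auto simp: bij_betw_def inj_def elim!: evenE)
  then have 1: "(?b has_sum s True) {j. even j}"
    using has_sum_reindex_bij_betw[of "\<lambda>m. 2 * m" UNIV _ ?b] e(1) by blast
  have "bij_betw (\<lambda>m. Suc (2 * m)) UNIV {j :: nat. odd j}"
    by (auto simp: bij_betw_def inj_def elim!: oddE)
  then have 2: "(?b has_sum s False) {j. odd j}"
    using has_sum_reindex_bij_betw[of "\<lambda>m. Suc (2 * m)" UNIV _ ?b] e(2) by blast
  have "(?b has_sum s True + s False) ({j. even j} \<union> {j. odd j})"
    by (rule has_sum_Un_disjoint[OF 1 2]) auto
  moreover have "{j. even j} \<union> {j. odd j} = (UNIV :: nat set)" by auto
  ultimately show ?thesis using has_sum_imp_sums S by metis
qed

section \<open>Frequencies\<close>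

definition freq :: "real \<Rightarrow> 'n::finite multi_nat \<Rightarrow> real" where
  "freq \<alpha> \<kappa> = sqrt (pi\<^sup>2 * real (sq_sum \<kappa>) + \<alpha>)"

lemma card_le_sq_sum: "\<kappa> \<in> multi_indices \<Longrightarrow> CARD('n) \<le> sq_sum (\<kappa> :: 'n::finite multi_nat)"
  unfolding sq_sum_def multi_indices_def card_eq_sum
  by (intro sum_mono) (simp add: power2_eq_square)

lemma freq_ge:
  assumes "\<alpha> \<ge> 0" "\<kappa> \<in> multi_indices"
  shows "sqrt (real CARD('n) * pi\<^sup>2 + \<alpha>) \<le> freq \<alpha> (\<kappa> :: 'n::finite multi_nat)"
  using card_le_sq_sum[OF assms(2)] unfolding freq_def
  by (simp add: mult.commute mult_left_mono)

lemma freq_ones: "freq \<alpha> (\<chi> j. 1 :: 'n::finite multi_nat) = sqrt (real CARD('n) * pi\<^sup>2 + \<alpha>)"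
  by (simp add: freq_def sq_sum_def mult.commute)

lemma lowest_freq_pos: "\<alpha> \<ge> 0 \<Longrightarrow> 0 < sqrt (real CARD('n::finite) * pi\<^sup>2 + \<alpha>)"
  by (simp add: add_pos_nonneg)

lemma freq_pos: "\<alpha> \<ge> 0 \<Longrightarrow> \<kappa> \<in> multi_indices \<Longrightarrow> freq \<alpha> \<kappa> > 0"
  using freq_ge lowest_freq_pos by (rule less_le_trans[rotated])

lemma freq_square: "\<alpha> \<ge> 0 \<Longrightarrow> (freq \<alpha> \<kappa>)\<^sup>2 = pi\<^sup>2 * real (sq_sum \<kappa>) + \<alpha>"
  by (simp add: freq_def)

lemma abs_omega: "\<alpha> \<ge> 0 \<Longrightarrow> \<bar>omega TYPE('n::{finite,linorder}) \<alpha> k\<bar> = freq \<alpha> (mode_index k :: 'n multi_nat)"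
  by (simp add: omega_def eigval_def eigval_branch_def freq_def)

lemma omega_min_eq:
  assumes "\<alpha> \<ge> 0"
  shows "omega_min TYPE('n::{finite,linorder}) \<alpha> = sqrt (real CARD('n) * pi\<^sup>2 + \<alpha>)"
  unfolding omega_min_def
proof (rule cInf_eq_minimum)
  have "(\<chi> j. 1) \<in> (multi_indices :: 'n multi_nat set)" by (simp add: multi_indices_def)
  then obtain k where "k \<ge> 1" "(mode_index k :: 'n multi_nat) = (\<chi> j. 1)"
    using mode_index_surj by blast
  then show "sqrt (real CARD('n) * pi\<^sup>2 + \<alpha>) \<in> (\<lambda>k. \<bar>omega TYPE('n) \<alpha> k\<bar>) ` {1..}"
    by (intro image_eqI[of _ _ k]) (auto simp: abs_omega[OF assms] freq_ones simp del: One_nat_def)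
next
  fix x assume "x \<in> (\<lambda>k. \<bar>omega TYPE('n) \<alpha> k\<bar>) ` {1..}"
  then show "sqrt (real CARD('n) * pi\<^sup>2 + \<alpha>) \<le> x"
    using freq_ge[OF assms mode_index_in] by (auto simp: abs_omega[OF assms])
qed

section \<open>The energy space\<close>

abbreviation sine_coeff :: "'n::finite L2_cube \<Rightarrow> 'n multi_nat \<Rightarrow> complex" where
  "sine_coeff u \<kappa> \<equiv> L2_inner u (mode {} \<kappa>)"

lemma L2_cube_eqI:
  assumes "\<And>\<kappa>. \<kappa> \<in> multi_indices \<Longrightarrow> sine_coeff u \<kappa> = sine_coeff v \<kappa>"
  shows "u = v"
proof -
  have "u - v = 0" by (rule mode_complete) (simp add: assms L2_inner_simps)
  then show ?thesis by simp
qed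

lemma energy_norm_square:
  "\<alpha> \<ge> 0 \<Longrightarrow> (energy_norm \<alpha> U)\<^sup>2
    = (\<Sum>i\<in>UNIV. (norm (pd i (fst U)))\<^sup>2) + \<alpha> * (norm (fst U))\<^sup>2 + (norm (snd U))\<^sup>2"
  by (simp add: energy_norm_def energy_inner_def L2_inner_self sum_nonneg del: of_real_power)

lemma energy_norm_nonneg: "\<alpha> \<ge> 0 \<Longrightarrow> 0 \<le> energy_norm \<alpha> U"
  by (simp add: energy_norm_def energy_inner_def L2_inner_self sum_nonneg del: of_real_power)

text \<open>The direction of the eigenvalue on the imaginary axis.\<close>

definition sgn_branch :: "bool \<Rightarrow> complex" where
  "sgn_branch s = (if s then \<i> else - \<i>)"

lemma sgn_branch_simps [simp]:
  "sgn_branch s * sgn_branch s = - 1" "cnj (sgn_branch s) = - sgn_branch s" "cmod (sgn_branch s) = 1"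
  "sgn_branch s * (sgn_branch s * x) = - x" "sgn_branch s \<noteq> 0"
  by (simp_all add: sgn_branch_def flip: mult.assoc)

lemma eigval_branch_eq: "eigval_branch \<alpha> s \<kappa> = sgn_branch s * of_real (freq \<alpha> \<kappa>)"
  by (simp add: eigval_branch_def sgn_branch_def freq_def)

text \<open>Gradient and mass term of the energy add up to \<open>\<omega>\<^sup>2\<close> times the coefficient of the first component, and
  division by the conjugate of the eigenvalue leaves one factor \<open>\<omega>\<close>.\<close>

lemma energy_inner_eigfun:
  assumes \<alpha>: "\<alpha> \<ge> 0" and \<kappa>: "\<kappa> \<in> multi_indices" and U: "U \<in> energy_space"
  shows "energy_inner \<alpha> U (eigfun_branch \<alpha> s \<kappa>) = of_real (1 / sqrt 2) *
    (sgn_branch s * of_real (freq \<alpha> \<kappa>) * sine_coeff (fst U) \<kappa> - sine_coeff (snd U) \<kappa>)"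
proof -
  define a where "a = complex_of_real (1 / sqrt 2) * (1 / eigval_branch \<alpha> s \<kappa>)"
  have e: "abs_L2_cube (sine_fun \<kappa>) = mode {} \<kappa>" by (simp add: sine_fun_eq_mode_fun mode_def)
  have u: "fst U \<in> H10" using U by (auto simp: energy_space_def)
  have "pd i (cscale a (mode {} \<kappa>)) = cscale (a * of_real (dfactor i {} \<kappa>)) (mode {i} \<kappa>)" for i
    using pd_lincomb(2)[OF H10_imp_H1 H10_imp_H1, OF mode_in_H10(1)[of \<kappa>] mode_in_H10(1)[of \<kappa>], of i a 0]
    by (simp add: mode_in_H10(2))
  then have "L2_inner (pd i (fst U)) (pd i (cscale a (mode {} \<kappa>)))
      = cnj a * of_real ((dfactor i {} \<kappa>)\<^sup>2) * sine_coeff (fst U) \<kappa>" for i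
    by (simp add: L2_inner_simps H10_coefficient[OF u] power2_eq_square)
  then have "energy_inner \<alpha> U (eigfun_branch \<alpha> s \<kappa>)
      = (\<Sum>i\<in>UNIV. cnj a * of_real ((dfactor i {} \<kappa>)\<^sup>2) * sine_coeff (fst U) \<kappa>)
        + of_real \<alpha> * (cnj a * sine_coeff (fst U) \<kappa>) - of_real (1 / sqrt 2) * sine_coeff (snd U) \<kappa>"
    by (simp add: energy_inner_def eigfun_branch_def cscale_state_def e a_def[symmetric]
        L2_inner_simps del: cscale_minus_right) (simp add: a_def)
  also have "(\<Sum>i\<in>UNIV. cnj a * of_real ((dfactor i {} \<kappa>)\<^sup>2) * sine_coeff (fst U) \<kappa>)
      = cnj a * of_real (\<Sum>i\<in>UNIV. (dfactor i {} \<kappa>)\<^sup>2) * sine_coeff (fst U) \<kappa>"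
    by (simp add: sum_distrib_left sum_distrib_right)
  also have "(\<Sum>i\<in>UNIV. (dfactor i {} \<kappa>)\<^sup>2) = pi\<^sup>2 * real (sq_sum \<kappa>)"
    by (simp add: dfactor_def sq_sum_def power_mult_distrib sum_distrib_left mult.commute)
  also have "cnj a * of_real (pi\<^sup>2 * real (sq_sum \<kappa>)) * sine_coeff (fst U) \<kappa>
        + of_real \<alpha> * (cnj a * sine_coeff (fst U) \<kappa>) - of_real (1 / sqrt 2) * sine_coeff (snd U) \<kappa>
      = cnj a * of_real ((freq \<alpha> \<kappa>)\<^sup>2) * sine_coeff (fst U) \<kappa> - of_real (1 / sqrt 2) * sine_coeff (snd U) \<kappa>"
    unfolding freq_square[OF \<alpha>] by (simp add: algebra_simps)
  also have "cnj a * of_real ((freq \<alpha> \<kappa>)\<^sup>2) = of_real (1 / sqrt 2) * (sgn_branch s * of_real (freq \<alpha> \<kappa>))"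
    using freq_pos[OF \<alpha> \<kappa>] unfolding a_def eigval_branch_eq
    by (simp add: field_simps power2_eq_square)
  finally show ?thesis by (simp add: algebra_simps)
qed

text \<open>The parallelogram law: the mixed terms of the two branches cancel.\<close>

lemma energy_inner_eigfun_pair:
  assumes \<alpha>: "\<alpha> \<ge> 0" and \<kappa>: "\<kappa> \<in> multi_indices" and U: "U \<in> energy_space"
  shows "(cmod (energy_inner \<alpha> U (eigfun_branch \<alpha> True \<kappa>)))\<^sup>2
      + (cmod (energy_inner \<alpha> U (eigfun_branch \<alpha> False \<kappa>)))\<^sup>2
    = (freq \<alpha> \<kappa>)\<^sup>2 * (cmod (sine_coeff (fst U) \<kappa>))\<^sup>2 + (cmod (sine_coeff (snd U) \<kappa>))\<^sup>2"
proof -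
  have parallelogram: "(cmod (\<i> * a - b))\<^sup>2 + (cmod (- \<i> * a - b))\<^sup>2
      = 2 * ((cmod a)\<^sup>2 + (cmod b)\<^sup>2)" for a b
    unfolding cmod_power2 by (simp add: power2_eq_square algebra_simps)
  have c2: "(cmod (complex_of_real (1 / sqrt 2)))\<^sup>2 = 1 / 2"
    unfolding norm_of_real by (simp add: power_divide)
  let ?a = "of_real (freq \<alpha> \<kappa>) * sine_coeff (fst U) \<kappa>" and ?b = "sine_coeff (snd U) \<kappa>"
  have "(cmod (energy_inner \<alpha> U (eigfun_branch \<alpha> True \<kappa>)))\<^sup>2
      + (cmod (energy_inner \<alpha> U (eigfun_branch \<alpha> False \<kappa>)))\<^sup>2
    = 1 / 2 * ((cmod (\<i> * ?a - ?b))\<^sup>2 + (cmod (- \<i> * ?a - ?b))\<^sup>2)"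
    unfolding energy_inner_eigfun[OF assms] norm_mult[of "of_real (1 / sqrt 2)"] power_mult_distrib
      sgn_branch_def c2
    by (simp add: mult.assoc)
  also have "\<dots> = (cmod ?a)\<^sup>2 + (cmod ?b)\<^sup>2" unfolding parallelogram by simp
  finally show ?thesis by (simp add: norm_mult power_mult_distrib)
qed

lemma energy_Parseval:
  assumes \<alpha>: "\<alpha> \<ge> 0" and U: "U \<in> energy_space"
  shows "((\<lambda>\<kappa>. (cmod (energy_inner \<alpha> U (eigfun_branch \<alpha> True \<kappa>)))\<^sup>2
      + (cmod (energy_inner \<alpha> U (eigfun_branch \<alpha> False \<kappa>)))\<^sup>2) has_sum (energy_norm \<alpha> U)\<^sup>2) multi_indices"
proof -
  have u: "fst U \<in> H10" using U by (auto simp: energy_space_def)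
  have "((\<lambda>\<kappa>. pi\<^sup>2 * real (sq_sum \<kappa>) * (cmod (sine_coeff (fst U) \<kappa>))\<^sup>2 + \<alpha> * (cmod (sine_coeff (fst U) \<kappa>))\<^sup>2
      + (cmod (sine_coeff (snd U) \<kappa>))\<^sup>2) has_sum (energy_norm \<alpha> U)\<^sup>2) multi_indices"
    unfolding energy_norm_square[OF \<alpha>]
    by (intro has_sum_add has_sum_cmult_right H10_gradient_Parseval u L2_Parseval)
  then show ?thesis
  proof (rule has_sum_cong[THEN iffD1, rotated])
    fix \<kappa> :: "'a multi_nat" assume "\<kappa> \<in> multi_indices"
    from energy_inner_eigfun_pair[OF \<alpha> this U]
    show "pi\<^sup>2 * real (sq_sum \<kappa>) * (cmod (sine_coeff (fst U) \<kappa>))\<^sup>2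
        + \<alpha> * (cmod (sine_coeff (fst U) \<kappa>))\<^sup>2 + (cmod (sine_coeff (snd U) \<kappa>))\<^sup>2
      = (cmod (energy_inner \<alpha> U (eigfun_branch \<alpha> True \<kappa>)))\<^sup>2
        + (cmod (energy_inner \<alpha> U (eigfun_branch \<alpha> False \<kappa>)))\<^sup>2"
      unfolding freq_square[OF \<alpha>] by (simp only: distrib_right)
  qed
qed

lemma energy_space_eqI:
  assumes \<alpha>: "\<alpha> \<ge> 0" and U: "U \<in> energy_space" "V \<in> energy_space"
    and eq: "\<And>s \<kappa>. \<kappa> \<in> multi_indices \<Longrightarrow>
      energy_inner \<alpha> U (eigfun_branch \<alpha> s \<kappa>) = energy_inner \<alpha> V (eigfun_branch \<alpha> s \<kappa>)"
  shows "U = V"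
proof -
  have "sine_coeff (fst U) \<kappa> = sine_coeff (fst V) \<kappa> \<and> sine_coeff (snd U) \<kappa> = sine_coeff (snd V) \<kappa>"
    if \<kappa>: "\<kappa> \<in> multi_indices" for \<kappa>
  proof -
    have e: "sgn_branch s * of_real (freq \<alpha> \<kappa>) * sine_coeff (fst U) \<kappa> - sine_coeff (snd U) \<kappa>
        = sgn_branch s * of_real (freq \<alpha> \<kappa>) * sine_coeff (fst V) \<kappa> - sine_coeff (snd V) \<kappa>" for s
      using eq[OF \<kappa>, of s] unfolding energy_inner_eigfun[OF \<alpha> \<kappa> U(1)] energy_inner_eigfun[OF \<alpha> \<kappa> U(2)]
      by simp
    have snd: "sine_coeff (snd U) \<kappa> = sine_coeff (snd V) \<kappa>"
      using e[of True] e[of False] by (simp add: sgn_branch_def) (simp add: complex_eq_iff)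
    then show ?thesis using e[of True] freq_pos[OF \<alpha> \<kappa>] by (simp add: sgn_branch_def)
  qed
  then show ?thesis by (auto intro!: prod_eqI L2_cube_eqI)
qed

lemma energy_norm_pos:
  assumes \<alpha>: "\<alpha> \<ge> 0" and U: "U \<in> energy_space" "U \<noteq> 0"
  shows "energy_norm \<alpha> U > 0"
proof (rule ccontr)
  assume "\<not> ?thesis"
  then have "energy_norm \<alpha> U = 0" using energy_norm_nonneg[OF \<alpha>, of U] by simp
  then have "(cmod (energy_inner \<alpha> U (eigfun_branch \<alpha> True \<kappa>)))\<^sup>2
      + (cmod (energy_inner \<alpha> U (eigfun_branch \<alpha> False \<kappa>)))\<^sup>2 = 0" if "\<kappa> \<in> multi_indices" for \<kappa>
    using nonneg_has_sum_le_0D[OF _ _ _ that] energy_Parseval[OF \<alpha> U(1)] by fastforce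
  then have z: "energy_inner \<alpha> U (eigfun_branch \<alpha> s \<kappa>) = 0" if "\<kappa> \<in> multi_indices" for s \<kappa>
    using that by (cases s) (auto simp: add_nonneg_eq_0_iff)
  have zero: "0 \<in> energy_space" by (simp add: energy_space_def zero_in_H10 zero_prod_def)
  have "U = 0"
    by (rule energy_space_eqI[OF \<alpha> U(1) zero])
       (simp add: z energy_inner_eigfun[OF \<alpha> _ zero] L2_inner_simps)
  then show False using U(2) by simp
qed

lemma energy_space_lincomb:
  assumes "U \<in> energy_space" "V \<in> energy_space"
  shows "cscale_state a U + cscale_state b V \<in> energy_space"
  using assms by (auto simp: energy_space_def cscale_state_def H10_lincomb plus_prod_def)

lemma energy_inner_lincomb:
  assumes \<alpha>: "\<alpha> \<ge> 0" and \<kappa>: "\<kappa> \<in> multi_indices" and U: "U \<in> energy_space" "V \<in> energy_space"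
  shows "energy_inner \<alpha> (cscale_state a U + cscale_state b V) (eigfun_branch \<alpha> s \<kappa>)
    = a * energy_inner \<alpha> U (eigfun_branch \<alpha> s \<kappa>) + b * energy_inner \<alpha> V (eigfun_branch \<alpha> s \<kappa>)"
  unfolding energy_inner_eigfun[OF \<alpha> \<kappa> energy_space_lincomb[OF U]]
    energy_inner_eigfun[OF \<alpha> \<kappa> U(1)] energy_inner_eigfun[OF \<alpha> \<kappa> U(2)]
  by (simp add: cscale_state_def L2_inner_simps algebra_simps)

lemma cscale_state_simps: "cscale_state 1 U = U" "cscale_state 0 U = 0"
  by (simp_all add: cscale_state_def zero_prod_def)

section \<open>The implicit Euler map\<close>

lemma euler_map_components:
  "fst (euler_map \<alpha> t U) = fst U - t *\<^sub>R snd U"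
  "snd (euler_map \<alpha> t U) = snd U + t *\<^sub>R (- laplacian (fst U) + \<alpha> *\<^sub>R fst U)"
  by (simp_all add: euler_map_def op_A_def)

lemma dom_A_subset: "dom_A \<subseteq> energy_space"
  by (auto simp: dom_A_def energy_space_def)

lemma euler_map_in_energy_space:
  assumes "U \<in> dom_A"
  shows "euler_map \<alpha> t U \<in> energy_space"
proof -
  have "cscale 1 (fst U) + cscale (- of_real t) (snd U) \<in> H10"
    using assms by (intro H10_lincomb) (auto simp: dom_A_def)
  then show ?thesis
    by (simp add: energy_space_def mem_Times_iff euler_map_components scaleR_eq_cscale)
qed

lemma euler_map_snd_coeff:
  assumes "\<alpha> \<ge> 0" "U \<in> dom_A"
  shows "sine_coeff (snd (euler_map \<alpha> t U)) \<kappa>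
    = sine_coeff (snd U) \<kappa> + of_real (t * (freq \<alpha> \<kappa>)\<^sup>2) * sine_coeff (fst U) \<kappa>"
  using assms laplacian_coefficient[of "fst U" \<kappa>]
  by (simp add: euler_map_components scaleR_eq_cscale L2_inner_simps dom_A_def mem_Times_iff
      freq_square algebra_simps)

text \<open>The two components mix, but the eigenfunction pairs with the image as with \<open>1 + t \<lambda>\<close> times the argument,
  because \<open>\<lambda>\<^sup>2 = - \<omega>\<^sup>2\<close>.\<close>

lemma energy_inner_euler_map:
  assumes \<alpha>: "\<alpha> \<ge> 0" and \<kappa>: "\<kappa> \<in> multi_indices" and U: "U \<in> dom_A"
  shows "energy_inner \<alpha> (euler_map \<alpha> t U) (eigfun_branch \<alpha> s \<kappa>)
    = (1 + of_real t * eigval_branch \<alpha> s \<kappa>) * energy_inner \<alpha> U (eigfun_branch \<alpha> s \<kappa>)"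
proof -
  have U': "U \<in> energy_space" using U dom_A_subset by blast
  let ?l = "sgn_branch s * of_real (freq \<alpha> \<kappa>)"
  have l: "of_real ((freq \<alpha> \<kappa>)\<^sup>2) = - (?l * ?l)"
    by (simp add: power2_eq_square mult.left_commute mult.assoc[symmetric])
  define c where "c = complex_of_real (1 / sqrt 2)"
  show ?thesis
    unfolding energy_inner_eigfun[OF \<alpha> \<kappa> euler_map_in_energy_space[OF U]]
      energy_inner_eigfun[OF \<alpha> \<kappa> U'] euler_map_snd_coeff[OF \<alpha> U] eigval_branch_eq of_real_mult l
      c_def[symmetric]
    by (simp add: euler_map_components scaleR_eq_cscale L2_inner_simps algebra_simps)
qed

lemma cmod_euler_factor:
  "cmod (1 + of_real t * eigval_branch \<alpha> s \<kappa>) = sqrt (1 + (freq \<alpha> \<kappa>)\<^sup>2 * t\<^sup>2)"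
  by (simp add: eigval_branch_eq sgn_branch_def cmod_def power_mult_distrib mult.commute)

lemma euler_factor_nonzero: "1 + of_real t * eigval_branch \<alpha> s \<kappa> \<noteq> 0"
proof -
  have "0 < 1 + (freq \<alpha> \<kappa>)\<^sup>2 * t\<^sup>2" by (intro add_pos_nonneg) auto
  then show ?thesis using cmod_euler_factor[of t \<alpha> s \<kappa>] by auto
qed

text \<open>Injectivity holds because no factor \<open>1 + t \<lambda>\<close> vanishes. For surjectivity onto \<open>(f, g)\<close>, the first equation
  gives \<open>z = (u - f) / t\<close>, and inserting this in the second leaves \<open>(1 + t\<^sup>2 \<omega>\<^sup>2) u = f + t g\<close> for the sine
  coefficients.\<close>

lemma euler_map_bij:
  assumes \<alpha>: "\<alpha> \<ge> 0" and t: "t > 0"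
  shows "bij_betw (euler_map \<alpha> t) dom_A (energy_space :: 'n::finite state set)"
  unfolding bij_betw_def
proof
  show "inj_on (euler_map \<alpha> t) (dom_A :: 'n state set)"
  proof
    fix U V :: "'n state" assume UV: "U \<in> dom_A" "V \<in> dom_A" "euler_map \<alpha> t U = euler_map \<alpha> t V"
    show "U = V"
    proof (rule energy_space_eqI[OF \<alpha>])
      show "U \<in> energy_space" "V \<in> energy_space" using UV dom_A_subset by blast+
      show "energy_inner \<alpha> U (eigfun_branch \<alpha> s \<kappa>) = energy_inner \<alpha> V (eigfun_branch \<alpha> s \<kappa>)"
        if "\<kappa> \<in> multi_indices" for s \<kappa>
      proof -
        have "(1 + of_real t * eigval_branch \<alpha> s \<kappa>) * energy_inner \<alpha> U (eigfun_branch \<alpha> s \<kappa>)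
            = (1 + of_real t * eigval_branch \<alpha> s \<kappa>) * energy_inner \<alpha> V (eigfun_branch \<alpha> s \<kappa>)"
          using energy_inner_euler_map[OF \<alpha> that UV(1), of t s]
            energy_inner_euler_map[OF \<alpha> that UV(2), of t s] UV(3) by metis
        then show ?thesis using mult_left_cancel[OF euler_factor_nonzero] by blast
      qed
    qed
  qed
  have "W \<in> euler_map \<alpha> t ` dom_A" if W: "W \<in> energy_space" for W :: "'n state"
  proof -
    obtain f g where fg: "W = (f, g)" "f \<in> H10" using W by (auto simp: energy_space_def)
    define h where "h = f + t *\<^sub>R g"
    define q where "q \<kappa> = 1 + t\<^sup>2 * (freq \<alpha> \<kappa>)\<^sup>2" for \<kappa> :: "'n multi_nat"
    define c where "c \<kappa> = sine_coeff h \<kappa> / of_real (q \<kappa>)" for \<kappa>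
    \<comment> \<open>With this constant, \<open>d * (1 + sq_sum \<kappa>) \<le> q \<kappa>\<close>: the resolvent gains two derivatives.\<close>
    define d where "d = min 1 (t\<^sup>2 * pi\<^sup>2)"
    have d: "d > 0" using t by (simp add: d_def)
    have q_ge: "d * (1 + real (sq_sum \<kappa>)) \<le> q \<kappa>" for \<kappa>
    proof -
      have "d * real (sq_sum \<kappa>) \<le> (t\<^sup>2 * pi\<^sup>2) * real (sq_sum \<kappa>)"
        by (intro mult_right_mono) (auto simp: d_def)
      moreover have "0 \<le> t\<^sup>2 * \<alpha>" using \<alpha> by simp
      moreover have "d \<le> 1" by (simp add: d_def)
      ultimately show ?thesis
        unfolding q_def freq_square[OF \<alpha>] by (simp add: algebra_simps)
    qed
    have q_pos: "q \<kappa> > 0" for \<kappa>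
      unfolding q_def by (intro add_pos_nonneg) auto
    have "(\<lambda>\<kappa>. (cmod (c \<kappa>))\<^sup>2 * (1 + real (sq_sum \<kappa>))\<^sup>2) summable_on multi_indices"
    proof (rule summable_on_comparison_test)
      show "(\<lambda>\<kappa>. (1 / d)\<^sup>2 * (cmod (sine_coeff h \<kappa>))\<^sup>2) summable_on multi_indices"
        by (intro summable_on_cmult_right Bessel_summable mode_orthonormal)
      fix \<kappa> :: "'n multi_nat"
      have "(1 + real (sq_sum \<kappa>)) / q \<kappa> \<le> 1 / d"
        using q_ge[of \<kappa>] q_pos[of \<kappa>] d by (simp add: field_simps)
      then have "((1 + real (sq_sum \<kappa>)) / q \<kappa>)\<^sup>2 \<le> (1 / d)\<^sup>2"
        using q_pos[of \<kappa>] by (intro power_mono) auto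
      then have "((1 + real (sq_sum \<kappa>)) / q \<kappa>)\<^sup>2 * (cmod (sine_coeff h \<kappa>))\<^sup>2
          \<le> (1 / d)\<^sup>2 * (cmod (sine_coeff h \<kappa>))\<^sup>2"
        by (rule mult_right_mono) simp
      moreover have "(cmod (c \<kappa>))\<^sup>2 * (1 + real (sq_sum \<kappa>))\<^sup>2
          = ((1 + real (sq_sum \<kappa>)) / q \<kappa>)\<^sup>2 * (cmod (sine_coeff h \<kappa>))\<^sup>2"
        using q_pos[of \<kappa>] by (simp add: c_def norm_divide power_divide)
      ultimately show "(cmod (c \<kappa>))\<^sup>2 * (1 + real (sq_sum \<kappa>))\<^sup>2 \<le> (1 / d)\<^sup>2 * (cmod (sine_coeff h \<kappa>))\<^sup>2"
        by simp
    qed simp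
    then obtain u where u: "u \<in> H2" "u \<in> H10" "\<And>\<kappa>. \<kappa> \<in> multi_indices \<Longrightarrow> sine_coeff u \<kappa> = c \<kappa>"
      using mode_series_in_H2_H10 by blast
    define z where "z = cscale (of_real (1 / t)) u + cscale (- of_real (1 / t)) f"
    have dom: "(u, z) \<in> dom_A"
      using u H10_lincomb[OF u(2) fg(2)] by (simp add: dom_A_def z_def del: cscale_minus_left)
    have "fst (euler_map \<alpha> t (u, z)) = f"
      using t by (simp add: euler_map_components z_def scaleR_eq_cscale flip: of_real_mult)
    moreover have "snd (euler_map \<alpha> t (u, z)) = g"
    proof (rule L2_cube_eqI)
      fix \<kappa> :: "'n multi_nat" assume \<kappa>: "\<kappa> \<in> multi_indices"
      have cu: "of_real (q \<kappa>) * sine_coeff u \<kappa> = sine_coeff f \<kappa> + of_real t * sine_coeff g \<kappa>"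
        using q_pos[of \<kappa>] by (simp add: u(3)[OF \<kappa>] c_def h_def scaleR_eq_cscale L2_inner_simps)
      have "sine_coeff (snd (euler_map \<alpha> t (u, z))) \<kappa>
          = (of_real (q \<kappa>) * sine_coeff u \<kappa> - sine_coeff f \<kappa>) / of_real t"
        using t unfolding euler_map_snd_coeff[OF \<alpha> dom]
        by (simp add: z_def L2_inner_simps q_def field_simps power2_eq_square)
      also have "\<dots> = sine_coeff g \<kappa>" using t by (simp add: cu)
      finally show "sine_coeff (snd (euler_map \<alpha> t (u, z))) \<kappa> = sine_coeff g \<kappa>" .
    qed
    ultimately have "euler_map \<alpha> t (u, z) = W" using fg(1) by (simp add: prod_eq_iff)
    then show ?thesis using dom by blast
  qed
  then show "euler_map \<alpha> t ` dom_A = (energy_space :: 'n state set)"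
    using euler_map_in_energy_space by blast
qed

section \<open>Powers of the resolvent\<close>

lemma powr_neg_half_square:
  fixes q :: real
  assumes "q > 0"
  shows "(q powr (- (real n / 2)))\<^sup>2 = 1 / q ^ n"
proof -
  have "(q powr (- (real n / 2)))\<^sup>2 = q powr (- real n)"
    unfolding power2_eq_square powr_add[symmetric] by simp
  then show ?thesis using assms by (simp add: powr_minus_divide powr_realpow)
qed

lemma euler_inv:
  fixes U :: "'n::finite state"
  assumes "\<alpha> \<ge> 0" "t > 0" "U \<in> energy_space"
  shows "euler_inv \<alpha> t U \<in> dom_A" "euler_map \<alpha> t (euler_inv \<alpha> t U) = U"
proof -
  have "U \<in> euler_map \<alpha> t ` dom_A"
    using euler_map_bij[OF assms(1,2), where 'n = 'n] assms(3) by (simp add: bij_betw_def)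
  then show "euler_inv \<alpha> t U \<in> dom_A" "euler_map \<alpha> t (euler_inv \<alpha> t U) = U"
    by (auto simp: euler_inv_def inv_into_into f_inv_into_f)
qed

text \<open>Each application of the resolvent divides the coefficient by \<open>1 + t \<lambda>\<close>.\<close>

lemma euler_inv_pow:
  assumes \<alpha>: "\<alpha> \<ge> 0" and t: "t > 0" and U: "U \<in> energy_space"
  shows "euler_inv_pow \<alpha> t n U \<in> energy_space \<and> (\<forall>\<kappa>\<in>multi_indices. \<forall>s.
    energy_inner \<alpha> (euler_inv_pow \<alpha> t n U) (eigfun_branch \<alpha> s \<kappa>)
      = energy_inner \<alpha> U (eigfun_branch \<alpha> s \<kappa>) / (1 + of_real t * eigval_branch \<alpha> s \<kappa>) ^ n)"
proof (induction n)
  case 0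
  then show ?case using U by (simp add: euler_inv_pow_def)
next
  case (Suc n)
  let ?V = "euler_inv_pow \<alpha> t n U"
  have V: "?V \<in> energy_space" using Suc by blast
  have eq: "euler_inv_pow \<alpha> t (Suc n) U = euler_inv \<alpha> t ?V" by (simp add: euler_inv_pow_def)
  note inv = euler_inv[OF \<alpha> t V]
  have "energy_inner \<alpha> (euler_inv \<alpha> t ?V) (eigfun_branch \<alpha> s \<kappa>)
      = energy_inner \<alpha> ?V (eigfun_branch \<alpha> s \<kappa>) / (1 + of_real t * eigval_branch \<alpha> s \<kappa>)"
    if "\<kappa> \<in> multi_indices" for s \<kappa>
    using energy_inner_euler_map[OF \<alpha> that inv(1), of t s] euler_factor_nonzero[of t \<alpha> s \<kappa>]
    by (simp add: inv(2))
  then show ?case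
    using Suc inv(1) dom_A_subset unfolding eq by (auto simp: mult.commute)
qed

lemma cmod_energy_inner_euler_inv_pow:
  assumes "\<alpha> \<ge> 0" "t > 0" "U \<in> energy_space" "\<kappa> \<in> multi_indices"
  shows "cmod (energy_inner \<alpha> (euler_inv_pow \<alpha> t n U) (eigfun_branch \<alpha> s \<kappa>))
    = cmod (energy_inner \<alpha> U (eigfun_branch \<alpha> s \<kappa>)) / sqrt (1 + (freq \<alpha> \<kappa>)\<^sup>2 * t\<^sup>2) ^ n"
  using euler_inv_pow[OF assms(1-3), of n] assms(4)
  by (simp add: norm_divide norm_power cmod_euler_factor)

lemma cmod_square_energy_inner_euler_inv_pow:
  assumes "\<alpha> \<ge> 0" "t > 0" "U \<in> energy_space" "\<kappa> \<in> multi_indices"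
  shows "(cmod (energy_inner \<alpha> (euler_inv_pow \<alpha> t n U) (eigfun_branch \<alpha> s \<kappa>)))\<^sup>2
    = (cmod (energy_inner \<alpha> U (eigfun_branch \<alpha> s \<kappa>)))\<^sup>2 / (1 + (freq \<alpha> \<kappa>)\<^sup>2 * t\<^sup>2) ^ n"
proof -
  have "(sqrt (1 + (freq \<alpha> \<kappa>)\<^sup>2 * t\<^sup>2) ^ n)\<^sup>2 = ((sqrt (1 + (freq \<alpha> \<kappa>)\<^sup>2 * t\<^sup>2))\<^sup>2) ^ n"
    by (simp only: power_mult[symmetric] mult.commute)
  also have "\<dots> = (1 + (freq \<alpha> \<kappa>)\<^sup>2 * t\<^sup>2) ^ n" by simp
  finally show ?thesis
    by (simp add: cmod_energy_inner_euler_inv_pow[OF assms] power_divide)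
qed

lemma energy_norm_euler_inv_pow_has_sum:
  assumes "\<alpha> \<ge> 0" "t > 0" "U \<in> energy_space"
  shows "((\<lambda>\<kappa>. (cmod (energy_inner \<alpha> U (eigfun_branch \<alpha> True \<kappa>)))\<^sup>2 / (1 + (freq \<alpha> \<kappa>)\<^sup>2 * t\<^sup>2) ^ n
      + (cmod (energy_inner \<alpha> U (eigfun_branch \<alpha> False \<kappa>)))\<^sup>2 / (1 + (freq \<alpha> \<kappa>)\<^sup>2 * t\<^sup>2) ^ n)
    has_sum (energy_norm \<alpha> (euler_inv_pow \<alpha> t n U))\<^sup>2) multi_indices"
  using energy_Parseval[OF assms(1) conjunct1[OF euler_inv_pow[OF assms, of n]]]
  by (rule has_sum_cong[THEN iffD1, rotated])
     (simp add: cmod_square_energy_inner_euler_inv_pow[OF assms])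

text \<open>No weight in the sum for the left-hand side exceeds that of the lowest frequency.\<close>

lemma energy_norm_euler_inv_pow_le:
  fixes U :: "'n::finite state"
  assumes \<alpha>: "\<alpha> \<ge> 0" and t: "t > 0" and U: "U \<in> energy_space"
  shows "energy_norm \<alpha> (euler_inv_pow \<alpha> t n U)
    \<le> (1 + (sqrt (real CARD('n) * pi\<^sup>2 + \<alpha>))\<^sup>2 * t\<^sup>2) powr (- (real n / 2)) * energy_norm \<alpha> U"
proof -
  define w where "w = sqrt (real CARD('n) * pi\<^sup>2 + \<alpha>)"
  define q where "q = 1 + w\<^sup>2 * t\<^sup>2"
  have q: "q > 0" unfolding q_def by (intro add_pos_nonneg) auto
  have "(energy_norm \<alpha> (euler_inv_pow \<alpha> t n U))\<^sup>2 \<le> (1 / q ^ n) * (energy_norm \<alpha> U)\<^sup>2"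
  proof (rule has_sum_mono[OF energy_norm_euler_inv_pow_has_sum[OF assms]
        has_sum_cmult_right[OF energy_Parseval[OF \<alpha> U]]])
    fix \<kappa> :: "'n multi_nat" assume \<kappa>: "\<kappa> \<in> multi_indices"
    have "w\<^sup>2 \<le> (freq \<alpha> \<kappa>)\<^sup>2"
      unfolding w_def using freq_ge[OF \<alpha> \<kappa>] \<alpha> by (intro power_mono) auto
    then have "q \<le> 1 + (freq \<alpha> \<kappa>)\<^sup>2 * t\<^sup>2" unfolding q_def by (simp add: mult_right_mono)
    then have "q ^ n \<le> (1 + (freq \<alpha> \<kappa>)\<^sup>2 * t\<^sup>2) ^ n" using q by (intro power_mono) auto
    then have "x / (1 + (freq \<alpha> \<kappa>)\<^sup>2 * t\<^sup>2) ^ n \<le> (1 / q ^ n) * x" if "x \<ge> 0" for x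
      using q that by (simp add: frac_le)
    from add_mono[OF this this]
    show "(cmod (energy_inner \<alpha> U (eigfun_branch \<alpha> True \<kappa>)))\<^sup>2 / (1 + (freq \<alpha> \<kappa>)\<^sup>2 * t\<^sup>2) ^ n
        + (cmod (energy_inner \<alpha> U (eigfun_branch \<alpha> False \<kappa>)))\<^sup>2 / (1 + (freq \<alpha> \<kappa>)\<^sup>2 * t\<^sup>2) ^ n
      \<le> (1 / q ^ n) * ((cmod (energy_inner \<alpha> U (eigfun_branch \<alpha> True \<kappa>)))\<^sup>2
        + (cmod (energy_inner \<alpha> U (eigfun_branch \<alpha> False \<kappa>)))\<^sup>2)"
      by (simp only: distrib_left zero_le_power2)
  qed
  also have "1 / q ^ n = (q powr (- (real n / 2)))\<^sup>2"
    by (rule powr_neg_half_square[OF q, symmetric])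
  finally have "(energy_norm \<alpha> (euler_inv_pow \<alpha> t n U))\<^sup>2 \<le> (q powr (- (real n / 2)) * energy_norm \<alpha> U)\<^sup>2"
    by (simp add: power_mult_distrib)
  then show ?thesis
    unfolding w_def[symmetric] q_def[symmetric]
    by (rule power2_le_imp_le) (simp add: energy_norm_nonneg[OF \<alpha>])
qed

text \<open>The eigenfunction of the lowest frequency is a unit vector with a single nonzero coefficient, so the bound
  of the preceding lemma is attained.\<close>

lemma energy_norm_euler_inv_pow_lowest_mode:
  fixes \<phi> :: "'n::finite state"
  assumes \<alpha>: "\<alpha> \<ge> 0" and t: "t > 0"
  defines "\<phi> \<equiv> eigfun_branch \<alpha> True (\<chi> j. 1)"
  shows "\<phi> \<in> energy_space" "energy_norm \<alpha> \<phi> = 1"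
    "energy_norm \<alpha> (euler_inv_pow \<alpha> t n \<phi>)
      = (1 + (sqrt (real CARD('n) * pi\<^sup>2 + \<alpha>))\<^sup>2 * t\<^sup>2) powr (- (real n / 2))"
proof -
  define \<kappa>\<^sub>0 :: "'n multi_nat" where "\<kappa>\<^sub>0 = (\<chi> j. 1)"
  define w where "w = freq \<alpha> \<kappa>\<^sub>0"
  have \<kappa>\<^sub>0: "\<kappa>\<^sub>0 \<in> multi_indices" by (simp add: \<kappa>\<^sub>0_def multi_indices_def)
  have w: "w > 0" unfolding w_def by (rule freq_pos[OF \<alpha> \<kappa>\<^sub>0])
  define a where "a = complex_of_real (1 / sqrt 2) * (1 / eigval_branch \<alpha> True \<kappa>\<^sub>0)"
  have \<phi>: "\<phi> = (cscale a (mode {} \<kappa>\<^sub>0), cscale (- of_real (1 / sqrt 2)) (mode {} \<kappa>\<^sub>0))"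
    unfolding \<phi>_def \<kappa>\<^sub>0_def[symmetric]
    by (simp add: eigfun_branch_def cscale_state_def sine_fun_eq_mode_fun mode_def a_def)
  show E: "\<phi> \<in> energy_space"
    using H10_lincomb[OF mode_in_H10(1)[of \<kappa>\<^sub>0] mode_in_H10(1)[of \<kappa>\<^sub>0], of a 0]
    by (simp add: \<phi> energy_space_def)
  have sc: "sine_coeff (mode {} \<kappa>\<^sub>0) \<kappa> = (if \<kappa> = \<kappa>\<^sub>0 then 1 else 0)" if "\<kappa> \<in> multi_indices" for \<kappa>
    using mode_orthonormal[of "{}"] that \<kappa>\<^sub>0 by (auto simp: orthonormal_def)
  have c: "complex_of_real (1 / sqrt 2) * complex_of_real (1 / sqrt 2) = 1 / 2"
    by (simp flip: of_real_mult)
  have pair: "energy_inner \<alpha> \<phi> (eigfun_branch \<alpha> s \<kappa>) = (if \<kappa> = \<kappa>\<^sub>0 \<and> s then 1 else 0)"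
    if "\<kappa> \<in> multi_indices" for s \<kappa>
  proof (cases "\<kappa> = \<kappa>\<^sub>0")
    case True
    have "sgn_branch s * of_real w * a = of_real (1 / sqrt 2) * (sgn_branch s / sgn_branch True)"
      using w unfolding a_def eigval_branch_eq w_def[symmetric] by simp
    then have "energy_inner \<alpha> \<phi> (eigfun_branch \<alpha> s \<kappa>)
        = of_real (1 / sqrt 2) * (of_real (1 / sqrt 2) * (sgn_branch s / sgn_branch True) + of_real (1 / sqrt 2))"
      unfolding energy_inner_eigfun[OF \<alpha> that E] using True sc[OF \<kappa>\<^sub>0]
      by (simp add: \<phi> L2_inner_simps w_def)
    also have "\<dots> = (of_real (1 / sqrt 2) * of_real (1 / sqrt 2)) * (sgn_branch s / sgn_branch True + 1)"
      by (simp only: distrib_left mult.assoc mult_1_right)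
    also have "\<dots> = (if s then 1 else 0)" unfolding c by (simp add: sgn_branch_def)
    finally show ?thesis using True by simp
  next
    case False
    then show ?thesis
      unfolding energy_inner_eigfun[OF \<alpha> that E] using sc[OF that] by (simp add: \<phi> L2_inner_simps)
  qed
  have norm: "(energy_norm \<alpha> (euler_inv_pow \<alpha> t n \<phi>))\<^sup>2 = 1 / (1 + w\<^sup>2 * t\<^sup>2) ^ n" for n
  proof (rule has_sum_unique[OF energy_norm_euler_inv_pow_has_sum[OF \<alpha> t E]])
    have "((\<lambda>\<kappa>. 1 / (1 + w\<^sup>2 * t\<^sup>2) ^ n) has_sum 1 / (1 + w\<^sup>2 * t\<^sup>2) ^ n) {\<kappa>\<^sub>0}"
      by (rule has_sum_finiteI) auto
    then show "((\<lambda>\<kappa>. (cmod (energy_inner \<alpha> \<phi> (eigfun_branch \<alpha> True \<kappa>)))\<^sup>2 / (1 + (freq \<alpha> \<kappa>)\<^sup>2 * t\<^sup>2) ^ n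
        + (cmod (energy_inner \<alpha> \<phi> (eigfun_branch \<alpha> False \<kappa>)))\<^sup>2 / (1 + (freq \<alpha> \<kappa>)\<^sup>2 * t\<^sup>2) ^ n)
      has_sum 1 / (1 + w\<^sup>2 * t\<^sup>2) ^ n) multi_indices"
      by (rule has_sum_cong_neutral[THEN iffD1, rotated -1])
         (use \<kappa>\<^sub>0 in \<open>auto simp: pair w_def\<close>)
  qed
  show "energy_norm \<alpha> \<phi> = 1"
    using norm[of 0] energy_norm_nonneg[OF \<alpha>, of \<phi>]
    by (simp add: euler_inv_pow_def power2_eq_1_iff)
  have q: "1 + w\<^sup>2 * t\<^sup>2 > 0" by (intro add_pos_nonneg) auto
  have "(energy_norm \<alpha> (euler_inv_pow \<alpha> t n \<phi>))\<^sup>2 = ((1 + w\<^sup>2 * t\<^sup>2) powr (- (real n / 2)))\<^sup>2"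
    unfolding norm by (rule powr_neg_half_square[OF q, symmetric])
  then have "energy_norm \<alpha> (euler_inv_pow \<alpha> t n \<phi>) = (1 + w\<^sup>2 * t\<^sup>2) powr (- (real n / 2))"
    by (simp add: energy_norm_nonneg[OF \<alpha>])
  then show "energy_norm \<alpha> (euler_inv_pow \<alpha> t n \<phi>)
      = (1 + (sqrt (real CARD('n) * pi\<^sup>2 + \<alpha>))\<^sup>2 * t\<^sup>2) powr (- (real n / 2))"
    by (simp only: w_def \<kappa>\<^sub>0_def freq_ones)
qed

text \<open>Both sides lie in the energy space and have the same coefficients.\<close>

lemma euler_inv_pow_lincomb:
  fixes U V :: "'n::finite state"
  assumes \<alpha>: "\<alpha> \<ge> 0" and t: "t > 0" and UV: "U \<in> energy_space" "V \<in> energy_space"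
  shows "euler_inv_pow \<alpha> t n (cscale_state a U + cscale_state b V)
    = cscale_state a (euler_inv_pow \<alpha> t n U) + cscale_state b (euler_inv_pow \<alpha> t n V)"
proof -
  note pow = euler_inv_pow[OF \<alpha> t, of _ n]
  have W: "cscale_state a U + cscale_state b V \<in> energy_space" by (rule energy_space_lincomb[OF UV])
  note in_E = conjunct1[OF pow]
  show ?thesis
  proof (rule energy_space_eqI[OF \<alpha> in_E[OF W] energy_space_lincomb[OF in_E[OF UV(1)] in_E[OF UV(2)]]])
    fix s and \<kappa> :: "'n multi_nat" assume \<kappa>: "\<kappa> \<in> multi_indices"
    show "energy_inner \<alpha> (euler_inv_pow \<alpha> t n (cscale_state a U + cscale_state b V)) (eigfun_branch \<alpha> s \<kappa>)
        = energy_inner \<alpha> (cscale_state a (euler_inv_pow \<alpha> t n U) + cscale_state b (euler_inv_pow \<alpha> t n V))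
            (eigfun_branch \<alpha> s \<kappa>)"
      unfolding energy_inner_lincomb[OF \<alpha> \<kappa> in_E[OF UV(1)] in_E[OF UV(2)]]
      using pow[OF W] pow[OF UV(1)] pow[OF UV(2)] \<kappa>
      by (simp add: energy_inner_lincomb[OF \<alpha> \<kappa> UV] add_divide_distrib)
  qed
qed

lemma euler_inv_pow_bounded:
  assumes \<alpha>: "\<alpha> \<ge> 0" and t: "t > 0"
  shows "(euler_inv_pow \<alpha> t n :: 'n::finite state \<Rightarrow> 'n state) \<in> bounded_operators \<alpha>"
proof -
  note lin = euler_inv_pow_lincomb[OF \<alpha> t, of _ _ n]
  have "euler_inv_pow \<alpha> t n (U + V) = euler_inv_pow \<alpha> t n U + euler_inv_pow \<alpha> t n V"
    if "U \<in> energy_space" "V \<in> energy_space" for U V :: "'n state"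
    using lin[OF that, of 1 1] by (simp add: cscale_state_simps)
  moreover have "euler_inv_pow \<alpha> t n (cscale_state c U) = cscale_state c (euler_inv_pow \<alpha> t n U)"
    if "U \<in> energy_space" for U :: "'n state" and c
    using lin[OF that that, of c 0] by (simp add: cscale_state_simps)
  ultimately show ?thesis
    unfolding bounded_operators_def
    using euler_inv_pow[OF \<alpha> t] energy_norm_euler_inv_pow_le[OF \<alpha> t] by blast
qed

lemma operator_norm_euler_inv_pow:
  assumes \<alpha>: "\<alpha> \<ge> 0" and t: "t > 0"
  shows "operator_norm \<alpha> (euler_inv_pow \<alpha> t n :: 'n::finite state \<Rightarrow> 'n state)
    = (1 + (sqrt (real CARD('n) * pi\<^sup>2 + \<alpha>))\<^sup>2 * t\<^sup>2) powr (- (real n / 2))" (is "_ = ?q")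
  unfolding operator_norm_def
proof (rule cSup_eq_maximum)
  show "?q \<in> (\<lambda>U. energy_norm \<alpha> (euler_inv_pow \<alpha> t n U))
      ` {U :: 'n state. U \<in> energy_space \<and> energy_norm \<alpha> U \<le> 1}"
    using energy_norm_euler_inv_pow_lowest_mode[OF \<alpha> t, where 'n = 'n]
    by (intro image_eqI[of _ _ "eigfun_branch \<alpha> True (\<chi> j. 1)"]) auto
next
  fix x assume "x \<in> (\<lambda>U. energy_norm \<alpha> (euler_inv_pow \<alpha> t n U))
      ` {U :: 'n state. U \<in> energy_space \<and> energy_norm \<alpha> U \<le> 1}"
  then obtain U :: "'n state" where U: "U \<in> energy_space" "energy_norm \<alpha> U \<le> 1"
    "x = energy_norm \<alpha> (euler_inv_pow \<alpha> t n U)" by blast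
  have "x \<le> ?q * energy_norm \<alpha> U" unfolding U(3) by (rule energy_norm_euler_inv_pow_le[OF \<alpha> t U(1)])
  also have "\<dots> \<le> ?q * 1" using U(2) by (intro mult_left_mono) auto
  finally show "x \<le> ?q" by simp
qed

theorem proposition19:
  fixes \<alpha> \<Delta>t :: real and n :: nat and \<Phi>\<^sub>0 :: "'n::{finite,linorder} state"
  assumes "\<alpha> \<ge> 0" and "\<Delta>t > 0" and "n \<ge> 1" and "\<Phi>\<^sub>0 \<in> energy_space"
  shows
    "(bij_betw (euler_map \<alpha> \<Delta>t) (dom_A :: 'n state set) energy_space)
     \<and> ((\<lambda>j. (cmod (energy_inner \<alpha> \<Phi>\<^sub>0 (eigfun \<alpha> (Suc j))))\<^sup>2
            / (1 + (omega TYPE('n) \<alpha> (Suc j))\<^sup>2 * \<Delta>t\<^sup>2) ^ n)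
       sums (energy_norm \<alpha> (euler_inv_pow \<alpha> \<Delta>t n \<Phi>\<^sub>0))\<^sup>2)
     \<and> ((euler_inv_pow \<alpha> \<Delta>t n :: 'n state \<Rightarrow> 'n state) \<in> bounded_operators \<alpha>)
     \<and> (operator_norm \<alpha> (euler_inv_pow \<alpha> \<Delta>t n :: 'n state \<Rightarrow> 'n state)
       = (1 + (omega_min TYPE('n) \<alpha>)\<^sup>2 * \<Delta>t\<^sup>2) powr (- (real n / 2)))
     \<and> ((1 + (omega_min TYPE('n) \<alpha>)\<^sup>2 * \<Delta>t\<^sup>2) powr (- (real n / 2)) < 1)
     \<and> (omega_min TYPE('n) \<alpha> = sqrt (real CARD('n) * pi\<^sup>2 + \<alpha>))
     \<and> (omega_min TYPE('n) \<alpha> > 0)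
     \<and> (\<exists>k\<ge>1. (mode_index k :: 'n multi_nat) = (\<chi> j. 1))
     \<and> (\<forall>k\<ge>1. (mode_index k :: 'n multi_nat) = (\<chi> j. 1) \<longrightarrow>
       \<bar>omega TYPE('n) \<alpha> k\<bar> = omega_min TYPE('n) \<alpha>)
     \<and> (\<Phi>\<^sub>0 \<noteq> 0 \<longrightarrow> energy_norm \<alpha> (euler_inv_pow \<alpha> \<Delta>t n \<Phi>\<^sub>0) < energy_norm \<alpha> \<Phi>\<^sub>0)
     \<and> (\<forall>k\<ge>1. cmod (energy_inner \<alpha> (euler_inv_pow \<alpha> \<Delta>t n \<Phi>\<^sub>0) (eigfun \<alpha> k))
       = cmod (energy_inner \<alpha> \<Phi>\<^sub>0 (eigfun \<alpha> k))
           / (1 + (omega TYPE('n) \<alpha> k)\<^sup>2 * \<Delta>t\<^sup>2) powr (real n / 2))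
     \<and> (\<forall>k\<ge>1. cmod (energy_inner \<alpha> \<Phi>\<^sub>0 (eigfun \<alpha> k))
           / (1 + (omega TYPE('n) \<alpha> k)\<^sup>2 * \<Delta>t\<^sup>2) powr (real n / 2)
       \<le> cmod (energy_inner \<alpha> \<Phi>\<^sub>0 (eigfun \<alpha> k)) / (\<bar>omega TYPE('n) \<alpha> k\<bar> * \<Delta>t) ^ n)
     \<and> (\<forall>k\<ge>1. \<bar>omega TYPE('n) \<alpha> k\<bar> * \<Delta>t \<ge> 1 \<longrightarrow>
       cmod (energy_inner \<alpha> \<Phi>\<^sub>0 (eigfun \<alpha> k)) / (sqrt 2 * (\<bar>omega TYPE('n) \<alpha> k\<bar> * \<Delta>t)) ^ n
       \<le> cmod (energy_inner \<alpha> (euler_inv_pow \<alpha> \<Delta>t n \<Phi>\<^sub>0) (eigfun \<alpha> k)))"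
proof -
  note \<alpha> = assms(1) and t = assms(2) and U = assms(4)
  let ?w = "sqrt (real CARD('n) * pi\<^sup>2 + \<alpha>)"
  let ?q = "(1 + (omega_min TYPE('n) \<alpha>)\<^sup>2 * \<Delta>t\<^sup>2) powr (- (real n / 2))"
  let ?f = "\<lambda>k. cmod (energy_inner \<alpha> \<Phi>\<^sub>0 (eigfun \<alpha> k))"
  let ?om = "omega TYPE('n) \<alpha>"
  have w: "0 < ?w" using lowest_freq_pos[OF \<alpha>, where 'n = 'n] .
  have om_min: "omega_min TYPE('n) \<alpha> = ?w" by (rule omega_min_eq[OF \<alpha>])
  have om2: "(?om k)\<^sup>2 = (freq \<alpha> (mode_index k :: 'n multi_nat))\<^sup>2" for k
    using abs_omega[OF \<alpha>, where 'n = 'n, of k] by (metis power2_abs)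
  have om_pos: "\<bar>?om k\<bar> > 0" for k
    unfolding abs_omega[OF \<alpha>] by (rule freq_pos[OF \<alpha> mode_index_in])
  have base: "1 < 1 + (?om k)\<^sup>2 * \<Delta>t\<^sup>2" for k
    using om_pos[of k] t by simp
  have root_pos: "0 < sqrt (1 + (?om k)\<^sup>2 * \<Delta>t\<^sup>2)" for k
    by (rule real_sqrt_gt_zero) (use base[of k] in linarith)
  have powr: "(1 + (?om k)\<^sup>2 * \<Delta>t\<^sup>2) powr (real n / 2) = sqrt (1 + (?om k)\<^sup>2 * \<Delta>t\<^sup>2) ^ n" for k
  proof -
    have "sqrt (1 + (?om k)\<^sup>2 * \<Delta>t\<^sup>2) ^ n = ((1 + (?om k)\<^sup>2 * \<Delta>t\<^sup>2) powr (1 / 2)) powr real n"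
      using base[of k] by (simp add: powr_half_sqrt powr_realpow)
    then show ?thesis by (simp add: powr_powr)
  qed
  have bij: "bij_betw (euler_map \<alpha> \<Delta>t) (dom_A :: 'n state set) energy_space"
    by (rule euler_map_bij[OF \<alpha> t])
  have sums: "(\<lambda>j. (?f (Suc j))\<^sup>2 / (1 + (?om (Suc j))\<^sup>2 * \<Delta>t\<^sup>2) ^ n)
      sums (energy_norm \<alpha> (euler_inv_pow \<alpha> \<Delta>t n \<Phi>\<^sub>0))\<^sup>2"
    using mode_sums[of "\<lambda>s \<kappa>. (cmod (energy_inner \<alpha> \<Phi>\<^sub>0 (eigfun_branch \<alpha> s \<kappa>)))\<^sup>2
        / (1 + (freq \<alpha> \<kappa>)\<^sup>2 * \<Delta>t\<^sup>2) ^ n", OF _ energy_norm_euler_inv_pow_has_sum[OF \<alpha> t U]]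
    by (simp add: eigfun_def om2)
  have q_less: "?q < 1"
    unfolding om_min using w t assms(3) by (intro powr_less_one) auto
  have ones: "(\<chi> j. 1) \<in> (multi_indices :: 'n multi_nat set)" by (simp add: multi_indices_def)
  have attained: "\<bar>?om k\<bar> = omega_min TYPE('n) \<alpha>" if "(mode_index k :: 'n multi_nat) = (\<chi> j. 1)" for k
    unfolding abs_omega[OF \<alpha>] that freq_ones om_min ..
  have contraction: "energy_norm \<alpha> (euler_inv_pow \<alpha> \<Delta>t n \<Phi>\<^sub>0) < energy_norm \<alpha> \<Phi>\<^sub>0" if "\<Phi>\<^sub>0 \<noteq> 0"
  proof -
    have "energy_norm \<alpha> (euler_inv_pow \<alpha> \<Delta>t n \<Phi>\<^sub>0) \<le> ?q * energy_norm \<alpha> \<Phi>\<^sub>0"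
      unfolding om_min by (rule energy_norm_euler_inv_pow_le[OF \<alpha> t U])
    also have "\<dots> < 1 * energy_norm \<alpha> \<Phi>\<^sub>0"
      by (rule mult_strict_right_mono[OF q_less energy_norm_pos[OF \<alpha> U that]])
    finally show ?thesis by simp
  qed
  have amplitude: "cmod (energy_inner \<alpha> (euler_inv_pow \<alpha> \<Delta>t n \<Phi>\<^sub>0) (eigfun \<alpha> k))
      = ?f k / (1 + (?om k)\<^sup>2 * \<Delta>t\<^sup>2) powr (real n / 2)" for k
    unfolding powr unfolding eigfun_def om2
    by (rule cmod_energy_inner_euler_inv_pow[OF \<alpha> t U mode_index_in])
  have damping: "?f k / (1 + (?om k)\<^sup>2 * \<Delta>t\<^sup>2) powr (real n / 2) \<le> ?f k / (\<bar>?om k\<bar> * \<Delta>t) ^ n" for k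
  proof -
    have "\<bar>?om k\<bar> * \<Delta>t \<le> sqrt (1 + (?om k)\<^sup>2 * \<Delta>t\<^sup>2)"
      by (rule real_le_rsqrt) (simp add: power_mult_distrib)
    then have "(\<bar>?om k\<bar> * \<Delta>t) ^ n \<le> sqrt (1 + (?om k)\<^sup>2 * \<Delta>t\<^sup>2) ^ n"
      using t by (intro power_mono) auto
    then show ?thesis
      unfolding powr using om_pos[of k] t
      by (intro divide_left_mono mult_pos_pos zero_less_power root_pos) auto
  qed
  have lower: "?f k / (sqrt 2 * (\<bar>?om k\<bar> * \<Delta>t)) ^ n
      \<le> cmod (energy_inner \<alpha> (euler_inv_pow \<alpha> \<Delta>t n \<Phi>\<^sub>0) (eigfun \<alpha> k))"
    if "\<bar>?om k\<bar> * \<Delta>t \<ge> 1" for k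
  proof -
    have "1 \<le> (\<bar>?om k\<bar> * \<Delta>t)\<^sup>2" using that by (rule one_le_power)
    moreover have "(\<bar>?om k\<bar> * \<Delta>t)\<^sup>2 = (?om k)\<^sup>2 * \<Delta>t\<^sup>2" by (simp add: power_mult_distrib)
    ultimately have "sqrt (1 + (?om k)\<^sup>2 * \<Delta>t\<^sup>2) \<le> sqrt (2 * (\<bar>?om k\<bar> * \<Delta>t)\<^sup>2)"
      by (intro real_sqrt_le_mono) linarith
    also have "\<dots> = sqrt 2 * (\<bar>?om k\<bar> * \<Delta>t)"
      using t by (simp add: real_sqrt_mult)
    finally have "sqrt (1 + (?om k)\<^sup>2 * \<Delta>t\<^sup>2) ^ n \<le> (sqrt 2 * (\<bar>?om k\<bar> * \<Delta>t)) ^ n"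
      by (intro power_mono less_imp_le[OF root_pos])
    then show ?thesis
      unfolding amplitude powr using om_pos[of k] t
      by (intro divide_left_mono mult_pos_pos zero_less_power root_pos) auto
  qed
  show ?thesis
    using bij sums euler_inv_pow_bounded[OF \<alpha> t] operator_norm_euler_inv_pow[OF \<alpha> t, where 'n = 'n]
      q_less om_min w mode_index_surj[OF ones] attained contraction amplitude damping lower
    by (auto simp only:)
qed

end
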